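(* Let $1 < p < \infty$ and let $C$ be a semi-compact positive operator on a separable infinite-dimensional space $L^p(M, \mu)$. Then $C$ is a commutator between two positive operators, i.e. there exist positive operators $A$ and $B$ on $L^p(M,\mu)$ such that $C = AB - BA$.
   Context: $L^p(M,\mu)$ is the Banach lattice of $p$-integrable functions on a measure space $(M,\mu)$ with the almost-everywhere order. $B_X$ denotes the closed unit ball of a Banach lattice $X$. A subset $A$ of $X$ is almost order bounded if for every $\epsilon > 0$ there is $u \ge 0$ in $X$ with $A \subseteq [-u,u] + \epsilon B_X$. An operator $T$ on $X$ is semi-compact if $T(B_X)$ is almost order bounded in $X$. *)

theory Defs
  imports "HOL-Analysis.Analysis"
begin

section \<open>The space \<open>L\<^sup>p(M)\<close> as a quotient modulo almost everywhere equality\<close>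

text \<open>
  The space depends on the term variables \<open>M\<close> and \<open>p\<close>, so it is given by an explicit carrier
  \<open>Lp M p\<close> whose elements are equivalence classes of functions. The scalars are real, and no
  finiteness condition is imposed on the measure.
\<close>

definition p_integrable_functions :: "'a measure \<Rightarrow> real \<Rightarrow> ('a \<Rightarrow> real) set" where
  "p_integrable_functions M p =
     {f \<in> borel_measurable M. integrable M (\<lambda>x. \<bar>f x\<bar> powr p)}"

definition AE_eq_rel :: "'a measure \<Rightarrow> real \<Rightarrow> (('a \<Rightarrow> real) \<times> ('a \<Rightarrow> real)) set" where
  "AE_eq_rel M p =
     {(f, g). f \<in> p_integrable_functions M p \<and> g \<in> p_integrable_functions M p \<and>
              (AE x in M. f x = g x)}"

definition Lp :: "'a measure \<Rightarrow> real \<Rightarrow> ('a \<Rightarrow> real) set set" where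
  "Lp M p = p_integrable_functions M p // AE_eq_rel M p"

definition Lp_class :: "'a measure \<Rightarrow> real \<Rightarrow> ('a \<Rightarrow> real) \<Rightarrow> ('a \<Rightarrow> real) set" where
  "Lp_class M p f = AE_eq_rel M p `` {f}"

text \<open>
  The operations are induced by those on representatives; the lemmas below show that they do not
  depend on the choice of representatives.
\<close>

definition Lp_zero :: "'a measure \<Rightarrow> real \<Rightarrow> ('a \<Rightarrow> real) set" where
  "Lp_zero M p = Lp_class M p (\<lambda>_. 0)"

definition Lp_add ::
    "'a measure \<Rightarrow> real \<Rightarrow> ('a \<Rightarrow> real) set \<Rightarrow> ('a \<Rightarrow> real) set \<Rightarrow> ('a \<Rightarrow> real) set" where
  "Lp_add M p F G = (\<Union>f\<in>F. \<Union>g\<in>G. Lp_class M p (\<lambda>x. f x + g x))"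

definition Lp_scale ::
    "'a measure \<Rightarrow> real \<Rightarrow> real \<Rightarrow> ('a \<Rightarrow> real) set \<Rightarrow> ('a \<Rightarrow> real) set" where
  "Lp_scale M p c F = (\<Union>f\<in>F. Lp_class M p (\<lambda>x. c * f x))"

definition Lp_diff ::
    "'a measure \<Rightarrow> real \<Rightarrow> ('a \<Rightarrow> real) set \<Rightarrow> ('a \<Rightarrow> real) set \<Rightarrow> ('a \<Rightarrow> real) set" where
  "Lp_diff M p F G = Lp_add M p F (Lp_scale M p (-1) G)"

definition Lp_norm :: "'a measure \<Rightarrow> real \<Rightarrow> ('a \<Rightarrow> real) set \<Rightarrow> real" where
  "Lp_norm M p F = the_elem ((\<lambda>f. (\<integral>x. \<bar>f x\<bar> powr p \<partial>M) powr (1 / p)) ` F)"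

definition Lp_le :: "'a measure \<Rightarrow> ('a \<Rightarrow> real) set \<Rightarrow> ('a \<Rightarrow> real) set \<Rightarrow> bool" where
  "Lp_le M F G \<longleftrightarrow> (\<forall>f\<in>F. \<forall>g\<in>G. AE x in M. f x \<le> g x)"

lemma p_integrable_functions_zero: "(\<lambda>_. 0) \<in> p_integrable_functions M p"
  by (simp add: p_integrable_functions_def)

lemma p_integrable_functions_add:
  assumes "p > 0" "f \<in> p_integrable_functions M p" "g \<in> p_integrable_functions M p"
  shows "(\<lambda>x. f x + g x) \<in> p_integrable_functions M p"
proof -
  have [measurable]: "f \<in> borel_measurable M" "g \<in> borel_measurable M"
    using assms by (auto simp: p_integrable_functions_def)
  have bound: "\<bar>a + b\<bar> powr p \<le> 2 powr p * (\<bar>a\<bar> powr p + \<bar>b\<bar> powr p)" for a b :: real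
  proof -
    have "\<bar>a + b\<bar> powr p \<le> (2 * max \<bar>a\<bar> \<bar>b\<bar>) powr p"
      using assms(1) by (intro powr_mono2) auto
    also have "\<dots> = 2 powr p * max \<bar>a\<bar> \<bar>b\<bar> powr p"
      by (simp add: powr_mult)
    also have "max \<bar>a\<bar> \<bar>b\<bar> powr p \<le> \<bar>a\<bar> powr p + \<bar>b\<bar> powr p"
      by (auto simp: max_def)
    finally show ?thesis by simp
  qed
  have "integrable M (\<lambda>x. 2 powr p * (\<bar>f x\<bar> powr p + \<bar>g x\<bar> powr p))"
    using assms by (auto simp: p_integrable_functions_def)
  then have "integrable M (\<lambda>x. \<bar>f x + g x\<bar> powr p)"
  proof (rule Bochner_Integration.integrable_bound)
    show "AE x in M. norm (\<bar>f x + g x\<bar> powr p)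
            \<le> norm (2 powr p * (\<bar>f x\<bar> powr p + \<bar>g x\<bar> powr p))"
      using bound by (auto simp: abs_mult)
  qed measurable
  then show ?thesis by (simp add: p_integrable_functions_def)
qed

lemma p_integrable_functions_scale:
  assumes "f \<in> p_integrable_functions M p"
  shows "(\<lambda>x. c * f x) \<in> p_integrable_functions M p"
  using assms by (auto simp: p_integrable_functions_def abs_mult powr_mult)

lemma equiv_AE_eq_rel: "equiv (p_integrable_functions M p) (AE_eq_rel M p)"
proof (rule equivI)
  show "AE_eq_rel M p \<subseteq> p_integrable_functions M p \<times> p_integrable_functions M p"
    by (auto simp: AE_eq_rel_def)
  show "refl_on (p_integrable_functions M p) (AE_eq_rel M p)"
    by (auto simp: refl_on_def AE_eq_rel_def)
  show "sym (AE_eq_rel M p)"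
    by (auto simp: sym_def AE_eq_rel_def elim: eventually_mono)
  show "trans (AE_eq_rel M p)"
  proof (rule transI)
    fix f g h assume "(f, g) \<in> AE_eq_rel M p" "(g, h) \<in> AE_eq_rel M p"
    then have ae: "AE x in M. f x = g x" "AE x in M. g x = h x"
      and fh: "f \<in> p_integrable_functions M p" "h \<in> p_integrable_functions M p"
      by (auto simp: AE_eq_rel_def)
    from ae have "AE x in M. f x = h x" by eventually_elim simp
    with fh show "(f, h) \<in> AE_eq_rel M p" by (simp add: AE_eq_rel_def)
  qed
qed

lemma mem_Lp_class:
  "g \<in> Lp_class M p f \<longleftrightarrow> f \<in> p_integrable_functions M p \<and> g \<in> p_integrable_functions M p \<and>
     (AE x in M. f x = g x)"
  by (auto simp: Lp_class_def AE_eq_rel_def)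

lemma Lp_class_eq_iff:
  assumes "f \<in> p_integrable_functions M p" "g \<in> p_integrable_functions M p"
  shows "Lp_class M p f = Lp_class M p g \<longleftrightarrow> (AE x in M. f x = g x)"
  using eq_equiv_class_iff[OF equiv_AE_eq_rel assms] assms
  by (simp add: Lp_class_def AE_eq_rel_def)

lemma Lp_class_self: "f \<in> p_integrable_functions M p \<Longrightarrow> f \<in> Lp_class M p f"
  by (simp add: mem_Lp_class)

lemma Lp_class_in_Lp: "f \<in> p_integrable_functions M p \<Longrightarrow> Lp_class M p f \<in> Lp M p"
  by (simp add: Lp_class_def Lp_def quotientI)

lemma Lp_cases:
  assumes "F \<in> Lp M p"
  obtains f where "f \<in> p_integrable_functions M p" "F = Lp_class M p f"
  using assms by (auto simp: Lp_def Lp_class_def elim: quotientE)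

lemma Lp_zero_in_Lp: "Lp_zero M p \<in> Lp M p"
  by (simp add: Lp_zero_def Lp_class_in_Lp p_integrable_functions_zero)

lemma Lp_add_class:
  assumes "p > 0" "f \<in> p_integrable_functions M p" "g \<in> p_integrable_functions M p"
  shows "Lp_add M p (Lp_class M p f) (Lp_class M p g) = Lp_class M p (\<lambda>x. f x + g x)"
proof -
  have "Lp_class M p (\<lambda>x. f' x + g' x) = Lp_class M p (\<lambda>x. f x + g x)"
    if "f' \<in> Lp_class M p f" "g' \<in> Lp_class M p g" for f' g'
  proof -
    have "AE x in M. f' x + g' x = f x + g x"
    proof -
      have "AE x in M. f x = f' x" "AE x in M. g x = g' x"
        using that by (simp_all add: mem_Lp_class)
      then show ?thesis by eventually_elim simp
    qed
    then show ?thesis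
      using that assms by (subst Lp_class_eq_iff) (auto simp: mem_Lp_class p_integrable_functions_add)
  qed
  then have "Lp_add M p (Lp_class M p f) (Lp_class M p g)
      = (\<Union>f'\<in>Lp_class M p f. \<Union>g'\<in>Lp_class M p g. Lp_class M p (\<lambda>x. f x + g x))"
    unfolding Lp_add_def by (intro SUP_cong refl)
  also have "\<dots> = Lp_class M p (\<lambda>x. f x + g x)"
    using Lp_class_self[OF assms(2)] Lp_class_self[OF assms(3)] by blast
  finally show ?thesis .
qed

lemma Lp_scale_class:
  assumes "f \<in> p_integrable_functions M p"
  shows "Lp_scale M p c (Lp_class M p f) = Lp_class M p (\<lambda>x. c * f x)"
proof -
  have "Lp_class M p (\<lambda>x. c * f' x) = Lp_class M p (\<lambda>x. c * f x)"
    if "f' \<in> Lp_class M p f" for f'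
  proof -
    have "AE x in M. c * f' x = c * f x"
    proof -
      have "AE x in M. f x = f' x"
        using that by (simp add: mem_Lp_class)
      then show ?thesis by eventually_elim simp
    qed
    then show ?thesis
      using that assms by (subst Lp_class_eq_iff) (auto simp: mem_Lp_class p_integrable_functions_scale)
  qed
  then have "Lp_scale M p c (Lp_class M p f)
      = (\<Union>f'\<in>Lp_class M p f. Lp_class M p (\<lambda>x. c * f x))"
    unfolding Lp_scale_def by (intro SUP_cong refl)
  also have "\<dots> = Lp_class M p (\<lambda>x. c * f x)"
    using Lp_class_self[OF assms] by blast
  finally show ?thesis .
qed

lemma Lp_norm_class:
  assumes "f \<in> p_integrable_functions M p"
  shows "Lp_norm M p (Lp_class M p f) = (\<integral>x. \<bar>f x\<bar> powr p \<partial>M) powr (1 / p)"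
proof -
  have "(\<integral>x. \<bar>g x\<bar> powr p \<partial>M) = (\<integral>x. \<bar>f x\<bar> powr p \<partial>M)" if "g \<in> Lp_class M p f" for g
  proof (rule integral_cong_AE)
    have "AE x in M. f x = g x"
      using that by (simp add: mem_Lp_class)
    then show "AE x in M. \<bar>g x\<bar> powr p = \<bar>f x\<bar> powr p" by eventually_elim simp
    have [measurable]: "f \<in> borel_measurable M" "g \<in> borel_measurable M"
      using that by (simp_all add: mem_Lp_class p_integrable_functions_def)
    show "(\<lambda>x. \<bar>g x\<bar> powr p) \<in> borel_measurable M" "(\<lambda>x. \<bar>f x\<bar> powr p) \<in> borel_measurable M"
      by measurable
  qed
  then have "(\<lambda>g. (\<integral>x. \<bar>g x\<bar> powr p \<partial>M) powr (1 / p)) ` Lp_class M p f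
      = (\<lambda>_. (\<integral>x. \<bar>f x\<bar> powr p \<partial>M) powr (1 / p)) ` Lp_class M p f"
    by (intro image_cong refl arg_cong[where f = "\<lambda>t. t powr (1 / p)"])
  also have "\<dots> = {(\<integral>x. \<bar>f x\<bar> powr p \<partial>M) powr (1 / p)}"
    using Lp_class_self[OF assms] by (intro image_constant)
  finally have "(\<lambda>g. (\<integral>x. \<bar>g x\<bar> powr p \<partial>M) powr (1 / p)) ` Lp_class M p f
      = {(\<integral>x. \<bar>f x\<bar> powr p \<partial>M) powr (1 / p)}" .
  then show ?thesis by (simp add: Lp_norm_def)
qed

lemma Lp_le_class:
  assumes "f \<in> p_integrable_functions M p" "g \<in> p_integrable_functions M p"
  shows "Lp_le M (Lp_class M p f) (Lp_class M p g) \<longleftrightarrow> (AE x in M. f x \<le> g x)"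
proof
  assume "Lp_le M (Lp_class M p f) (Lp_class M p g)"
  then show "AE x in M. f x \<le> g x"
    using Lp_class_self[OF assms(1)] Lp_class_self[OF assms(2)] unfolding Lp_le_def by blast
next
  assume le: "AE x in M. f x \<le> g x"
  show "Lp_le M (Lp_class M p f) (Lp_class M p g)"
    unfolding Lp_le_def
  proof (intro ballI)
    fix f' g' assume "f' \<in> Lp_class M p f" "g' \<in> Lp_class M p g"
    then have "AE x in M. f x = f' x" "AE x in M. g x = g' x"
      by (auto simp: mem_Lp_class)
    with le show "AE x in M. f' x \<le> g' x"
      by eventually_elim simp
  qed
qed

section \<open>Separability and dimension\<close>

definition Lp_separable :: "'a measure \<Rightarrow> real \<Rightarrow> bool" where
  "Lp_separable M p \<longleftrightarrow>
     (\<exists>D. D \<subseteq> Lp M p \<and> countable D \<and>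
          (\<forall>F\<in>Lp M p. \<forall>\<epsilon>>0. \<exists>G\<in>D. Lp_norm M p (Lp_diff M p F G) < \<epsilon>))"

inductive_set Lp_span ::
    "'a measure \<Rightarrow> real \<Rightarrow> ('a \<Rightarrow> real) set set \<Rightarrow> ('a \<Rightarrow> real) set set"
  for M p S where
  zero: "Lp_zero M p \<in> Lp_span M p S"
| step: "G \<in> S \<Longrightarrow> F \<in> Lp_span M p S \<Longrightarrow> Lp_add M p (Lp_scale M p c G) F \<in> Lp_span M p S"

definition Lp_infinite_dimensional :: "'a measure \<Rightarrow> real \<Rightarrow> bool" where
  "Lp_infinite_dimensional M p \<longleftrightarrow>
     \<not> (\<exists>S. finite S \<and> S \<subseteq> Lp M p \<and> Lp M p \<subseteq> Lp_span M p S)"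

section \<open>Operators\<close>

text \<open>
  Only the values of \<open>T\<close> on the carrier \<open>Lp M p\<close> are relevant.
\<close>

definition Lp_operator ::
    "'a measure \<Rightarrow> real \<Rightarrow> (('a \<Rightarrow> real) set \<Rightarrow> ('a \<Rightarrow> real) set) \<Rightarrow> bool" where
  "Lp_operator M p T \<longleftrightarrow>
     (\<forall>F\<in>Lp M p. T F \<in> Lp M p) \<and>
     (\<forall>F\<in>Lp M p. \<forall>G\<in>Lp M p. T (Lp_add M p F G) = Lp_add M p (T F) (T G)) \<and>
     (\<forall>c. \<forall>F\<in>Lp M p. T (Lp_scale M p c F) = Lp_scale M p c (T F)) \<and>
     (\<exists>K. \<forall>F\<in>Lp M p. Lp_norm M p (T F) \<le> K * Lp_norm M p F)"

definition Lp_positive_operator ::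
    "'a measure \<Rightarrow> real \<Rightarrow> (('a \<Rightarrow> real) set \<Rightarrow> ('a \<Rightarrow> real) set) \<Rightarrow> bool" where
  "Lp_positive_operator M p T \<longleftrightarrow>
     Lp_operator M p T \<and>
     (\<forall>F\<in>Lp M p. Lp_le M (Lp_zero M p) F \<longrightarrow> Lp_le M (Lp_zero M p) (T F))"

definition Lp_unit_ball :: "'a measure \<Rightarrow> real \<Rightarrow> ('a \<Rightarrow> real) set set" where
  "Lp_unit_ball M p = {F \<in> Lp M p. Lp_norm M p F \<le> 1}"

definition Lp_interval ::
    "'a measure \<Rightarrow> real \<Rightarrow> ('a \<Rightarrow> real) set \<Rightarrow> ('a \<Rightarrow> real) set \<Rightarrow> ('a \<Rightarrow> real) set set" where
  "Lp_interval M p U V = {F \<in> Lp M p. Lp_le M U F \<and> Lp_le M F V}"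

definition Lp_almost_order_bounded ::
    "'a measure \<Rightarrow> real \<Rightarrow> ('a \<Rightarrow> real) set set \<Rightarrow> bool" where
  "Lp_almost_order_bounded M p A \<longleftrightarrow>
     A \<subseteq> Lp M p \<and>
     (\<forall>\<epsilon>>0. \<exists>U\<in>Lp M p. Lp_le M (Lp_zero M p) U \<and>
        A \<subseteq> {Lp_add M p G (Lp_scale M p \<epsilon> H) | G H.
               G \<in> Lp_interval M p (Lp_scale M p (-1) U) U \<and> H \<in> Lp_unit_ball M p})"

definition Lp_semicompact ::
    "'a measure \<Rightarrow> real \<Rightarrow> (('a \<Rightarrow> real) set \<Rightarrow> ('a \<Rightarrow> real) set) \<Rightarrow> bool" where
  "Lp_semicompact M p T \<longleftrightarrow> Lp_almost_order_bounded M p (T ` Lp_unit_ball M p)"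

end

theory Submission
  imports Defs "HOL-Probability.Probability"
begin

text \<open>
  The commutator comes from a pair of positive operators \<open>S\<close>, \<open>L\<close> with \<open>LS = I\<close>. The series
  \<open>B = \<Sum>\<^sub>n S\<^bsup>n+1\<^esup> C L\<^sup>n\<close> telescopes formally: \<open>LB = \<Sum>\<^sub>n S\<^sup>n C L\<^sup>n\<close> and
  \<open>BL = \<Sum>\<^sub>n S\<^bsup>n+1\<^esup> C L\<^bsup>n+1\<^esup>\<close>, so \<open>LB - BL = C\<close>, and \<open>A = L\<close> and \<open>B\<close> are positive with \<open>C\<close>. The
  point is to choose \<open>S\<close> and \<open>L\<close> such that the series defines a bounded operator.

  Partition the measure space into sets \<open>E\<^sub>0, E\<^sub>1, \<dots>\<close> and let \<open>S\<close> carry the functions on \<open>E\<^sub>i\<close> into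
  those on \<open>E\<^bsub>i+1\<^esub>\<close> by a positive contraction that has a positive contractive left inverse, the
  corresponding part of \<open>L\<close>. A single entry of \<open>C\<close>, from \<open>E\<^sub>j\<close> to \<open>E\<^sub>m\<close>, then contributes to \<open>B\<close> terms
  with disjoint sources and disjoint targets, whose sum is bounded by the norm of that entry. So \<open>B\<close> is
  bounded as soon as the norms of the entries are summable, and for this it suffices that \<open>C\<close> is
  geometrically small both when restricted to functions on \<open>E\<^sub>j\<close> and when cut down to \<open>E\<^sub>m\<close>
  (\<open>shift_commutator.row_decay\<close>, \<open>shift_commutator.mass_cut_B\<close>).

  Semi-compactness makes \<open>C\<close> arbitrarily small, in both senses, far out in every disjoint sequence of
  sets. For the range this is immediate, since a fixed function has little mass on most of the sets
  (\<open>semicompact_pos_map.eventually_small_range\<close>). For the source, \<open>N\<close> disjointly supported functions of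
  norm one have a sum of norm only \<open>N\<^bsup>1/p\<^esup>\<close>, which is much smaller than \<open>N\<close>, while large images dominated
  up to a small error by one fixed function \<open>u\<close> would add up to order \<open>N\<close> when integrated against
  \<open>u\<^bsup>p-1\<^esup>\<close> (\<open>semicompact_pos_map.few_large_sources\<close>). Here \<open>p > 1\<close> enters.

  It remains to find a disjoint sequence of sets each of which carries a positively complemented copy of
  the whole space; a subsequence of it then serves as \<open>E\<^sub>1, E\<^sub>2, \<dots>\<close>. A separable space is, up to a
  weight, the \<open>L\<^sup>p\<close> space of a probability measure \<open>\<rho>\<close> on the real line (\<open>separable_coding\<close>). A map \<open>k\<close>
  that transports a weighted piece of the measure to \<open>\<rho>\<close> embeds \<open>L\<^sup>p(\<rho>)\<close> isometrically by composition,
  and conditional expectation given \<open>k\<close> is the positive left inverse (locale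
  \<open>weighted_composition\<close>). Finally \<open>\<rho>\<close> has infinitely many disjoint pieces that can be transported to all
  of \<open>\<rho>\<close>: if it has a part without atoms, pieces of that part are mapped by its distribution function and a quantile function; if it
  is purely atomic, its atoms are infinite in number by infinite-dimensionality and are split into
  infinitely many infinite families (\<open>disjoint_copies_exist\<close>).

  All estimates are for the integral of \<open>\<bar>f\<bar>\<^sup>p\<close> of functions, and the operators are handled through
  representatives whose laws hold almost everywhere; the last section translates to classes.
\<close>

section \<open>The integral of \<open>\<bar>f\<bar>\<^sup>p\<close>\<close>

text \<open>
  The \<open>p\<close>-th power of the norm. Taking values in the extended nonnegative reals makes it countably
  additive over disjoint sets without side conditions.
\<close>

definition pmass :: "'a measure \<Rightarrow> real \<Rightarrow> ('a \<Rightarrow> real) \<Rightarrow> ennreal" where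
  "pmass M p f = (\<integral>\<^sup>+x. ennreal (\<bar>f x\<bar> powr p) \<partial>M)"

abbreviation pfuns :: "'a measure \<Rightarrow> real \<Rightarrow> ('a \<Rightarrow> real) set" where
  "pfuns M p \<equiv> p_integrable_functions M p"

lemma pfuns_iff: "f \<in> pfuns M p \<longleftrightarrow> f \<in> borel_measurable M \<and> pmass M p f < \<infinity>"
proof -
  have "integrable M (\<lambda>x. \<bar>f x\<bar> powr p) \<longleftrightarrow> pmass M p f < \<infinity>" if "f \<in> borel_measurable M"
    using that by (simp add: integrable_iff_bounded pmass_def)
  then show ?thesis by (auto simp: p_integrable_functions_def)
qed

lemma pfuns_measurable [measurable_dest]: "f \<in> pfuns M p \<Longrightarrow> f \<in> borel_measurable M"
  by (simp add: pfuns_iff)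

lemma pmass_eq_integral:
  "f \<in> pfuns M p \<Longrightarrow> pmass M p f = ennreal (\<integral>x. \<bar>f x\<bar> powr p \<partial>M)"
  unfolding pmass_def by (rule nn_integral_eq_integral) (auto simp: p_integrable_functions_def)

lemma pmass_mono_AE:
  assumes "0 \<le> p" "AE x in M. \<bar>f x\<bar> \<le> \<bar>g x\<bar>"
  shows "pmass M p f \<le> pmass M p g"
  unfolding pmass_def
proof (rule nn_integral_mono_AE)
  show "AE x in M. ennreal (\<bar>f x\<bar> powr p) \<le> ennreal (\<bar>g x\<bar> powr p)"
    using assms(2) by eventually_elim (auto intro!: ennreal_leI powr_mono2 assms(1))
qed

lemma pmass_cong_AE: "AE x in M. f x = g x \<Longrightarrow> pmass M p f = pmass M p g"
  unfolding pmass_def by (rule nn_integral_cong_AE) auto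

lemma pmass_abs: "pmass M p (\<lambda>x. \<bar>f x\<bar>) = pmass M p f"
  by (simp add: pmass_def)

lemma pmass_zero [simp]: "pmass M p (\<lambda>_. 0) = 0"
  by (simp add: pmass_def)

lemma pmass_scale:
  assumes "f \<in> borel_measurable M"
  shows "pmass M p (\<lambda>x. c * f x) = ennreal (\<bar>c\<bar> powr p) * pmass M p f"
  using assms by (simp add: pmass_def abs_mult powr_mult nn_integral_cmult ennreal_mult)

lemma pmass_eq_0_iff:
  assumes "f \<in> borel_measurable M"
  shows "pmass M p f = 0 \<longleftrightarrow> (AE x in M. f x = 0)"
  using assms by (simp add: pmass_def nn_integral_0_iff_AE)

lemma pfuns_dominated:
  assumes "0 \<le> p" "g \<in> pfuns M p" "f \<in> borel_measurable M" "AE x in M. \<bar>f x\<bar> \<le> \<bar>g x\<bar>"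
  shows "f \<in> pfuns M p"
  using pmass_mono_AE[OF assms(1,4)] assms(2,3) by (auto simp: pfuns_iff)

lemma pfuns_cong_AE:
  assumes "g \<in> pfuns M p" "f \<in> borel_measurable M" "AE x in M. f x = g x"
  shows "f \<in> pfuns M p"
  using pmass_cong_AE[OF assms(3), of p] assms(1,2) by (simp add: pfuns_iff)

lemmas pfuns_zero [simp, intro] = p_integrable_functions_zero
lemmas pfuns_add = p_integrable_functions_add
lemmas pfuns_scale = p_integrable_functions_scale

lemma pfuns_abs: "f \<in> pfuns M p \<Longrightarrow> (\<lambda>x. \<bar>f x\<bar>) \<in> pfuns M p"
  by (auto simp: pfuns_iff pmass_abs)

lemma pfuns_diff:
  assumes "0 < p" "f \<in> pfuns M p" "g \<in> pfuns M p"
  shows "(\<lambda>x. f x - g x) \<in> pfuns M p"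
  using pfuns_add[OF assms(1,2) pfuns_scale[OF assms(3), of "-1"]] by simp

lemma pfuns_sum:
  assumes "0 < p" "\<And>i. i \<in> I \<Longrightarrow> f i \<in> pfuns M p"
  shows "(\<lambda>x. \<Sum>i\<in>I. f i x) \<in> pfuns M p"
  using assms(2)
proof (induction I rule: infinite_finite_induct)
  case (insert i I)
  then show ?case using pfuns_add[OF assms(1), of "f i" M "\<lambda>x. \<Sum>i\<in>I. f i x"] by simp
qed auto

definition cut :: "'a set \<Rightarrow> ('a \<Rightarrow> real) \<Rightarrow> 'a \<Rightarrow> real" where
  "cut G f = (\<lambda>x. if x \<in> G then f x else 0)"

lemma cut_measurable [measurable]:
  assumes [measurable]: "G \<in> sets M" "f \<in> borel_measurable M"
  shows "cut G f \<in> borel_measurable M"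
  unfolding cut_def by measurable

lemma cut_pfuns:
  assumes "0 < p" "G \<in> sets M" "f \<in> pfuns M p"
  shows "cut G f \<in> pfuns M p"
  using assms by (intro pfuns_dominated[OF _ assms(3)]) (auto simp: cut_def)

lemma cut_add: "cut G (\<lambda>x. f x + g x) = (\<lambda>x. cut G f x + cut G g x)"
  by (auto simp: cut_def)

lemma cut_scale: "cut G (\<lambda>x. c * f x) = (\<lambda>x. c * cut G f x)"
  by (auto simp: cut_def)

lemma pmass_cut_le: "0 < p \<Longrightarrow> pmass M p (cut G f) \<le> pmass M p f"
  by (rule pmass_mono_AE) (auto simp: cut_def)

text \<open>
  Countable additivity and continuity in the set come from reading the left-hand side as a measure.
\<close>

lemma pmass_cut:
  assumes "0 < p" "G \<in> sets M" "f \<in> borel_measurable M"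
  shows "pmass M p (cut G f) = emeasure (density M (\<lambda>x. ennreal (\<bar>f x\<bar> powr p))) G"
  using assms
  by (subst emeasure_density) (auto simp: pmass_def cut_def indicator_def intro!: nn_integral_cong)

text \<open>
  A sum is at most twice the largest of the numbers \<open>2\<^sup>m \<bar>y m\<bar>\<close>. Used in place of Minkowski's inequality,
  this can be integrated termwise, and the weights do no harm to summands that decay geometrically.
\<close>

lemma powr_sum_le:
  fixes y :: "nat \<Rightarrow> real"
  assumes "0 < p"
  shows "\<bar>\<Sum>m<n. y m\<bar> powr p \<le> 2 powr p * (\<Sum>m<n. 2 powr (real m * p) * \<bar>y m\<bar> powr p)"
proof (cases "n = 0")
  case False
  define z where "z = Max ((\<lambda>m. 2 ^ m * \<bar>y m\<bar>) ` {..<n})"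
  have z: "2 ^ m * \<bar>y m\<bar> \<le> z" if "m < n" for m
    unfolding z_def using that by (intro Max_ge) auto
  have "z \<in> (\<lambda>m. 2 ^ m * \<bar>y m\<bar>) ` {..<n}"
    unfolding z_def using False by (intro Max_in) auto
  then obtain k where k: "k < n" "z = 2 ^ k * \<bar>y k\<bar>" by auto
  have "\<bar>\<Sum>m<n. y m\<bar> \<le> (\<Sum>m<n. z * (1/2) ^ m)"
  proof (intro order_trans[OF sum_abs] sum_mono)
    fix m assume "m \<in> {..<n}"
    then show "\<bar>y m\<bar> \<le> z * (1/2) ^ m" using z[of m] by (simp add: field_simps)
  qed
  also have "\<dots> = z * (\<Sum>m<n. (1/2) ^ m)" by (simp add: sum_distrib_left)
  also have "\<dots> \<le> z * 2"
  proof (rule mult_left_mono)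
    show "(\<Sum>m<n. (1/2) ^ m) \<le> (2::real)" by (simp add: sum_gp_strict)
  qed (use k in simp)
  finally have "\<bar>\<Sum>m<n. y m\<bar> \<le> 2 * z" by simp
  then have "\<bar>\<Sum>m<n. y m\<bar> powr p \<le> (2 * z) powr p"
    using assms by (intro powr_mono2) auto
  also have "\<dots> = 2 powr p * (2 powr (real k * p) * \<bar>y k\<bar> powr p)"
    by (simp add: k powr_mult powr_powr powr_realpow[symmetric])
  also have "2 powr (real k * p) * \<bar>y k\<bar> powr p \<le> (\<Sum>m<n. 2 powr (real m * p) * \<bar>y m\<bar> powr p)"
    using k by (intro member_le_sum) auto
  finally show ?thesis by simp
qed (use assms in simp)

lemma powr_add_le:
  fixes a b :: real
  assumes "0 < p"
  shows "\<bar>a + b\<bar> powr p \<le> 2 powr p * (\<bar>a\<bar> powr p + \<bar>b\<bar> powr p)"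
proof -
  have "\<bar>a + b\<bar> powr p \<le> (2 * max \<bar>a\<bar> \<bar>b\<bar>) powr p"
    using assms by (intro powr_mono2) auto
  also have "\<dots> = 2 powr p * max \<bar>a\<bar> \<bar>b\<bar> powr p" by (simp add: powr_mult)
  also have "max \<bar>a\<bar> \<bar>b\<bar> powr p \<le> \<bar>a\<bar> powr p + \<bar>b\<bar> powr p" by (auto simp: max_def)
  finally show ?thesis by simp
qed

lemma pmass_add_le:
  assumes "0 < p" "f \<in> borel_measurable M" "g \<in> borel_measurable M"
  shows "pmass M p (\<lambda>x. f x + g x) \<le> ennreal (2 powr p) * (pmass M p f + pmass M p g)"
proof -
  have "pmass M p (\<lambda>x. f x + g x)
      \<le> (\<integral>\<^sup>+x. ennreal (2 powr p) * (ennreal (\<bar>f x\<bar> powr p) + ennreal (\<bar>g x\<bar> powr p)) \<partial>M)"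
    unfolding pmass_def using powr_add_le[OF assms(1)]
    by (intro nn_integral_mono) (simp flip: ennreal_mult' ennreal_plus)
  also have "\<dots> = ennreal (2 powr p) * (pmass M p f + pmass M p g)"
    using assms(2,3) by (simp add: pmass_def nn_integral_cmult nn_integral_add)
  finally show ?thesis .
qed

lemma pmass_sum_le:
  fixes y :: "nat \<Rightarrow> 'a \<Rightarrow> real"
  assumes "0 < p" and [measurable]: "\<And>m. y m \<in> borel_measurable M"
  shows "pmass M p (\<lambda>x. \<Sum>m<n. y m x)
    \<le> ennreal (2 powr p) * (\<Sum>m<n. ennreal (2 powr (real m * p)) * pmass M p (y m))"
proof -
  have "pmass M p (\<lambda>x. \<Sum>m<n. y m x)
      \<le> (\<integral>\<^sup>+x. ennreal (2 powr p) * (\<Sum>m<n. ennreal (2 powr (real m * p)) * ennreal (\<bar>y m x\<bar> powr p)) \<partial>M)"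
    unfolding pmass_def using powr_sum_le[OF assms(1)]
    by (intro nn_integral_mono) (simp flip: ennreal_mult' add: sum_nonneg)
  also have "\<dots> = ennreal (2 powr p) * (\<Sum>m<n. ennreal (2 powr (real m * p)) * pmass M p (y m))"
    unfolding pmass_def
    by (subst nn_integral_cmult, measurable, subst nn_integral_sum, measurable)
       (subst nn_integral_cmult, measurable)
  finally show ?thesis .
qed

section \<open>Positive maps modulo null sets\<close>

text \<open>
  The laws hold only almost everywhere: conditional expectations and representatives of operators on
  classes are determined no better than that. The constant \<open>K\<close> bounds the \<open>p\<close>-th power of the norm.
\<close>

locale pos_map =
  fixes M :: "'a measure" and N :: "'b measure" and p :: real and K :: ennreal
    and T :: "('a \<Rightarrow> real) \<Rightarrow> 'b \<Rightarrow> real"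
  assumes p_pos: "0 < p"
    and K_finite: "K < \<infinity>"
    and maps: "f \<in> pfuns M p \<Longrightarrow> T f \<in> pfuns N p"
    and add: "f \<in> pfuns M p \<Longrightarrow> g \<in> pfuns M p \<Longrightarrow> AE y in N. T (\<lambda>x. f x + g x) y = T f y + T g y"
    and scale: "f \<in> pfuns M p \<Longrightarrow> AE y in N. T (\<lambda>x. c * f x) y = c * T f y"
    and pos: "f \<in> pfuns M p \<Longrightarrow> AE x in M. 0 \<le> f x \<Longrightarrow> AE y in N. 0 \<le> T f y"
    and mass: "f \<in> pfuns M p \<Longrightarrow> pmass N p (T f) \<le> K * pmass M p f"
begin

lemma map_zero: "AE y in N. T (\<lambda>_. 0) y = 0"
  using scale[of "\<lambda>_. 0" 0] by simp

lemma map_diff: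
  assumes "f \<in> pfuns M p" "g \<in> pfuns M p"
  shows "AE y in N. T (\<lambda>x. f x - g x) y = T f y - T g y"
  using add[OF assms(1) pfuns_scale[OF assms(2), of "-1"]] scale[OF assms(2), of "-1"]
  by eventually_elim simp

lemma mono:
  assumes "f \<in> pfuns M p" "g \<in> pfuns M p" "AE x in M. f x \<le> g x"
  shows "AE y in N. T f y \<le> T g y"
proof -
  have "AE x in M. 0 \<le> g x - f x" using assms(3) by eventually_elim simp
  then have "AE y in N. 0 \<le> T (\<lambda>x. g x - f x) y"
    by (rule pos[OF pfuns_diff[OF p_pos assms(2,1)]])
  with map_diff[OF assms(2,1)] show ?thesis by eventually_elim simp
qed

lemma cong:
  assumes "f \<in> pfuns M p" "g \<in> pfuns M p" "AE x in M. f x = g x"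
  shows "AE y in N. T f y = T g y"
proof -
  have "AE x in M. f x \<le> g x" "AE x in M. g x \<le> f x"
    using assms(3) by (auto elim: eventually_mono)
  then show ?thesis
    using mono[OF assms(1,2)] mono[OF assms(2,1)] by (auto elim: eventually_elim2)
qed

lemma abs_le:
  assumes "f \<in> pfuns M p"
  shows "AE y in N. \<bar>T f y\<bar> \<le> T (\<lambda>x. \<bar>f x\<bar>) y"
proof -
  note a = pfuns_abs[OF assms] and m = pfuns_scale[OF assms, of "-1"]
  have "AE y in N. T f y \<le> T (\<lambda>x. \<bar>f x\<bar>) y" by (rule mono[OF assms a]) simp
  moreover have "AE y in N. T (\<lambda>x. -1 * f x) y \<le> T (\<lambda>x. \<bar>f x\<bar>) y" by (rule mono[OF m a]) simp
  ultimately show ?thesis using scale[OF assms, of "-1"] by eventually_elim auto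
qed

lemma sum:
  assumes "finite I" "\<And>i. i \<in> I \<Longrightarrow> f i \<in> pfuns M p"
  shows "AE y in N. T (\<lambda>x. \<Sum>i\<in>I. f i x) y = (\<Sum>i\<in>I. T (f i) y)"
  using assms
proof (induction I rule: finite_induct)
  case empty
  then show ?case using map_zero by simp
next
  case (insert i I)
  have "(\<lambda>x. \<Sum>i\<in>I. f i x) \<in> pfuns M p" using insert by (intro pfuns_sum p_pos) auto
  then have "AE y in N. T (\<lambda>x. f i x + (\<Sum>i\<in>I. f i x)) y = T (f i) y + T (\<lambda>x. \<Sum>i\<in>I. f i x) y"
    using insert by (intro add) auto
  moreover have "AE y in N. T (\<lambda>x. \<Sum>i\<in>I. f i x) y = (\<Sum>i\<in>I. T (f i) y)" using insert by auto
  ultimately show ?case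
    using insert(1,2) by (auto elim: eventually_elim2)
qed

end

lemma pos_map_compose:
  assumes "pos_map M N p K T" "pos_map N R p K' U"
  shows "pos_map M R p (K' * K) (\<lambda>f. U (T f))"
proof -
  interpret T: pos_map M N p K T by fact
  interpret U: pos_map N R p K' U by fact
  show ?thesis
  proof
    show "0 < p" by (rule T.p_pos)
    show "K' * K < \<infinity>" using T.K_finite U.K_finite by (simp add: ennreal_mult_less_top)
    show "U (T f) \<in> pfuns R p" if "f \<in> pfuns M p" for f using that by (intro U.maps T.maps)
    show "AE y in R. U (T (\<lambda>x. f x + g x)) y = U (T f) y + U (T g) y"
      if f: "f \<in> pfuns M p" and g: "g \<in> pfuns M p" for f g
    proof -
      have "AE y in R. U (T (\<lambda>x. f x + g x)) y = U (\<lambda>x. T f x + T g x) y"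
        by (rule U.cong) (auto intro!: T.maps f g T.add pfuns_add T.p_pos)
      with U.add[OF T.maps[OF f] T.maps[OF g]] show ?thesis by eventually_elim simp
    qed
    show "AE y in R. U (T (\<lambda>x. c * f x)) y = c * U (T f) y" if f: "f \<in> pfuns M p" for c f
    proof -
      have "AE y in R. U (T (\<lambda>x. c * f x)) y = U (\<lambda>x. c * T f x) y"
        by (rule U.cong) (auto intro!: T.maps f T.scale pfuns_scale)
      with U.scale[OF T.maps[OF f]] show ?thesis by eventually_elim simp
    qed
    show "AE y in R. 0 \<le> U (T f) y" if "f \<in> pfuns M p" "AE x in M. 0 \<le> f x" for f
      using that by (intro U.pos T.pos T.maps)
    show "pmass R p (U (T f)) \<le> K' * K * pmass M p f" if f: "f \<in> pfuns M p" for f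
      using order_trans[OF U.mass[OF T.maps[OF f]] mult_left_mono[OF T.mass[OF f]]]
      by (simp add: mult.assoc)
  qed
qed

lemma pos_map_id: "0 < p \<Longrightarrow> pos_map M M p 1 (\<lambda>f. f)"
  by standard auto

lemma pos_map_funpow:
  assumes "pos_map M M p 1 T"
  shows "pos_map M M p 1 (T ^^ n)"
proof (induction n)
  case 0
  then show ?case using pos_map_id[of p M] assms by (simp add: pos_map_def id_def)
next
  case (Suc n)
  then show ?case using pos_map_compose[OF Suc assms] by (simp add: o_def)
qed

lemma pos_map_cut:
  assumes "0 < p" "G \<in> sets M"
  shows "pos_map M M p 1 (cut G)"
  by standard (use assms in \<open>auto simp: cut_add cut_scale pmass_cut_le cut_pfuns\<close>, auto simp: cut_def elim: eventually_mono)

lemma pos_map_zero_map: "0 < p \<Longrightarrow> pos_map M N p 0 (\<lambda>f y. 0)"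
  by standard auto

lemma pos_map_sum_map:
  fixes T :: "nat \<Rightarrow> ('a \<Rightarrow> real) \<Rightarrow> 'b \<Rightarrow> real"
  assumes "0 < p" "\<And>i. \<exists>K. pos_map M N p K (T i)"
  shows "\<exists>K. pos_map M N p K (\<lambda>f y. \<Sum>i<n. T i f y)"
proof (induction n)
  case 0
  then show ?case using pos_map_zero_map[OF assms(1)] by auto
next
  case (Suc n)
  obtain K1 where K1: "pos_map M N p K1 (\<lambda>f y. \<Sum>i<n. T i f y)" using Suc by blast
  obtain K2 where K2: "pos_map M N p K2 (T n)" using assms(2) by blast
  interpret S: pos_map M N p K1 "\<lambda>f y. \<Sum>i<n. T i f y" by fact
  interpret T: pos_map M N p K2 "T n" by fact
  have "pos_map M N p (ennreal (2 powr p) * (K1 + K2)) (\<lambda>f y. (\<Sum>i<n. T i f y) + T n f y)"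
  proof
    show "ennreal (2 powr p) * (K1 + K2) < \<infinity>"
      using S.K_finite T.K_finite by (simp add: ennreal_mult_less_top)
    show "(\<lambda>y. (\<Sum>i<n. T i f y) + T n f y) \<in> pfuns N p" if "f \<in> pfuns M p" for f
      using that by (intro pfuns_add assms(1) S.maps T.maps)
    show "AE y in N. (\<Sum>i<n. T i (\<lambda>x. f x + g x) y) + T n (\<lambda>x. f x + g x) y =
        (\<Sum>i<n. T i f y) + T n f y + ((\<Sum>i<n. T i g y) + T n g y)"
      if "f \<in> pfuns M p" "g \<in> pfuns M p" for f g
      using S.add[OF that] T.add[OF that] by eventually_elim simp
    show "AE y in N. (\<Sum>i<n. T i (\<lambda>x. c * f x) y) + T n (\<lambda>x. c * f x) y =
        c * ((\<Sum>i<n. T i f y) + T n f y)" if "f \<in> pfuns M p" for c f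
      using S.scale[OF that, of c] T.scale[OF that, of c] by eventually_elim (simp add: distrib_left)
    show "AE y in N. 0 \<le> (\<Sum>i<n. T i f y) + T n f y"
      if "f \<in> pfuns M p" "AE x in M. 0 \<le> f x" for f
      using S.pos[OF that] T.pos[OF that] by eventually_elim simp
    show "pmass N p (\<lambda>y. (\<Sum>i<n. T i f y) + T n f y) \<le> ennreal (2 powr p) * (K1 + K2) * pmass M p f"
      if f: "f \<in> pfuns M p" for f
    proof -
      have "pmass N p (\<lambda>y. (\<Sum>i<n. T i f y) + T n f y)
          \<le> ennreal (2 powr p) * (pmass N p (\<lambda>y. \<Sum>i<n. T i f y) + pmass N p (T n f))"
        by (intro pmass_add_le assms(1) pfuns_measurable[OF S.maps[OF f]] pfuns_measurable[OF T.maps[OF f]])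
      also have "\<dots> \<le> ennreal (2 powr p) * (K1 * pmass M p f + K2 * pmass M p f)"
        by (intro mult_left_mono add_mono S.mass T.mass f) simp
      finally show ?thesis by (simp add: distrib_right mult.assoc)
    qed
  qed (rule assms(1))
  then show ?case by auto
qed

lemma cut_sum: "cut G (\<lambda>x. \<Sum>i\<in>I. f i x) = (\<lambda>x. \<Sum>i\<in>I. cut G (f i) x)"
  by (auto simp: cut_def)

lemma cut_cut_same [simp]: "cut G (cut G f) = cut G f"
  by (auto simp: cut_def)

section \<open>Semi-compact positive maps along disjoint sets\<close>

lemma finite_measure_pmass_density:
  assumes "f \<in> pfuns M p"
  shows "finite_measure (density M (\<lambda>x. ennreal (\<bar>f x\<bar> powr p)))"
proof
  have [measurable]: "f \<in> borel_measurable M" by (rule pfuns_measurable[OF assms])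
  have "emeasure (density M (\<lambda>x. ennreal (\<bar>f x\<bar> powr p))) (space M) = pmass M p f"
    by (subst emeasure_density) (auto simp: pmass_def intro!: nn_integral_cong)
  then show "emeasure (density M (\<lambda>x. ennreal (\<bar>f x\<bar> powr p)))
      (space (density M (\<lambda>x. ennreal (\<bar>f x\<bar> powr p)))) \<noteq> \<infinity>"
    using assms by (simp add: pfuns_iff)
qed

lemma pmass_cut_disjoint_tendsto_0:
  fixes G :: "nat \<Rightarrow> 'a set"
  assumes "0 < p" "f \<in> pfuns M p" "range G \<subseteq> sets M" "disjoint_family G"
  shows "(\<lambda>n. pmass M p (cut (G n) f)) \<longlonglongrightarrow> 0"
proof -
  let ?D = "density M (\<lambda>x. ennreal (\<bar>f x\<bar> powr p))"
  interpret D: finite_measure ?D by (rule finite_measure_pmass_density[OF assms(2)])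
  have "(\<lambda>n. measure ?D (G n)) sums measure ?D (\<Union>n. G n)"
    using assms by (intro D.finite_measure_UNION) auto
  then have "(\<lambda>n. measure ?D (G n)) \<longlonglongrightarrow> 0"
    by (intro summable_LIMSEQ_zero) (rule sums_summable)
  then have "(\<lambda>n. ennreal (measure ?D (G n))) \<longlonglongrightarrow> ennreal 0" by (rule tendsto_ennrealI)
  moreover have "pmass M p (cut (G n) f) = ennreal (measure ?D (G n))" for n
    using assms pfuns_measurable[OF assms(2)]
    by (subst pmass_cut) (auto simp: D.emeasure_eq_measure)
  ultimately show ?thesis by simp
qed

lemma pmass_cut_decseq_tendsto_0:
  fixes G :: "nat \<Rightarrow> 'a set"
  assumes "0 < p" "f \<in> pfuns M p" "range G \<subseteq> sets M" "decseq G" "(\<Inter>n. G n) = {}"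
  shows "(\<lambda>n. pmass M p (cut (G n) f)) \<longlonglongrightarrow> 0"
proof -
  let ?D = "density M (\<lambda>x. ennreal (\<bar>f x\<bar> powr p))"
  interpret D: finite_measure ?D by (rule finite_measure_pmass_density[OF assms(2)])
  have "(\<lambda>n. emeasure ?D (G n)) \<longlonglongrightarrow> emeasure ?D (\<Inter>n. G n)"
    using assms(3,4) by (intro Lim_emeasure_decseq) (auto simp: D.emeasure_eq_measure)
  moreover have "pmass M p (cut (G n) f) = emeasure ?D (G n)" for n
    using assms pfuns_measurable[OF assms(2)] by (subst pmass_cut) auto
  ultimately show ?thesis using assms(5) by simp
qed

lemma (in pos_map) mass_le_of_unit_ball:
  assumes "\<And>f. f \<in> pfuns M p \<Longrightarrow> pmass M p f \<le> 1 \<Longrightarrow> pmass N p (T f) \<le> e"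
    and f: "f \<in> pfuns M p"
  shows "pmass N p (T f) \<le> e * pmass M p f"
proof (cases "pmass M p f = 0")
  case True
  then show ?thesis using mass[OF f] by simp
next
  case False
  define m where "m = (\<integral>x. \<bar>f x\<bar> powr p \<partial>M)"
  have m: "pmass M p f = ennreal m" unfolding m_def by (rule pmass_eq_integral[OF f])
  with False have "m > 0" by (cases "m > 0") (auto simp: ennreal_neg)
  define t where "t = (1 / m) powr (1 / p)"
  have "t > 0" using \<open>m > 0\<close> by (simp add: t_def)
  have tp: "\<bar>t\<bar> powr p = 1 / m"
    using \<open>m > 0\<close> p_pos by (simp add: t_def powr_powr)
  have "pmass M p (\<lambda>x. t * f x) = 1"
    using \<open>m > 0\<close> by (subst pmass_scale) (auto simp: tp m pfuns_measurable[OF f] simp flip: ennreal_mult)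
  then have "pmass N p (T (\<lambda>x. t * f x)) \<le> e" by (intro assms(1) pfuns_scale f) simp
  also have "pmass N p (T (\<lambda>x. t * f x)) = pmass N p (\<lambda>y. t * T f y)"
    by (rule pmass_cong_AE[OF scale[OF f]])
  also have "\<dots> = ennreal (1 / m) * pmass N p (T f)"
    by (subst pmass_scale) (auto simp: tp pfuns_measurable[OF maps[OF f]])
  finally have "ennreal m * (ennreal (1 / m) * pmass N p (T f)) \<le> ennreal m * e"
    by (rule mult_left_mono) simp
  then show ?thesis using \<open>m > 0\<close>
    by (simp add: m mult.assoc[symmetric] mult.commute flip: ennreal_mult)
qed

lemma pmass_sum_disjoint:
  assumes "0 < p" "finite I" "\<And>i. i \<in> I \<Longrightarrow> f i \<in> borel_measurable M"
    and disj: "\<And>i j x. i \<in> I \<Longrightarrow> j \<in> I \<Longrightarrow> i \<noteq> j \<Longrightarrow> f i x = 0 \<or> f j x = 0"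
  shows "pmass M p (\<lambda>x. \<Sum>i\<in>I. f i x) = (\<Sum>i\<in>I. pmass M p (f i))"
proof -
  have "ennreal (\<bar>\<Sum>i\<in>I. f i x\<bar> powr p) = (\<Sum>i\<in>I. ennreal (\<bar>f i x\<bar> powr p))" for x
  proof (cases "\<exists>i\<in>I. f i x \<noteq> 0")
    case True
    then obtain i where i: "i \<in> I" "f i x \<noteq> 0" by auto
    then have 0: "f j x = 0" if "j \<in> I - {i}" for j using disj[of i j x] that by auto
    show ?thesis using i 0 assms(2) by (simp add: sum.remove[of I i])
  qed auto
  then show ?thesis unfolding pmass_def using assms(3) by (simp add: nn_integral_sum del: sum_ennreal)
qed

text \<open>
  Integration against \<open>u\<^bsup>p-1\<^esup>\<close> is a linear functional that stands in for the \<open>p\<close>-th power: it is at least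
  the mass of \<open>min w u\<close> (\<open>min_powr_le\<close>), and it is at most a multiple of the mass of \<open>w\<close> plus an
  arbitrarily small share of the mass of \<open>u\<close>. The latter is seen by comparing \<open>w\<close> with \<open>s u\<close>.
\<close>

lemma mult_powr_le:
  fixes u w s p :: real
  assumes "1 < p" "0 < s" "0 \<le> u" "0 \<le> w"
  shows "w * u powr (p - 1) \<le> s * u powr p + s powr (1 - p) * w powr p"
proof (cases "w \<le> s * u")
  case True
  have "w * u powr (p - 1) \<le> s * u * u powr (p - 1)"
    using True by (intro mult_right_mono) auto
  also have "\<dots> = s * u powr p" using assms by (cases "u = 0") (auto simp: powr_mult_base)
  also have "\<dots> \<le> s * u powr p + s powr (1 - p) * w powr p" by simp
  finally show ?thesis .
next
  case False
  then have "w > 0" using assms mult_nonneg_nonneg[of s u] by linarith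
  have "u \<le> w / s" using False assms by (simp add: field_simps)
  then have "w * u powr (p - 1) \<le> w * (w / s) powr (p - 1)"
    using assms by (intro mult_left_mono powr_mono2) auto
  also have "\<dots> = s powr (1 - p) * w powr p"
  proof -
    have "(w / s) powr (p - 1) = w powr (p - 1) * s powr (1 - p)"
      using assms \<open>w > 0\<close> powr_minus_divide[of s "p - 1"] by (simp add: powr_divide)
    then show ?thesis using \<open>w > 0\<close> by (simp add: powr_mult_base algebra_simps)
  qed
  also have "\<dots> \<le> s * u powr p + s powr (1 - p) * w powr p" using assms by simp
  finally show ?thesis .
qed

lemma min_powr_le:
  fixes u w p :: real
  assumes "1 < p" "0 \<le> u" "0 \<le> w"
  shows "min w u powr p \<le> w * u powr (p - 1)"
proof -
  have "min w u powr p = min w u * min w u powr (p - 1)"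
    using assms by (cases "min w u = 0") (auto simp: powr_mult_base)
  also have "\<dots> \<le> w * u powr (p - 1)"
    using assms by (intro mult_mono powr_mono2) auto
  finally show ?thesis .
qed

text \<open>
  Semi-compactness in terms of representatives. The error enters through \<open>\<bar>h\<bar>\<close> because only upper
  bounds of \<open>\<bar>c f\<bar>\<close> are ever used.
\<close>

locale semicompact_pos_map = pos_map M M p K c for M :: "'a measure" and p K c +
  assumes p_gt_1: "1 < p"
    and order_bounded_approx: "0 < e \<Longrightarrow> \<exists>u\<in>pfuns M p. (AE x in M. 0 \<le> u x) \<and>
      (\<forall>f\<in>pfuns M p. pmass M p f \<le> 1 \<longrightarrow>
        (\<exists>h\<in>pfuns M p. pmass M p h \<le> 1 \<and> (AE x in M. \<bar>c f x\<bar> \<le> u x + e * \<bar>h x\<bar>)))"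
begin

text \<open>
  Up to a small error, images of the unit ball are dominated by \<open>u\<close>, and the masses of \<open>u\<close> on the sets
  \<open>G n\<close> have a finite sum.
\<close>

lemma eventually_small_range:
  fixes G :: "nat \<Rightarrow> 'a set" and e :: real
  assumes G: "range G \<subseteq> sets M" "disjoint_family G" and e: "0 < e"
  shows "\<forall>\<^sub>F n in sequentially. \<forall>f\<in>pfuns M p. pmass M p (cut (G n) (c f)) \<le> ennreal e * pmass M p f"
proof -
  \<comment> \<open>chosen such that \<open>(2 d)\<^sup>p\<close> is half of \<open>e\<close>\<close>
  define d where "d = (e / 2) powr (1 / p) / 2"
  have d: "d > 0" using e by (simp add: d_def)
  have dp: "2 powr p * d powr p = e / 2"
  proof -
    have "2 powr p * d powr p = (2 * d) powr p" using d by (simp add: powr_mult)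
    also have "\<dots> = e / 2" using e p_pos by (simp add: d_def powr_powr)
    finally show ?thesis .
  qed
  obtain u where u: "u \<in> pfuns M p" "AE x in M. 0 \<le> u x"
    and approx: "\<And>f. f \<in> pfuns M p \<Longrightarrow> pmass M p f \<le> 1 \<Longrightarrow>
        (\<exists>h\<in>pfuns M p. pmass M p h \<le> 1 \<and> (AE x in M. \<bar>c f x\<bar> \<le> u x + d * \<bar>h x\<bar>))"
    using order_bounded_approx[OF d] by blast
  have G': "G n \<in> sets M" for n using G by auto
  have "(\<lambda>n. ennreal (2 powr p) * pmass M p (cut (G n) u)) \<longlonglongrightarrow> ennreal (2 powr p) * 0"
    by (intro ennreal_tendsto_cmult pmass_cut_disjoint_tendsto_0 p_pos u G) auto
  then have "\<forall>\<^sub>F n in sequentially. ennreal (2 powr p) * pmass M p (cut (G n) u) < ennreal (e / 2)"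
    using e by (intro order_tendstoD(2)[where y=0]) auto
  then show ?thesis
  proof eventually_elim
    case (elim n)
    interpret cutc: pos_map M M p "1 * K" "\<lambda>f. cut (G n) (c f)"
      by (rule pos_map_compose[OF pos_map_axioms pos_map_cut[OF p_pos G']])
    have "pmass M p (cut (G n) (c f)) \<le> ennreal e" if f: "f \<in> pfuns M p" "pmass M p f \<le> 1" for f
    proof -
      obtain h where h: "h \<in> pfuns M p" "pmass M p h \<le> 1" "AE x in M. \<bar>c f x\<bar> \<le> u x + d * \<bar>h x\<bar>"
        using approx[OF f] by blast
      have [measurable]: "u \<in> borel_measurable M" "h \<in> borel_measurable M"
        by (rule pfuns_measurable[OF u(1)], rule pfuns_measurable[OF h(1)])
      note [measurable] = G'
      have "pmass M p (cut (G n) (c f)) \<le> pmass M p (\<lambda>x. cut (G n) u x + d * \<bar>h x\<bar>)"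
      proof (rule pmass_mono_AE)
        show "AE x in M. \<bar>cut (G n) (c f) x\<bar> \<le> \<bar>cut (G n) u x + d * \<bar>h x\<bar>\<bar>"
          using h(3) u(2) by eventually_elim (use d in \<open>auto simp: cut_def\<close>)
      qed (use p_pos in simp)
      also have "\<dots> \<le> ennreal (2 powr p) * (pmass M p (cut (G n) u) + pmass M p (\<lambda>x. d * \<bar>h x\<bar>))"
        by (rule pmass_add_le[OF p_pos]) measurable
      also have "pmass M p (\<lambda>x. d * \<bar>h x\<bar>) \<le> ennreal (d powr p)"
        using h(2) d mult_left_mono[OF h(2), of "ennreal (d powr p)"]
        by (subst pmass_scale) (auto simp: pmass_abs)
      also have "ennreal (2 powr p) * (pmass M p (cut (G n) u) + ennreal (d powr p))
          = ennreal (2 powr p) * pmass M p (cut (G n) u) + ennreal (e / 2)"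
        by (simp add: distrib_left dp flip: ennreal_mult)
      also have "\<dots> \<le> ennreal (e / 2) + ennreal (e / 2)"
        using elim by (intro add_right_mono) simp
      also have "\<dots> = ennreal e" using e by (simp flip: ennreal_plus)
      finally show ?thesis by (simp add: mult_left_mono add_left_mono)
    qed
    then show ?case by (intro ballI cutc.mass_le_of_unit_ball)
  qed
qed

text \<open>
  Let \<open>\<phi>\<^sub>n \<ge> 0\<close> be supported in \<open>G n\<close>, of norm at most one, with large images. These images are
  dominated by a fixed \<open>u\<close> up to a small error, so integrating one of them against \<open>u\<^bsup>p-1\<^esup>\<close> gives at
  least \<open>\<theta> > 0\<close>, and \<open>N\<close> of them together give at least \<open>N \<theta>\<close>. But by disjointness the sum of
  \<open>N\<close> of the \<open>\<phi>\<^sub>n\<close> has \<open>p\<close>-mass at most \<open>N\<close>. With \<open>s = t N\<close> in \<open>mult_powr_le\<close>, the integral is at most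
  \<open>N (t U + (t N)\<^bsup>1-p\<^esup> k)\<close>, which is below \<open>N \<theta>\<close> for small \<open>t\<close> and large \<open>N\<close>.
\<close>

lemma few_large_sources:
  fixes G :: "nat \<Rightarrow> 'a set" and e :: real
  assumes G: "range G \<subseteq> sets M" "disjoint_family G" and e: "0 < e"
  shows "finite {n. \<exists>f\<in>pfuns M p. pmass M p f \<le> 1 \<and> ennreal e < pmass M p (c (cut (G n) f))}"
proof (rule ccontr)
  define bad where "bad = {n. \<exists>f\<in>pfuns M p. pmass M p f \<le> 1 \<and> ennreal e < pmass M p (c (cut (G n) f))}"
  assume "\<not> ?thesis"
  then have inf: "infinite bad" by (simp add: bad_def)
  have G': "G n \<in> sets M" for n using G by auto
  \<comment> \<open>half of \<open>e\<close>, after the loss of \<open>2 powr p\<close> in \<open>pmass_add_le\<close>, is given away for the error of size \<open>d\<close>\<close>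
  define \<theta> where "\<theta> = e / 2 / 2 powr p"
  have \<theta>: "\<theta> > 0" using e by (simp add: \<theta>_def)
  define d where "d = \<theta> powr (1 / p)"
  have d: "d > 0" using \<theta> by (simp add: d_def)
  have dp: "d powr p = \<theta>" using \<theta> p_pos by (simp add: d_def powr_powr)
  obtain u where u: "u \<in> pfuns M p" "AE x in M. 0 \<le> u x"
    and approx: "\<And>f. f \<in> pfuns M p \<Longrightarrow> pmass M p f \<le> 1 \<Longrightarrow>
        (\<exists>h\<in>pfuns M p. pmass M p h \<le> 1 \<and> (AE x in M. \<bar>c f x\<bar> \<le> u x + d * \<bar>h x\<bar>))"
    using order_bounded_approx[OF d] by blast
  have [measurable]: "u \<in> borel_measurable M" by (rule pfuns_measurable[OF u(1)])
  define F where "F n = (SOME f. f \<in> pfuns M p \<and> pmass M p f \<le> 1 \<and>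
    ennreal e < pmass M p (c (cut (G n) f)))" for n
  have F: "F n \<in> pfuns M p \<and> pmass M p (F n) \<le> 1 \<and> ennreal e < pmass M p (c (cut (G n) (F n)))"
    if "n \<in> bad" for n
  proof -
    have "\<exists>f. f \<in> pfuns M p \<and> pmass M p f \<le> 1 \<and> ennreal e < pmass M p (c (cut (G n) f))"
      using that by (auto simp: bad_def)
    from someI_ex[OF this] show ?thesis unfolding F_def .
  qed
  define \<phi> where "\<phi> n = (\<lambda>x. \<bar>cut (G n) (F n) x\<bar>)" for n
  have \<phi>: "\<phi> n \<in> pfuns M p" "pmass M p (\<phi> n) \<le> 1" if "n \<in> bad" for n
  proof -
    show "\<phi> n \<in> pfuns M p" unfolding \<phi>_def using F[OF that] by (intro pfuns_abs cut_pfuns p_pos G') auto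
    show "pmass M p (\<phi> n) \<le> 1" unfolding \<phi>_def pmass_abs
      using order_trans[OF pmass_cut_le[OF p_pos]] F[OF that] by blast
  qed
  have c\<phi>_pos: "AE x in M. 0 \<le> c (\<phi> n) x" if "n \<in> bad" for n
    by (rule pos[OF \<phi>(1)[OF that]]) (simp add: \<phi>_def)
  have large: "ennreal \<theta> \<le> (\<integral>\<^sup>+x. ennreal (c (\<phi> n) x * u x powr (p - 1)) \<partial>M)" if n: "n \<in> bad" for n
  proof -
    have cF: "cut (G n) (F n) \<in> pfuns M p" using F[OF n] by (intro cut_pfuns p_pos G') auto
    have [measurable]: "c (\<phi> n) \<in> borel_measurable M" by (rule pfuns_measurable[OF maps[OF \<phi>(1)[OF n]]])
    obtain h where h: "h \<in> pfuns M p" "pmass M p h \<le> 1"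
      "AE x in M. \<bar>c (\<phi> n) x\<bar> \<le> u x + d * \<bar>h x\<bar>"
      using approx[OF \<phi>[OF n]] by blast
    have [measurable]: "h \<in> borel_measurable M" by (rule pfuns_measurable[OF h(1)])
    have "ennreal e \<le> pmass M p (c (cut (G n) (F n)))" using F[OF n] by (simp add: less_imp_le)
    also have "\<dots> \<le> pmass M p (c (\<phi> n))"
      using abs_le[OF cF] p_pos by (intro pmass_mono_AE) (auto simp: \<phi>_def elim!: eventually_mono)
    also have "\<dots> \<le> pmass M p (\<lambda>x. min (c (\<phi> n) x) (u x) + d * \<bar>h x\<bar>)"
    proof (rule pmass_mono_AE)
      show "AE x in M. \<bar>c (\<phi> n) x\<bar> \<le> \<bar>min (c (\<phi> n) x) (u x) + d * \<bar>h x\<bar>\<bar>"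
        using h(3) u(2) c\<phi>_pos[OF n] by eventually_elim (use d in \<open>auto simp: min_def\<close>)
    qed (use p_pos in simp)
    also have "\<dots> \<le> ennreal (2 powr p) *
        (pmass M p (\<lambda>x. min (c (\<phi> n) x) (u x)) + pmass M p (\<lambda>x. d * \<bar>h x\<bar>))"
      by (rule pmass_add_le[OF p_pos]) measurable
    also have "\<dots> \<le> ennreal (2 powr p) * (pmass M p (\<lambda>x. min (c (\<phi> n) x) (u x)) + ennreal \<theta>)"
      using mult_left_mono[OF h(2), of "ennreal \<theta>"] d
      by (intro mult_left_mono add_left_mono) (auto simp: pmass_scale pmass_abs dp)
    also have "pmass M p (\<lambda>x. min (c (\<phi> n) x) (u x))
        \<le> (\<integral>\<^sup>+x. ennreal (c (\<phi> n) x * u x powr (p - 1)) \<partial>M)" (is "_ \<le> ?I")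
      unfolding pmass_def
    proof (rule nn_integral_mono_AE)
      show "AE x in M. ennreal (\<bar>min (c (\<phi> n) x) (u x)\<bar> powr p) \<le> ennreal (c (\<phi> n) x * u x powr (p - 1))"
        using u(2) c\<phi>_pos[OF n]
        by eventually_elim (auto intro!: ennreal_leI min_powr_le p_gt_1 simp: abs_of_nonneg)
    qed
    finally have *: "ennreal e \<le> ennreal (2 powr p) * (?I + ennreal \<theta>)"
      by (simp add: mult_left_mono add_right_mono)
    show ?thesis
    proof (cases ?I)
      case (real r)
      then have "e \<le> 2 powr p * (r + \<theta>)"
        using * \<theta> by (simp flip: ennreal_plus ennreal_mult)
      then have "\<theta> \<le> r" by (simp add: \<theta>_def field_simps)
      then show ?thesis using real by simp
    qed simp
  qed
  define U where "U = (\<integral>x. \<bar>u x\<bar> powr p \<partial>M)"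
  have U: "pmass M p u = ennreal U" "U \<ge> 0" unfolding U_def by (auto intro: pmass_eq_integral u)
  obtain k where k: "K = ennreal k" "k \<ge> 0" using K_finite by (cases K) auto
  have ineq: "\<theta> \<le> t * U + (t * real n) powr (1 - p) * k" if "t > 0" "n > 0" for t :: real and n :: nat
  proof -
    obtain I where I: "I \<subseteq> bad" "finite I" "card I = n"
      using infinite_arbitrarily_large[OF inf] by blast
    define s where "s = t * real n"
    have s: "s > 0" using that by (simp add: s_def)
    define W where "W = (\<lambda>x. \<Sum>i\<in>I. \<phi> i x)"
    have W: "W \<in> pfuns M p" unfolding W_def using I \<phi> by (intro pfuns_sum p_pos) auto
    have [measurable]: "c W \<in> borel_measurable M" by (rule pfuns_measurable[OF maps[OF W]])
    have \<phi>_meas [measurable]: "c (\<phi> i) \<in> borel_measurable M" if "i \<in> I" for i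
      using I that by (intro pfuns_measurable[OF maps[OF \<phi>(1)]]) auto
    have "pmass M p W = (\<Sum>i\<in>I. pmass M p (\<phi> i))"
      unfolding W_def
    proof (rule pmass_sum_disjoint[OF p_pos I(2)])
      show "\<phi> i \<in> borel_measurable M" if "i \<in> I" for i
        using \<phi>(1)[of i] I that by (auto simp: pfuns_iff)
      show "\<phi> i x = 0 \<or> \<phi> j x = 0" if "i \<noteq> j" for i j x
        using disjoint_family_onD[OF G(2), of i j] that by (auto simp: \<phi>_def cut_def)
    qed
    also have "\<dots> \<le> (\<Sum>i\<in>I. 1)" using \<phi> I by (intro sum_mono) auto
    also have "\<dots> = ennreal (real n)" using I by (simp add: ennreal_of_nat_eq_real_of_nat)
    finally have "pmass M p W \<le> ennreal (real n)" .
    then have "K * pmass M p W \<le> K * ennreal (real n)" by (rule mult_left_mono) simp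
    then have massW: "pmass M p (c W) \<le> ennreal (k * real n)"
      using order_trans[OF mass[OF W]] k by (simp add: ennreal_mult)
    have "ennreal (real n * \<theta>) = (\<Sum>i\<in>I. ennreal \<theta>)"
      using I by (simp add: ennreal_mult' ennreal_of_nat_eq_real_of_nat)
    also have "\<dots> \<le> (\<Sum>i\<in>I. \<integral>\<^sup>+x. ennreal (c (\<phi> i) x * u x powr (p - 1)) \<partial>M)"
      using large I by (intro sum_mono) auto
    also have "\<dots> = (\<integral>\<^sup>+x. (\<Sum>i\<in>I. ennreal (c (\<phi> i) x * u x powr (p - 1))) \<partial>M)"
      by (rule nn_integral_sum[symmetric]) measurable
    also have "\<dots> \<le> (\<integral>\<^sup>+x. ennreal s * ennreal (\<bar>u x\<bar> powr p) + ennreal (s powr (1 - p)) * ennreal (\<bar>c W x\<bar> powr p) \<partial>M)"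
    proof (rule nn_integral_mono_AE)
      have "AE x in M. c W x = (\<Sum>i\<in>I. c (\<phi> i) x)"
        unfolding W_def using I \<phi> by (intro sum) auto
      moreover have "AE x in M. \<forall>i\<in>I. 0 \<le> c (\<phi> i) x"
        using I c\<phi>_pos by (subst AE_finite_all[OF I(2)]) auto
      ultimately show "AE x in M. (\<Sum>i\<in>I. ennreal (c (\<phi> i) x * u x powr (p - 1)))
          \<le> ennreal s * ennreal (\<bar>u x\<bar> powr p) + ennreal (s powr (1 - p)) * ennreal (\<bar>c W x\<bar> powr p)"
        using u(2)
      proof eventually_elim
        case (elim x)
        have "(\<Sum>i\<in>I. ennreal (c (\<phi> i) x * u x powr (p - 1))) = ennreal (c W x * u x powr (p - 1))"
          using elim by (subst sum_ennreal) (auto simp: sum_distrib_right)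
        also have "\<dots> \<le> ennreal (s * u x powr p + s powr (1 - p) * c W x powr p)"
          using elim by (intro ennreal_leI mult_powr_le p_gt_1 s) (auto intro: sum_nonneg)
        also have "\<dots> = ennreal s * ennreal (\<bar>u x\<bar> powr p) + ennreal (s powr (1 - p)) * ennreal (\<bar>c W x\<bar> powr p)"
          using elim s sum_nonneg[of I "\<lambda>i. c (\<phi> i) x"] by (simp add: ennreal_mult)
        finally show ?case .
      qed
    qed
    also have "\<dots> = ennreal s * pmass M p u + ennreal (s powr (1 - p)) * pmass M p (c W)"
      by (simp add: pmass_def nn_integral_add nn_integral_cmult)
    also have "\<dots> \<le> ennreal s * ennreal U + ennreal (s powr (1 - p)) * ennreal (k * real n)"
      unfolding U by (intro add_left_mono mult_left_mono massW) auto
    also have "\<dots> = ennreal (s * U + s powr (1 - p) * (k * real n))"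
      using s U k by (simp flip: ennreal_mult' ennreal_plus)
    finally have "real n * \<theta> \<le> s * U + s powr (1 - p) * (k * real n)"
      using s U k by (subst (asm) ennreal_le_iff) auto
    also have "\<dots> = real n * (t * U + s powr (1 - p) * k)" by (simp add: s_def algebra_simps)
    finally show ?thesis using that by (simp add: s_def)
  qed
  define t where "t = \<theta> / (2 * (U + 1))"
  have t: "t > 0" using \<theta> U by (simp add: t_def)
  have "t * U < \<theta>" using \<theta> U by (simp add: t_def field_simps) (smt (verit) mult_nonneg_nonneg)
  have "(\<lambda>n. t * U + (t * real n) powr (1 - p) * k) \<longlonglongrightarrow> t * U + 0 * k"
  proof (intro tendsto_intros)
    show "(\<lambda>n. (t * real n) powr (1 - p)) \<longlonglongrightarrow> 0"
      using p_gt_1 t by (intro tendsto_neg_powr filterlim_tendsto_pos_mult_at_top[OF tendsto_const])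
        (auto intro: filterlim_real_sequentially)
  qed
  then have "\<forall>\<^sub>F n in sequentially. t * U + (t * real n) powr (1 - p) * k < \<theta>"
    using \<open>t * U < \<theta>\<close> by (intro order_tendstoD(2)) auto
  then have "\<forall>\<^sub>F n in sequentially. False"
    using eventually_gt_at_top[of 0]
  proof eventually_elim
    case (elim n)
    then show ?case using ineq[OF t, of n] by auto
  qed
  then show False by simp
qed

lemma eventually_small_source:
  fixes G :: "nat \<Rightarrow> 'a set" and e :: real
  assumes G: "range G \<subseteq> sets M" "disjoint_family G" and e: "0 < e"
  shows "\<forall>\<^sub>F n in sequentially. \<forall>f\<in>pfuns M p. pmass M p (c (cut (G n) f)) \<le> ennreal e * pmass M p f"
proof -
  have "\<forall>\<^sub>F n in cofinite. \<not> (\<exists>f\<in>pfuns M p. pmass M p f \<le> 1 \<and> ennreal e < pmass M p (c (cut (G n) f)))"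
    using few_large_sources[OF assms] by (simp add: eventually_cofinite)
  then show ?thesis unfolding cofinite_eq_sequentially
  proof eventually_elim
    case (elim n)
    have "G n \<in> sets M" using G by auto
    then interpret ccut: pos_map M M p "K * 1" "\<lambda>f. c (cut (G n) f)"
      by (intro pos_map_compose[OF pos_map_cut pos_map_axioms] p_pos)
    show ?case using elim by (intro ballI ccut.mass_le_of_unit_ball) (auto simp: not_less)
  qed
qed

end

section \<open>Gluing maps along a countable partition\<close>

locale countable_partition =
  fixes M :: "'a measure" and E :: "nat \<Rightarrow> 'a set"
  assumes E_sets [measurable]: "E i \<in> sets M"
    and E_disjoint: "i \<noteq> j \<Longrightarrow> E i \<inter> E j = {}"
    and E_cover: "space M \<subseteq> (\<Union>i. E i)"
begin

definition idx :: "'a \<Rightarrow> nat" where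
  "idx x = (LEAST i. x \<in> E i)"

lemma idx_eq: "x \<in> E i \<Longrightarrow> idx x = i"
  unfolding idx_def
proof (rule Least_equality)
  assume x: "x \<in> E i"
  show "i \<le> j" if "x \<in> E j" for j
    using x that E_disjoint[of i j] by (cases "i = j") auto
qed

lemma idx_measurable [measurable]: "idx \<in> measurable M (count_space UNIV)"
  unfolding idx_def by measurable

definition glue :: "(nat \<Rightarrow> ('a \<Rightarrow> real) \<Rightarrow> 'a \<Rightarrow> real) \<Rightarrow> ('a \<Rightarrow> real) \<Rightarrow> 'a \<Rightarrow> real" where
  "glue T f = (\<lambda>x. T (idx x) f x)"

lemma glue_on: "x \<in> E i \<Longrightarrow> glue T f x = T i f x"
  by (simp add: glue_def idx_eq)

lemma cut_glue: "cut (E i) (glue T f) = cut (E i) (T i f)"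
  by (auto simp: cut_def glue_on)

lemma glue_measurable:
  assumes "\<And>i. T i f \<in> borel_measurable M"
  shows "glue T f \<in> borel_measurable M"
  unfolding glue_def by (rule measurable_compose_countable[OF assms idx_measurable])

lemma AE_blocks:
  assumes "\<And>i. AE x in M. x \<in> E i \<longrightarrow> P x"
  shows "AE x in M. P x"
proof -
  have "AE x in M. \<forall>i. x \<in> E i \<longrightarrow> P x" using assms unfolding AE_all_countable by blast
  with AE_space show ?thesis by eventually_elim (use E_cover in auto)
qed

lemma pmass_blocks:
  assumes "0 < p" and [measurable]: "f \<in> borel_measurable M"
  shows "pmass M p f = (\<Sum>i. pmass M p (cut (E i) f))"
proof -
  let ?D = "density M (\<lambda>x. ennreal (\<bar>f x\<bar> powr p))"
  have "(\<Sum>i. pmass M p (cut (E i) f)) = (\<Sum>i. emeasure ?D (E i))"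
    using assms by (simp add: pmass_cut)
  also have "\<dots> = emeasure ?D (\<Union>i. E i)"
    using E_disjoint by (intro suminf_emeasure) (auto simp: disjoint_family_on_def)
  also have "(\<Union>i. E i) = space M"
    using E_cover sets.sets_into_space[OF E_sets] by blast
  also have "emeasure ?D (space M) = pmass M p f"
    by (subst emeasure_density) (auto simp: pmass_def intro!: nn_integral_cong)
  finally show ?thesis by simp
qed

lemma pos_map_glue:
  assumes T: "\<And>i. \<exists>k. pos_map M M p k (T i)" and K: "K < \<infinity>"
    and bound: "\<And>f. f \<in> pfuns M p \<Longrightarrow> (\<Sum>i. pmass M p (cut (E i) (T i f))) \<le> K * pmass M p f"
  shows "pos_map M M p K (glue T)"
proof -
  obtain k where "pos_map M M p (k i) (T i)" for i using T by metis
  then interpret T: pos_map M M p "k i" "T i" for i .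
  have meas: "glue T f \<in> borel_measurable M" if "f \<in> pfuns M p" for f
    by (rule glue_measurable) (rule pfuns_measurable[OF T.maps[OF that]])
  have mass: "pmass M p (glue T f) \<le> K * pmass M p f" if "f \<in> pfuns M p" for f
    using bound[OF that] by (subst pmass_blocks[OF T.p_pos meas[OF that]]) (simp add: cut_glue)
  show ?thesis
  proof
    show "0 < p" by (rule T.p_pos)
    show "glue T f \<in> pfuns M p" if "f \<in> pfuns M p" for f
    proof -
      have "K * pmass M p f < \<infinity>" using K that by (simp add: pfuns_iff ennreal_mult_less_top)
      then show ?thesis using meas[OF that] mass[OF that] by (simp add: pfuns_iff)
    qed
    show "AE y in M. glue T (\<lambda>x. f x + g x) y = glue T f y + glue T g y"
      if "f \<in> pfuns M p" "g \<in> pfuns M p" for f g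
    proof (rule AE_blocks)
      show "AE y in M. y \<in> E i \<longrightarrow> glue T (\<lambda>x. f x + g x) y = glue T f y + glue T g y" for i
        using T.add[OF that, of i] by eventually_elim (simp add: glue_on)
    qed
    show "AE y in M. glue T (\<lambda>x. c * f x) y = c * glue T f y" if "f \<in> pfuns M p" for c f
    proof (rule AE_blocks)
      show "AE y in M. y \<in> E i \<longrightarrow> glue T (\<lambda>x. c * f x) y = c * glue T f y" for i
        using T.scale[OF that, of i c] by eventually_elim (simp add: glue_on)
    qed
    show "AE y in M. 0 \<le> glue T f y" if "f \<in> pfuns M p" "AE x in M. 0 \<le> f x" for f
    proof (rule AE_blocks)
      show "AE y in M. y \<in> E i \<longrightarrow> 0 \<le> glue T f y" for i
        using T.pos[OF that, of i] by eventually_elim (simp add: glue_on)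
    qed
  qed (use K mass in auto)
qed

lemma tail_tendsto_0:
  assumes "0 < p" and f: "f \<in> pfuns M p"
  shows "(\<lambda>N. pmass M p (\<lambda>x. f x - (\<Sum>j<N. cut (E j) f x))) \<longlonglongrightarrow> 0"
proof -
  define R where "R N = space M - (\<Union>j<N. E j)" for N
  have "(\<lambda>N. pmass M p (cut (R N) f)) \<longlonglongrightarrow> 0"
  proof (rule pmass_cut_decseq_tendsto_0[OF assms])
    show "(\<Inter>N. R N) = {}" using E_cover unfolding R_def by blast
  qed (auto simp: R_def decseq_def)
  moreover have "pmass M p (\<lambda>x. f x - (\<Sum>j<N. cut (E j) f x)) = pmass M p (cut (R N) f)" for N
  proof (rule pmass_cong_AE, rule AE_I2)
    fix x assume x: "x \<in> space M"
    obtain i where i: "x \<in> E i" using x E_cover by auto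
    then have mem: "x \<in> E j \<longleftrightarrow> j = i" for j using idx_eq[of x i] idx_eq[of x j] by auto
    have *: "cut (E j) f x = (if j = i then f x else 0)" for j
      by (simp add: cut_def mem)
    have "x \<in> (\<Union>j<N. E j) \<longleftrightarrow> i < N" by (simp add: mem)
    then show "f x - (\<Sum>j<N. cut (E j) f x) = cut (R N) f x"
      using x by (simp add: * R_def) (auto simp: cut_def)
  qed
  ultimately show ?thesis by simp
qed

end

section \<open>Shifts along a partition and the commutator equation\<close>

text \<open>
  A shift from \<open>E i\<close> to \<open>E (Suc i)\<close> needs an embedding of the functions on \<open>E i\<close> only. Asking for an
  embedding of the whole space makes the condition one on \<open>E (Suc i)\<close> alone, so that the sets can be
  thinned out to a subsequence.
\<close>

locale shift_system = countable_partition M E for M :: "'a measure" and E +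
  fixes p :: real and J Q :: "nat \<Rightarrow> ('a \<Rightarrow> real) \<Rightarrow> 'a \<Rightarrow> real"
  assumes J: "pos_map M M p 1 (J i)" and Q: "pos_map M M p 1 (Q i)"
    and QJ: "f \<in> pfuns M p \<Longrightarrow> AE x in M. Q i (cut (E (Suc i)) (J i f)) x = f x"
begin

sublocale J: pos_map M M p 1 "J i" for i by (rule J)
sublocale Q: pos_map M M p 1 "Q i" for i by (rule Q)

lemma cut_blk [intro]: "f \<in> pfuns M p \<Longrightarrow> cut (E i) f \<in> pfuns M p"
  by (rule cut_pfuns[OF J.p_pos E_sets])

definition S :: "('a \<Rightarrow> real) \<Rightarrow> 'a \<Rightarrow> real" where
  "S = glue (\<lambda>i. case i of 0 \<Rightarrow> (\<lambda>f y. 0) | Suc j \<Rightarrow> (\<lambda>f. J j (cut (E j) f)))"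

definition L :: "('a \<Rightarrow> real) \<Rightarrow> 'a \<Rightarrow> real" where
  "L = glue (\<lambda>i f. Q i (cut (E (Suc i)) f))"

lemma cut_S: "cut (E (Suc i)) (S f) = cut (E (Suc i)) (J i (cut (E i) f))"
  by (simp add: S_def cut_glue)

lemma L_on: "x \<in> E i \<Longrightarrow> L f x = Q i (cut (E (Suc i)) f) x"
  by (simp add: L_def glue_on)

lemma cut_L: "cut (E i) (L f) = cut (E i) (Q i (cut (E (Suc i)) f))"
  by (simp add: L_def cut_glue)

lemma mass_cut_S: "f \<in> pfuns M p \<Longrightarrow> pmass M p (cut (E (Suc i)) (S f)) \<le> pmass M p (cut (E i) f)"
  unfolding cut_S using order_trans[OF pmass_cut_le[OF J.p_pos] J.mass[OF cut_blk]] by simp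

lemma mass_cut_L: "f \<in> pfuns M p \<Longrightarrow> pmass M p (cut (E i) (L f)) \<le> pmass M p (cut (E (Suc i)) f)"
  unfolding cut_L using order_trans[OF pmass_cut_le[OF J.p_pos] Q.mass[OF cut_blk]] by simp

lemma pos_map_S: "pos_map M M p 1 S"
  unfolding S_def
proof (rule pos_map_glue)
  let ?T = "\<lambda>i. case i of 0 \<Rightarrow> (\<lambda>f y. 0) | Suc j \<Rightarrow> (\<lambda>f. J j (cut (E j) f))"
  show "\<exists>k. pos_map M M p k (?T i)" for i
  proof (cases i)
    case 0
    then show ?thesis using pos_map_zero_map[OF J.p_pos, of M M] by auto
  next
    case (Suc j)
    then show ?thesis
      using pos_map_compose[OF pos_map_cut[OF J.p_pos E_sets[of j]] J[of j]] by auto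
  qed
  show "(\<Sum>i. pmass M p (cut (E i) (?T i f))) \<le> 1 * pmass M p f" if f: "f \<in> pfuns M p" for f
  proof -
    have "(\<Sum>i. pmass M p (cut (E i) (?T i f))) = (\<Sum>i. pmass M p (cut (E i) (S f)))"
      by (simp add: S_def cut_glue)
    also have "\<dots> = (\<Sum>i. pmass M p (cut (E (Suc i)) (S f)))"
      by (subst suminf_offset[where i = 1]) (auto simp: S_def cut_glue, simp add: cut_def)
    also have "\<dots> \<le> (\<Sum>i. pmass M p (cut (E i) f))"
      by (intro suminf_le mass_cut_S f) auto
    also have "\<dots> = pmass M p f" by (rule pmass_blocks[symmetric, OF J.p_pos pfuns_measurable[OF f]])
    finally show ?thesis by simp
  qed
qed simp

lemma pos_map_L: "pos_map M M p 1 L"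
  unfolding L_def
proof (rule pos_map_glue)
  show "\<exists>k. pos_map M M p k (\<lambda>f. Q i (cut (E (Suc i)) f))" for i
    using pos_map_compose[OF pos_map_cut[OF J.p_pos E_sets] Q] by blast
  show "(\<Sum>i. pmass M p (cut (E i) (Q i (cut (E (Suc i)) f)))) \<le> 1 * pmass M p f"
    if f: "f \<in> pfuns M p" for f
  proof -
    have "(\<Sum>i. pmass M p (cut (E i) (Q i (cut (E (Suc i)) f)))) = (\<Sum>i. pmass M p (cut (E i) (L f)))"
      by (simp add: cut_L)
    also have "\<dots> \<le> (\<Sum>i. pmass M p (cut (E (Suc i)) f))"
      by (intro suminf_le mass_cut_L f) auto
    also have "\<dots> \<le> (\<Sum>i. pmass M p (cut (E i) f))"
      by (subst (2) suminf_offset[where i = 1]) auto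
    also have "\<dots> = pmass M p f" by (rule pmass_blocks[symmetric, OF J.p_pos pfuns_measurable[OF f]])
    finally show ?thesis by simp
  qed
qed simp

sublocale S: pos_map M M p 1 S by (rule pos_map_S)
sublocale L: pos_map M M p 1 L by (rule pos_map_L)
sublocale Sn: pos_map M M p 1 "S ^^ n" for n by (rule pos_map_funpow[OF pos_map_S])
sublocale Ln: pos_map M M p 1 "L ^^ n" for n by (rule pos_map_funpow[OF pos_map_L])

lemma L_S:
  assumes f: "f \<in> pfuns M p"
  shows "AE x in M. L (S f) x = f x"
proof (rule AE_blocks)
  fix i
  show "AE x in M. x \<in> E i \<longrightarrow> L (S f) x = f x"
    using QJ[OF cut_blk[OF f], of i i] by eventually_elim (simp add: L_on cut_S, simp add: cut_def)
qed

lemma mass_cut_S_funpow: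
  "f \<in> pfuns M p \<Longrightarrow> pmass M p (cut (E (n + i)) ((S ^^ n) f)) \<le> pmass M p (cut (E i) f)"
proof (induction n)
  case (Suc n)
  show ?case using order_trans[OF mass_cut_S[OF Sn.maps[OF Suc.prems]] Suc.IH[OF Suc.prems]] by simp
qed simp

lemma mass_cut_L_funpow:
  "f \<in> pfuns M p \<Longrightarrow> pmass M p (cut (E i) ((L ^^ n) f)) \<le> pmass M p (cut (E (n + i)) f)"
proof (induction n arbitrary: i)
  case (Suc n)
  show ?case using order_trans[OF mass_cut_L[OF Ln.maps[OF Suc.prems]] Suc.IH[OF Suc.prems]] by simp
qed simp

end

lemma suminf_swap_ennreal:
  fixes f :: "nat \<Rightarrow> nat \<Rightarrow> ennreal"
  shows "(\<Sum>i. \<Sum>j. f i j) = (\<Sum>j. \<Sum>i. f i j)"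
proof -
  have "(\<Sum>i. \<Sum>j. f i j) = (\<integral>\<^sup>+i. (\<Sum>j. f i j) \<partial>count_space UNIV)"
    by (rule nn_integral_count_space_nat[symmetric])
  also have "\<dots> = (\<Sum>j. \<integral>\<^sup>+i. f i j \<partial>count_space UNIV)" by (rule nn_integral_suminf) simp
  also have "\<dots> = (\<Sum>j. \<Sum>i. f i j)" by (simp add: nn_integral_count_space_nat)
  finally show ?thesis .
qed

lemma suminf_half_powers: "(\<Sum>m. ennreal ((1/2) ^ m)) = 2"
proof -
  have "(\<lambda>m. (1/2) ^ m :: real) sums (1 / (1 - 1/2))" by (rule geometric_sums) simp
  then have "(\<Sum>m. ennreal ((1/2) ^ m)) = ennreal 2" by (intro suminf_ennreal_eq) auto
  then show ?thesis by simp
qed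

text \<open>Young's inequality for a convolution with two geometric weights.\<close>

lemma geometric_convolution_le:
  fixes \<phi> :: "nat \<Rightarrow> ennreal"
  shows "(\<Sum>l. \<Sum>m<Suc l. ennreal ((1/2) ^ m) * (\<Sum>j. ennreal ((1/2) ^ j) * \<phi> (j + (l - m))))
    \<le> 4 * (\<Sum>i. \<phi> i)"
proof -
  define g where "g m j l = (if m \<le> l then ennreal ((1/2) ^ m) * (ennreal ((1/2) ^ j) * \<phi> (j + (l - m))) else 0)"
    for m j l
  have shift: "(\<Sum>l. g m j l) \<le> ennreal ((1/2) ^ m) * (ennreal ((1/2) ^ j) * (\<Sum>i. \<phi> i))" for m j
  proof -
    have "(\<Sum>l. g m j l) = (\<Sum>l. g m j (l + m)) + (\<Sum>l<m. g m j l)" by (rule suminf_offset) simp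
    also have "\<dots> = ennreal ((1/2) ^ m) * (ennreal ((1/2) ^ j) * (\<Sum>l. \<phi> (l + j)))"
      by (simp add: g_def ennreal_suminf_cmult add.commute)
    also have "(\<Sum>l. \<phi> (l + j)) \<le> (\<Sum>i. \<phi> i)"
      by (subst (2) suminf_offset[where i = j]) auto
    finally show ?thesis by (simp add: mult_left_mono)
  qed
  have "(\<Sum>m<Suc l. ennreal ((1/2) ^ m) * (\<Sum>j. ennreal ((1/2) ^ j) * \<phi> (j + (l - m)))) = (\<Sum>m. \<Sum>j. g m j l)" for l
  proof -
    have "(\<Sum>m. \<Sum>j. g m j l) = (\<Sum>m<Suc l. \<Sum>j. g m j l)"
      by (rule suminf_finite) (auto simp: g_def)
    also have "\<dots> = (\<Sum>m<Suc l. ennreal ((1/2) ^ m) * (\<Sum>j. ennreal ((1/2) ^ j) * \<phi> (j + (l - m))))"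
      by (intro sum.cong refl) (auto simp: g_def ennreal_suminf_cmult)
    finally show ?thesis by simp
  qed
  then have "(\<Sum>l. \<Sum>m<Suc l. ennreal ((1/2) ^ m) * (\<Sum>j. ennreal ((1/2) ^ j) * \<phi> (j + (l - m))))
      = (\<Sum>l. \<Sum>m. \<Sum>j. g m j l)" by presburger
  also have "\<dots> = (\<Sum>m. \<Sum>l. \<Sum>j. g m j l)" by (rule suminf_swap_ennreal)
  also have "\<dots> = (\<Sum>m. \<Sum>j. \<Sum>l. g m j l)" by (subst suminf_swap_ennreal) simp
  also have "\<dots> \<le> (\<Sum>m. \<Sum>j. ennreal ((1/2) ^ m) * (ennreal ((1/2) ^ j) * (\<Sum>i. \<phi> i)))"
    by (intro suminf_le shift) auto
  also have "\<dots> = 4 * (\<Sum>i. \<phi> i)"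
    by (simp only: ennreal_suminf_cmult ennreal_suminf_multc suminf_half_powers mult.assoc[symmetric]) simp
  finally show ?thesis .
qed

text \<open>
  The exponent \<open>p + 1\<close> leaves a summable factor after the losses \<open>2\<^bsup>mp\<^esup>\<close> of \<open>pmass_sum_le\<close>.
\<close>

locale shift_commutator = shift_system M E p J Q + c: pos_map M M p K c
  for M :: "'a measure" and E p J Q K c +
  fixes k :: ennreal
  assumes k_finite: "k < \<infinity>"
    and range_decay: "f \<in> pfuns M p \<Longrightarrow>
      pmass M p (cut (E m) (c f)) \<le> k * ennreal (4 powr (- (p + 1) * real m)) * pmass M p f"
    and source_decay: "f \<in> pfuns M p \<Longrightarrow>
      pmass M p (c (cut (E j) f)) \<le> k * ennreal (4 powr (- (p + 1) * real j)) * pmass M p f"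
begin

text \<open>
  The entry from \<open>E j\<close> to \<open>E m\<close> is bounded by both decay assumptions, hence by their geometric mean;
  the base \<open>4\<close> becomes \<open>2\<close> and the decay is in \<open>m + j\<close>.
\<close>

lemma entry_decay:
  assumes f: "f \<in> pfuns M p"
  shows "pmass M p (cut (E m) (c (cut (E j) f)))
    \<le> k * ennreal (2 powr (- (p + 1) * (real m + real j))) * pmass M p (cut (E j) f)"
proof -
  have "pmass M p (cut (E m) (c (cut (E j) f)))
      \<le> k * ennreal (4 powr (- (p + 1) * real (max m j))) * pmass M p (cut (E j) f)"
  proof (cases "m \<le> j")
    case True
    have "pmass M p (cut (E m) (c (cut (E j) f))) \<le> pmass M p (c (cut (E j) (cut (E j) f)))"
      using pmass_cut_le[OF J.p_pos] by simp
    also have "\<dots> \<le> k * ennreal (4 powr (- (p + 1) * real j)) * pmass M p (cut (E j) f)"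
      by (intro source_decay cut_blk f)
    finally show ?thesis using True by (simp add: max_absorb2)
  next
    case False
    then show ?thesis using range_decay[OF cut_blk[OF f], of m j] by (simp add: max_absorb1)
  qed
  also have "4 powr (- (p + 1) * real (max m j)) = 2 powr (2 * (- (p + 1) * real (max m j)))"
    using powr_powr[of 2 2] by simp
  also have "k * ennreal (2 powr (2 * (- (p + 1) * real (max m j)))) * pmass M p (cut (E j) f)
      \<le> k * ennreal (2 powr (- (p + 1) * (real m + real j))) * pmass M p (cut (E j) f)"
  proof -
    have "(p + 1) * (real m + real j) \<le> (p + 1) * (2 * real (max m j))"
      using J.p_pos by (intro mult_left_mono) auto
    then have "2 * (- (p + 1) * real (max m j)) \<le> - (p + 1) * (real m + real j)"
      by (simp add: algebra_simps)
    then show ?thesis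
      by (intro mult_right_mono mult_left_mono ennreal_leI powr_mono) auto
  qed
  finally show ?thesis .
qed

text \<open>
  Summing the entries of one row over the first \<open>N\<close> columns with \<open>pmass_sum_le\<close> costs the factor
  \<open>2\<^bsup>jp\<^esup>\<close> in column \<open>j\<close>, which the exponent \<open>p + 1\<close> of the decay absorbs with \<open>2\<^bsup>-j\<^esup>\<close> to spare. The
  remaining columns contribute an error that vanishes as \<open>N\<close> grows because \<open>c\<close> is bounded.
\<close>

lemma row_decay:
  assumes f: "f \<in> pfuns M p"
  shows "pmass M p (cut (E m) (c f)) \<le> ennreal (2 powr p * 2 powr p) * k * ennreal (2 powr (- (p + 1) * real m))
    * (\<Sum>j. ennreal ((1/2) ^ j) * pmass M p (cut (E j) f))" (is "?X \<le> ?A * ?\<Sigma>")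
proof -
  define r where "r N = (\<lambda>x. f x - (\<Sum>j<N. cut (E j) f x))" for N
  have fN: "(\<lambda>x. \<Sum>j<N. cut (E j) f x) \<in> pfuns M p" for N
    using f by (intro pfuns_sum J.p_pos cut_blk)
  have r: "r N \<in> pfuns M p" for N unfolding r_def by (intro pfuns_diff J.p_pos f fN)
  have meas [measurable]: "c (cut (E j) f) \<in> borel_measurable M" "c (r j) \<in> borel_measurable M" for j
    by (intro pfuns_measurable[OF c.maps] cut_blk f r)+
  have step: "?X \<le> ?A * ?\<Sigma> + ennreal (2 powr p) * (K * pmass M p (r N))" for N
  proof -
    have "?X = pmass M p (\<lambda>x. (\<Sum>j<N. cut (E m) (c (cut (E j) f)) x) + cut (E m) (c (r N)) x)"
    proof (rule pmass_cong_AE)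
      have "AE x in M. c (\<lambda>x. f x - (\<Sum>j<N. cut (E j) f x)) x = c f x - c (\<lambda>x. \<Sum>j<N. cut (E j) f x) x"
        by (rule c.map_diff[OF f fN])
      moreover have "AE x in M. c (\<lambda>x. \<Sum>j<N. cut (E j) f x) x = (\<Sum>j<N. c (cut (E j) f) x)"
        using f by (intro c.sum cut_blk) auto
      ultimately show "AE x in M. cut (E m) (c f) x = (\<Sum>j<N. cut (E m) (c (cut (E j) f)) x) + cut (E m) (c (r N)) x"
        by eventually_elim (auto simp: r_def cut_def)
    qed
    also have "\<dots> \<le> ennreal (2 powr p) *
        (pmass M p (\<lambda>x. \<Sum>j<N. cut (E m) (c (cut (E j) f)) x) + pmass M p (cut (E m) (c (r N))))"
      by (intro pmass_add_le J.p_pos) measurable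
    also have "\<dots> \<le> ennreal (2 powr p) * (ennreal (2 powr p) * (k * ennreal (2 powr (- (p + 1) * real m)) * ?\<Sigma>)
        + K * pmass M p (r N))"
    proof (intro mult_left_mono add_mono)
      have "pmass M p (\<lambda>x. \<Sum>j<N. cut (E m) (c (cut (E j) f)) x)
          \<le> ennreal (2 powr p) * (\<Sum>j<N. ennreal (2 powr (real j * p)) * pmass M p (cut (E m) (c (cut (E j) f))))"
        by (intro pmass_sum_le J.p_pos) measurable
      also have "\<dots> \<le> ennreal (2 powr p) * (\<Sum>j<N. k * ennreal (2 powr (- (p + 1) * real m)) *
          (ennreal ((1/2) ^ j) * pmass M p (cut (E j) f)))"
      proof (intro mult_left_mono sum_mono)
        fix j
        have w: "ennreal (2 powr (real j * p)) * ennreal (2 powr (- (p + 1) * (real m + real j)))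
            = ennreal (2 powr (- (p + 1) * real m)) * ennreal ((1/2) ^ j)"
        proof -
          have "2 powr (real j * p) * 2 powr (- (p + 1) * (real m + real j))
              = 2 powr (- (p + 1) * real m) * 2 powr (- real j)"
            by (simp add: powr_add[symmetric] algebra_simps)
          also have "2 powr (- real j) = (1/2) ^ j"
            by (simp add: powr_minus powr_realpow power_one_over inverse_eq_divide)
          finally show ?thesis by (simp flip: ennreal_mult)
        qed
        have "ennreal (2 powr (real j * p)) * pmass M p (cut (E m) (c (cut (E j) f)))
            \<le> ennreal (2 powr (real j * p)) *
              (k * ennreal (2 powr (- (p + 1) * (real m + real j))) * pmass M p (cut (E j) f))"
          by (intro mult_left_mono entry_decay f) simp
        also have "\<dots> = k * (ennreal (2 powr (real j * p)) * ennreal (2 powr (- (p + 1) * (real m + real j))))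
            * pmass M p (cut (E j) f)" by (simp only: ac_simps)
        also have "\<dots> = k * ennreal (2 powr (- (p + 1) * real m)) * (ennreal ((1/2) ^ j) * pmass M p (cut (E j) f))"
          unfolding w by (simp only: ac_simps)
        finally show "ennreal (2 powr (real j * p)) * pmass M p (cut (E m) (c (cut (E j) f)))
            \<le> k * ennreal (2 powr (- (p + 1) * real m)) * (ennreal ((1/2) ^ j) * pmass M p (cut (E j) f))" .
      qed simp
      also have "\<dots> \<le> ennreal (2 powr p) * (k * ennreal (2 powr (- (p + 1) * real m)) * ?\<Sigma>)"
        unfolding sum_distrib_left[symmetric] by (intro mult_left_mono sum_le_suminf) auto
      finally show "pmass M p (\<lambda>x. \<Sum>j<N. cut (E m) (c (cut (E j) f)) x)
          \<le> ennreal (2 powr p) * (k * ennreal (2 powr (- (p + 1) * real m)) * ?\<Sigma>)" .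
      show "pmass M p (cut (E m) (c (r N))) \<le> K * pmass M p (r N)"
        by (rule order_trans[OF pmass_cut_le[OF J.p_pos] c.mass[OF r]])
    qed simp
    also have "\<dots> = ?A * ?\<Sigma> + ennreal (2 powr p) * (K * pmass M p (r N))"
      by (simp add: distrib_left ennreal_mult mult.assoc)
    finally show ?thesis .
  qed
  have "(\<lambda>N. ?A * ?\<Sigma> + ennreal (2 powr p) * (K * pmass M p (r N))) \<longlonglongrightarrow> ?A * ?\<Sigma> + ennreal (2 powr p) * (K * 0)"
    unfolding r_def using c.K_finite
    by (intro tendsto_add tendsto_const ennreal_tendsto_cmult tail_tendsto_0 J.p_pos f) auto
  then show ?thesis using step by (intro LIMSEQ_le_const) auto
qed

text \<open>
  The series \<open>\<Sum>\<^sub>n S\<^bsup>n+1\<^esup> c L\<^sup>n\<close>. Since \<open>S\<^bsup>n+1\<^esup>\<close> takes values in functions that vanish on \<open>E i\<close> for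
  \<open>i \<le> n\<close>, only the terms with \<open>n < i\<close> matter on \<open>E i\<close>, and no convergence question arises.
\<close>

definition B :: "('a \<Rightarrow> real) \<Rightarrow> 'a \<Rightarrow> real" where
  "B = glue (\<lambda>i f x. \<Sum>n<i. (S ^^ Suc n) (c ((L ^^ n) f)) x)"

text \<open>
  Indexed by \<open>m = l - n\<close>, the \<open>n\<close>-th term of \<open>B f\<close> on \<open>E (Suc l)\<close> is a shifted copy of the row \<open>m\<close> of
  \<open>c\<close>, applied to \<open>L\<^bsup>l-m\<^esup> f\<close>; so \<open>row_decay\<close> gives a bound that is a convolution in \<open>l\<close>.
\<close>

lemma mass_cut_B:
  assumes f: "f \<in> pfuns M p"
  shows "pmass M p (cut (E (Suc l)) (\<lambda>x. \<Sum>n<Suc l. (S ^^ Suc n) (c ((L ^^ n) f)) x))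
    \<le> ennreal (2 powr p) * (ennreal (2 powr p * 2 powr p) * k) *
      (\<Sum>m<Suc l. ennreal ((1/2) ^ m) * (\<Sum>j. ennreal ((1/2) ^ j) * pmass M p (cut (E (j + (l - m))) f)))"
    (is "?X \<le> _ * ?A * ?R")
proof -
  define y where "y m = cut (E (Suc l)) ((S ^^ Suc (l - m)) (c ((L ^^ (l - m)) f)))" for m
  have h: "c ((L ^^ n) f) \<in> pfuns M p" for n by (intro c.maps Ln.maps f)
  have y: "y m \<in> borel_measurable M" for m
    unfolding y_def by (intro cut_measurable E_sets pfuns_measurable[OF Sn.maps] h)
  have "?X = pmass M p (\<lambda>x. \<Sum>m<Suc l. y m x)"
    unfolding cut_sum y_def
    by (subst sum.nat_diff_reindex[symmetric]) (simp only: diff_Suc_Suc)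
  also have "\<dots> \<le> ennreal (2 powr p) * (\<Sum>m<Suc l. ennreal (2 powr (real m * p)) * pmass M p (y m))"
    by (rule pmass_sum_le[OF J.p_pos y])
  also have "\<dots> \<le> ennreal (2 powr p) * (\<Sum>m<Suc l. ?A * (ennreal ((1/2) ^ m) *
      (\<Sum>j. ennreal ((1/2) ^ j) * pmass M p (cut (E (j + (l - m))) f))))"
  proof (intro mult_left_mono sum_mono)
    fix m assume "m \<in> {..<Suc l}"
    then have m: "Suc l = Suc (l - m) + m" by simp
    have "pmass M p (y m) \<le> pmass M p (cut (E m) (c ((L ^^ (l - m)) f)))"
      unfolding y_def by (subst m) (rule mass_cut_S_funpow[OF h])
    also have "\<dots> \<le> ?A * ennreal (2 powr (- (p + 1) * real m)) *
        (\<Sum>j. ennreal ((1/2) ^ j) * pmass M p (cut (E j) ((L ^^ (l - m)) f)))"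
      by (rule row_decay[OF Ln.maps[OF f]])
    also have "\<dots> \<le> ?A * ennreal (2 powr (- (p + 1) * real m)) *
        (\<Sum>j. ennreal ((1/2) ^ j) * pmass M p (cut (E (j + (l - m))) f))"
      using mass_cut_L_funpow[OF f, of _ "l - m"]
      by (intro mult_left_mono suminf_le) (auto simp: add.commute)
    finally have "ennreal (2 powr (real m * p)) * pmass M p (y m)
        \<le> ennreal (2 powr (real m * p)) * (?A * ennreal (2 powr (- (p + 1) * real m)) *
          (\<Sum>j. ennreal ((1/2) ^ j) * pmass M p (cut (E (j + (l - m))) f)))"
      by (rule mult_left_mono) simp
    also have "\<dots> = ?A * ((ennreal (2 powr (real m * p)) * ennreal (2 powr (- (p + 1) * real m))) *
        (\<Sum>j. ennreal ((1/2) ^ j) * pmass M p (cut (E (j + (l - m))) f)))" by (simp only: ac_simps)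
    also have "ennreal (2 powr (real m * p)) * ennreal (2 powr (- (p + 1) * real m)) = ennreal ((1/2) ^ m)"
    proof -
      have "2 powr (real m * p) * 2 powr (- (p + 1) * real m) = 2 powr (- real m)"
        by (simp add: powr_add[symmetric] algebra_simps)
      also have "\<dots> = (1/2) ^ m"
        by (simp add: powr_minus powr_realpow power_one_over inverse_eq_divide)
      finally show ?thesis by (simp flip: ennreal_mult)
    qed
    finally show "ennreal (2 powr (real m * p)) * pmass M p (y m) \<le> ?A * (ennreal ((1/2) ^ m) *
      (\<Sum>j. ennreal ((1/2) ^ j) * pmass M p (cut (E (j + (l - m))) f)))" .
  qed simp
  finally show ?thesis by (simp only: sum_distrib_left[symmetric] mult.assoc)
qed

lemma pos_map_B: "\<exists>K'. pos_map M M p K' B"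
proof -
  let ?T = "\<lambda>i f x. \<Sum>n<i. (S ^^ Suc n) (c ((L ^^ n) f)) x"
  let ?A = "ennreal (2 powr p) * (ennreal (2 powr p * 2 powr p) * k)"
  have "pos_map M M p (?A * 4) (glue ?T)"
  proof (rule pos_map_glue)
    show "\<exists>k. pos_map M M p k (?T i)" for i
    proof (rule pos_map_sum_map[OF J.p_pos])
      show "\<exists>K. pos_map M M p K (\<lambda>f. (S ^^ Suc n) (c ((L ^^ n) f)))" for n
        by (intro exI, rule pos_map_compose[OF pos_map_compose[OF pos_map_funpow[OF pos_map_L] c.pos_map_axioms]
          pos_map_funpow[OF pos_map_S]])
    qed
    show "?A * 4 < \<infinity>" using k_finite by (simp add: ennreal_mult_less_top)
    show "(\<Sum>i. pmass M p (cut (E i) (?T i f))) \<le> ?A * 4 * pmass M p f" if f: "f \<in> pfuns M p" for f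
    proof -
      have "(\<Sum>i. pmass M p (cut (E i) (?T i f))) = (\<Sum>l. pmass M p (cut (E (Suc l)) (?T (Suc l) f)))"
        by (subst suminf_offset[where i = 1]) (auto, simp add: cut_def)
      also have "\<dots> \<le> (\<Sum>l. ?A * (\<Sum>m<Suc l. ennreal ((1/2) ^ m) *
          (\<Sum>j. ennreal ((1/2) ^ j) * pmass M p (cut (E (j + (l - m))) f))))"
        by (intro suminf_le mass_cut_B f) auto
      also have "\<dots> = ?A * (\<Sum>l. \<Sum>m<Suc l. ennreal ((1/2) ^ m) *
          (\<Sum>j. ennreal ((1/2) ^ j) * pmass M p (cut (E (j + (l - m))) f)))"
        by (rule ennreal_suminf_cmult)
      also have "\<dots> \<le> ?A * (4 * (\<Sum>i. pmass M p (cut (E i) f)))"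
        by (intro mult_left_mono geometric_convolution_le) simp
      also have "\<dots> = ?A * 4 * pmass M p f"
        by (simp only: pmass_blocks[symmetric, OF J.p_pos pfuns_measurable[OF f]] mult.assoc)
      finally show ?thesis .
    qed
  qed
  then show ?thesis unfolding B_def by blast
qed

text \<open>
  On \<open>E i\<close> the terms of \<open>L (B f)\<close> are \<open>L S\<close> applied to the \<open>S\<^sup>n c L\<^sup>n f\<close> with \<open>n \<le> i\<close>, and \<open>L S = I\<close>;
  the terms with \<open>n \<ge> 1\<close> are those of \<open>B (L f)\<close>, and the one with \<open>n = 0\<close> is \<open>c f\<close>.
\<close>

lemma commutator:
  assumes f: "f \<in> pfuns M p"
  shows "AE x in M. L (B f) x - B (L f) x = c f x"
proof (rule AE_blocks)
  fix i
  define h where "h n = (S ^^ n) (c ((L ^^ n) f))" for n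
  have h: "h n \<in> pfuns M p" for n unfolding h_def by (intro Sn.maps c.maps Ln.maps f)
  have cutB: "cut (E (Suc i)) (B f) = (\<lambda>x. \<Sum>n<Suc i. cut (E (Suc i)) (S (h n)) x)"
    by (simp only: B_def cut_glue cut_sum h_def funpow.simps o_def)
  have "AE x in M. Q i (\<lambda>x. \<Sum>n<Suc i. cut (E (Suc i)) (S (h n)) x) x
      = (\<Sum>n<Suc i. Q i (cut (E (Suc i)) (S (h n))) x)"
    by (intro Q.sum cut_blk S.maps h) auto
  moreover have "AE x in M. \<forall>n. L (S (h n)) x = h n x"
    using L_S[OF h] by (simp add: AE_all_countable)
  ultimately show "AE x in M. x \<in> E i \<longrightarrow> L (B f) x - B (L f) x = c f x"
  proof eventually_elim
    case (elim x)
    show ?case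
    proof
      assume x: "x \<in> E i"
      have "L (B f) x = (\<Sum>n<Suc i. Q i (cut (E (Suc i)) (S (h n))) x)"
        using elim(1) x by (simp only: L_on cutB)
      also have "\<dots> = (\<Sum>n<Suc i. h n x)"
        using elim(2) x by (simp only: L_on[symmetric])
      also have "\<dots> = h 0 x + (\<Sum>n<i. h (Suc n) x)" by (rule sum.lessThan_Suc_shift)
      also have "h 0 x = c f x" by (simp add: h_def)
      also have "(\<Sum>n<i. h (Suc n) x) = B (L f) x"
        using x by (simp add: B_def glue_on h_def funpow_swap1)
      finally show "L (B f) x - B (L f) x = c f x" by simp
    qed
  qed
qed

end

section \<open>Weighted composition isometries and their left inverses\<close>

text \<open>
  The Doob--Dynkin factorization. The level sets of \<open>\<phi>\<close> at rational heights are preimages of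
  sets \<open>B q\<close>, and \<open>h y\<close> is the supremum of the \<open>q\<close> with \<open>y \<in> B q\<close>. The supremum is taken in the extended
  reals, since off the image of \<open>k\<close> it may be infinite.
\<close>

lemma vimage_algebra_factor:
  fixes \<phi> :: "'a \<Rightarrow> real"
  assumes k: "k \<in> X \<rightarrow> space N" and \<phi>: "\<phi> \<in> borel_measurable (vimage_algebra X k N)"
  shows "\<exists>h\<in>borel_measurable N. \<forall>x\<in>X. \<phi> x = h (k x)"
proof -
  have "\<exists>B\<in>sets N. {x \<in> X. real_of_rat q < \<phi> x} = k -` B \<inter> X" for q
  proof -
    have "{x \<in> X. real_of_rat q < \<phi> x} = \<phi> -` {real_of_rat q<..} \<inter> space (vimage_algebra X k N)"
      by auto
    also have "\<dots> \<in> sets (vimage_algebra X k N)" by (rule measurable_sets[OF \<phi>]) simp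
    finally show ?thesis by (auto simp: sets_vimage_algebra2[OF k])
  qed
  then obtain B where B: "\<And>q. B q \<in> sets N" "\<And>q. {x \<in> X. real_of_rat q < \<phi> x} = k -` B q \<inter> X"
    by metis
  have mem: "k x \<in> B q \<longleftrightarrow> real_of_rat q < \<phi> x" if "x \<in> X" for x q
    using B(2)[of q] that by auto
  define h where "h y = real_of_ereal (SUP q. if y \<in> B q then ereal (real_of_rat q) else -\<infinity>)" for y
  note [measurable] = B(1)
  have "h \<in> borel_measurable N"
    unfolding h_def by measurable
  moreover have "\<phi> x = h (k x)" if x: "x \<in> X" for x
  proof -
    have "(SUP q. if k x \<in> B q then ereal (real_of_rat q) else -\<infinity>) = ereal (\<phi> x)"
    proof (rule SUP_eqI)
      show "(if k x \<in> B q then ereal (real_of_rat q) else -\<infinity>) \<le> ereal (\<phi> x)" for q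
        using mem[OF x] by auto
      fix y :: ereal
      assume y: "\<And>q. q \<in> UNIV \<Longrightarrow> (if k x \<in> B q then ereal (real_of_rat q) else -\<infinity>) \<le> y"
      have bound: "ereal (real_of_rat q) \<le> y" if "real_of_rat q < \<phi> x" for q
        using y[of q] that mem[OF x] by auto
      show "ereal (\<phi> x) \<le> y"
      proof (cases y)
        case (real r)
        have False if less: "r < \<phi> x"
        proof -
          obtain q where "r < real_of_rat q" "real_of_rat q < \<phi> x" using of_rat_dense[OF less] by blast
          then show False using bound[of q] real by auto
        qed
        then show ?thesis using real by force
      next
        case MInf
        obtain q where "\<phi> x - 1 < real_of_rat q" "real_of_rat q < \<phi> x"
          using of_rat_dense[of "\<phi> x - 1" "\<phi> x"] by auto
        then show ?thesis using bound[of q] MInf by auto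
      qed auto
    qed
    then show ?thesis by (simp add: h_def)
  qed
  ultimately show ?thesis by blast
qed

lemma convex_abs_powr:
  fixes p :: real
  assumes "1 \<le> p"
  shows "convex_on UNIV (\<lambda>x::real. \<bar>x\<bar> powr p)"
proof (rule convex_onI)
  fix t x y :: real
  assume t: "0 < t" "t < 1"
  have nonneg: "((1 - t) * a + t * b) powr p \<le> (1 - t) * a powr p + t * b powr p"
    if ab: "0 \<le> a" "0 \<le> b" for a b
  proof -
    have small: "s powr p \<le> s" if "0 < s" "s < 1" for s :: real
      using powr_mono'[of 1 p s] assms that by simp
    consider "a = 0" | "b = 0" | "0 < a" "0 < b" using ab by linarith
    then show ?thesis
    proof cases
      case 1
      then show ?thesis using small[of t] t ab by (simp add: powr_mult mult_right_mono)
    next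
      case 2
      then show ?thesis using small[of "1 - t"] t ab by (simp add: powr_mult mult_right_mono)
    next
      case 3
      then show ?thesis using convex_onD[OF powr_convex[OF assms], of t a b] t by simp
    qed
  qed
  have "\<bar>(1 - t) *\<^sub>R x + t *\<^sub>R y\<bar> \<le> (1 - t) * \<bar>x\<bar> + t * \<bar>y\<bar>"
    using abs_triangle_ineq[of "(1 - t) * x" "t * y"] t by (simp add: abs_mult)
  then have "\<bar>(1 - t) *\<^sub>R x + t *\<^sub>R y\<bar> powr p \<le> ((1 - t) * \<bar>x\<bar> + t * \<bar>y\<bar>) powr p"
    using assms by (intro powr_mono2) auto
  also have "\<dots> \<le> (1 - t) * \<bar>x\<bar> powr p + t * \<bar>y\<bar> powr p" by (rule nonneg) auto
  finally show "\<bar>(1 - t) *\<^sub>R x + t *\<^sub>R y\<bar> powr p \<le> (1 - t) * \<bar>x\<bar> powr p + t * \<bar>y\<bar> powr p" .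
qed simp

lemma (in finite_measure_subalgebra) pmass_cond_exp_le:
  assumes p: "1 \<le> p" and X: "integrable M X" "X \<in> pfuns M p"
  shows "pmass M p (real_cond_exp M F X) \<le> pmass M p X"
proof -
  have int: "integrable M (\<lambda>x. \<bar>X x\<bar> powr p)" using X by (simp add: p_integrable_functions_def)
  have le: "AE x in M. \<bar>real_cond_exp M F X x\<bar> powr p \<le> real_cond_exp M F (\<lambda>x. \<bar>X x\<bar> powr p) x"
    using X(1) int convex_abs_powr[OF p]
    by (intro real_cond_exp_jensens_inequality(2)[where I = UNIV]) auto
  have pos: "AE x in M. 0 \<le> real_cond_exp M F (\<lambda>x. \<bar>X x\<bar> powr p) x"
    using X by (intro real_cond_exp_pos) auto
  have "pmass M p (real_cond_exp M F X) \<le> (\<integral>\<^sup>+x. ennreal (real_cond_exp M F (\<lambda>x. \<bar>X x\<bar> powr p) x) \<partial>M)"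
    unfolding pmass_def using le by (intro nn_integral_mono_AE) (auto elim!: eventually_mono intro: ennreal_leI)
  also have "\<dots> = ennreal (\<integral>x. real_cond_exp M F (\<lambda>x. \<bar>X x\<bar> powr p) x \<partial>M)"
    by (rule nn_integral_eq_integral[OF real_cond_exp_int(1)[OF int] pos])
  also have "\<dots> = ennreal (\<integral>x. \<bar>X x\<bar> powr p \<partial>M)" by (simp add: real_cond_exp_int(2)[OF int])
  also have "\<dots> = pmass M p X" by (rule pmass_eq_integral[OF X(2), symmetric])
  finally show ?thesis .
qed

lemma (in finite_measure) pfuns_integrable:
  assumes "1 \<le> p" "f \<in> pfuns M p"
  shows "integrable M f"
proof (rule Bochner_Integration.integrable_bound)
  show "integrable M (\<lambda>x. 1 + \<bar>f x\<bar> powr p)"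
    using assms by (auto simp: p_integrable_functions_def)
  show "f \<in> borel_measurable M" by (rule pfuns_measurable[OF assms(2)])
  have "\<bar>a\<bar> \<le> 1 + \<bar>a\<bar> powr p" for a :: real
    using powr_mono[of 1 p "\<bar>a\<bar>"] assms(1) by (cases "\<bar>a\<bar> \<le> 1") (auto intro: add_increasing2)
  then show "AE x in M. norm (f x) \<le> norm (1 + \<bar>f x\<bar> powr p)" by (intro AE_I2) simp
qed

text \<open>
  Since \<open>k\<close> transports \<open>w\<^sup>p\<close> times the measure to \<open>\<rho>\<close>, the map \<open>h \<mapsto> w \<cdot> (h \<circ> k)\<close> is an isometry from
  \<open>L\<^sup>p(\<rho>)\<close> into the functions that vanish where \<open>w\<close> does.
\<close>

locale weighted_composition =
  fixes M :: "'a measure" and w k :: "'a \<Rightarrow> real" and \<rho> :: "real measure" and p :: real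
  assumes p_gt_1: "1 < p"
    and w_measurable [measurable]: "w \<in> borel_measurable M" and w_nonneg: "0 \<le> w x"
    and k_measurable [measurable]: "k \<in> borel_measurable M"
    and \<rho>_eq: "distr (density M (\<lambda>x. ennreal (w x powr p))) borel k = \<rho>"
    and prob_\<rho>: "prob_space \<rho>"
begin

definition m :: "'a measure" where "m = density M (\<lambda>x. ennreal (w x powr p))"

definition F :: "'a measure" where "F = vimage_algebra (space M) k borel"

definition \<Psi> :: "(real \<Rightarrow> real) \<Rightarrow> 'a \<Rightarrow> real" where "\<Psi> h = (\<lambda>x. w x * h (k x))"

text \<open>
  The left inverse of \<open>\<Psi>\<close>: divide by \<open>w\<close>, take the conditional expectation given \<open>k\<close> for the
  measure \<open>m\<close>, and read it as a function of \<open>k\<close>. Where \<open>w = 0\<close> the quotient is \<open>0\<close>, and that set is null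
  for \<open>m\<close>.
\<close>

definition \<Theta> :: "('a \<Rightarrow> real) \<Rightarrow> real \<Rightarrow> real" where
  "\<Theta> f = (SOME h. h \<in> borel_measurable borel \<and>
     (\<forall>x\<in>space M. real_cond_exp m F (\<lambda>x. f x / w x) x = h (k x)))"

lemma p_pos: "0 < p" using p_gt_1 by simp

lemma sets_m [measurable_cong]: "sets m = sets M" and space_m: "space m = space M"
  by (simp_all add: m_def)

lemma sets_\<rho> [measurable_cong]: "sets \<rho> = sets borel" and space_\<rho>: "space \<rho> = UNIV"
  by (simp_all add: \<rho>_eq[symmetric])

lemma \<rho>_distr: "\<rho> = distr m borel k"
  by (simp add: m_def \<rho>_eq)

sublocale m: prob_space m
  by (rule prob_space_distrD[of k m borel]) (use prob_\<rho> in \<open>simp_all add: \<rho>_distr\<close>)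

lemma k_F [measurable]: "k \<in> measurable F borel"
  unfolding F_def by (rule measurable_vimage_algebra1) simp

sublocale F: finite_measure_subalgebra m F
proof
  show "subalgebra m F"
    unfolding subalgebra_def F_def
    by (auto simp: space_m sets_vimage_algebra2 sets_m)
qed

lemma AE_m_iff: "(AE x in m. P x) \<longleftrightarrow> (AE x in M. 0 < w x \<longrightarrow> P x)"
proof -
  have "0 < ennreal (w x powr p) \<longleftrightarrow> 0 < w x" for x
    using w_nonneg[of x] by (auto simp: less_le)
  then show ?thesis unfolding m_def by (subst AE_density) auto
qed

lemma AE_\<rho>_iff: "{y. P y} \<in> sets borel \<Longrightarrow> (AE y in \<rho>. P y) \<longleftrightarrow> (AE x in m. P (k x))"
  unfolding \<rho>_distr by (rule AE_distr_iff) auto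

lemma pmass_\<rho>: "h \<in> borel_measurable borel \<Longrightarrow> pmass \<rho> p h = pmass m p (\<lambda>x. h (k x))"
  by (simp add: pmass_def \<rho>_distr nn_integral_distr)

lemma pmass_m: "f \<in> borel_measurable M \<Longrightarrow> pmass m p f = pmass M p (\<lambda>x. w x * f x)"
  using w_nonneg
  by (simp add: pmass_def m_def nn_integral_density abs_mult powr_mult ennreal_mult)

lemma pfuns_\<rho>_borel: "h \<in> pfuns \<rho> p \<Longrightarrow> h \<in> borel_measurable borel"
  using pfuns_measurable[of h \<rho> p] measurable_cong_sets[OF sets_\<rho> refl] by blast

lemma pmass_\<Psi>: "h \<in> borel_measurable borel \<Longrightarrow> pmass M p (\<Psi> h) = pmass \<rho> p h"
  by (simp add: pmass_\<rho> pmass_m \<Psi>_def)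

lemma \<Psi>_pfuns_iff: "h \<in> borel_measurable borel \<Longrightarrow> \<Psi> h \<in> pfuns M p \<longleftrightarrow> h \<in> pfuns \<rho> p"
  by (simp add: pfuns_iff pmass_\<Psi> measurable_cong_sets[OF sets_\<rho> refl]) (simp add: \<Psi>_def)

lemma pos_map_\<Psi>: "pos_map \<rho> M p 1 \<Psi>"
proof
  show "\<Psi> f \<in> pfuns M p" if "f \<in> pfuns \<rho> p" for f
    using that by (simp add: \<Psi>_pfuns_iff pfuns_\<rho>_borel)
  show "AE y in M. 0 \<le> \<Psi> f y" if f: "f \<in> pfuns \<rho> p" and pos: "AE x in \<rho>. 0 \<le> f x" for f
  proof -
    have [measurable]: "f \<in> borel_measurable borel" by (rule pfuns_\<rho>_borel[OF f])
    have "AE x in m. 0 \<le> f (k x)" using pos by (subst (asm) AE_\<rho>_iff) auto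
    then have "AE x in M. 0 < w x \<longrightarrow> 0 \<le> f (k x)" by (simp add: AE_m_iff)
    then show ?thesis
    proof eventually_elim
      case (elim x)
      then show ?case using w_nonneg[of x] by (cases "w x = 0") (auto simp: \<Psi>_def less_le)
    qed
  qed
qed (auto simp: p_pos \<Psi>_def distrib_left pmass_\<Psi> pfuns_\<rho>_borel pmass_\<Psi>[unfolded \<Psi>_def])

lemma quotient_pfuns: "f \<in> pfuns M p \<Longrightarrow> (\<lambda>x. f x / w x) \<in> pfuns m p"
  and pmass_quotient: "f \<in> pfuns M p \<Longrightarrow> pmass m p (\<lambda>x. f x / w x) \<le> pmass M p f"
proof -
  assume f: "f \<in> pfuns M p"
  have [measurable]: "f \<in> borel_measurable M" by (rule pfuns_measurable[OF f])
  have "pmass m p (\<lambda>x. f x / w x) = pmass M p (\<lambda>x. w x * (f x / w x))" by (rule pmass_m) measurable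
  also have "\<dots> \<le> pmass M p f" using p_pos by (intro pmass_mono_AE) auto
  finally show "pmass m p (\<lambda>x. f x / w x) \<le> pmass M p f" .
  then show "(\<lambda>x. f x / w x) \<in> pfuns m p" using f by (auto simp: pfuns_iff)
qed

lemma quotient_integrable: "f \<in> pfuns M p \<Longrightarrow> integrable m (\<lambda>x. f x / w x)"
  using p_gt_1 by (intro m.pfuns_integrable[OF _ quotient_pfuns]) auto

lemma \<Theta>_measurable [measurable]: "\<Theta> f \<in> borel_measurable borel"
  and \<Theta>_comp: "x \<in> space M \<Longrightarrow> \<Theta> f (k x) = real_cond_exp m F (\<lambda>x. f x / w x) x"
proof -
  have "\<exists>h\<in>borel_measurable borel. \<forall>x\<in>space M. real_cond_exp m F (\<lambda>x. f x / w x) x = h (k x)"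
    using borel_measurable_cond_exp[of m F "\<lambda>x. f x / w x"] unfolding F_def
    by (intro vimage_algebra_factor) auto
  then have "\<exists>h. h \<in> borel_measurable borel \<and> (\<forall>x\<in>space M. real_cond_exp m F (\<lambda>x. f x / w x) x = h (k x))"
    by blast
  from someI_ex[OF this]
  show "\<Theta> f \<in> borel_measurable borel" "x \<in> space M \<Longrightarrow> \<Theta> f (k x) = real_cond_exp m F (\<lambda>x. f x / w x) x"
    unfolding \<Theta>_def by auto
qed

lemma pmass_\<Theta>: "f \<in> pfuns M p \<Longrightarrow> pmass \<rho> p (\<Theta> f) \<le> pmass M p f"
proof -
  assume f: "f \<in> pfuns M p"
  have "pmass \<rho> p (\<Theta> f) = pmass m p (\<lambda>x. \<Theta> f (k x))" by (rule pmass_\<rho>) measurable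
  also have "\<dots> = pmass m p (real_cond_exp m F (\<lambda>x. f x / w x))"
    by (intro pmass_cong_AE AE_I2) (simp add: \<Theta>_comp space_m)
  also have "\<dots> \<le> pmass m p (\<lambda>x. f x / w x)"
    using p_gt_1 by (intro F.pmass_cond_exp_le quotient_integrable quotient_pfuns f) auto
  also have "\<dots> \<le> pmass M p f" by (rule pmass_quotient[OF f])
  finally show ?thesis .
qed

lemma AE_m_space: "AE x in m. x \<in> space M"
  using AE_space[of m] by (simp add: space_m)

lemma pos_map_\<Theta>: "pos_map M \<rho> p 1 \<Theta>"
proof
  show "\<Theta> f \<in> pfuns \<rho> p" if "f \<in> pfuns M p" for f
    using pmass_\<Theta>[OF that] that by (auto simp: pfuns_iff)
  show "AE y in \<rho>. \<Theta> (\<lambda>x. f x + g x) y = \<Theta> f y + \<Theta> g y"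
    if f: "f \<in> pfuns M p" and g: "g \<in> pfuns M p" for f g
  proof (subst AE_\<rho>_iff)
    show "AE x in m. \<Theta> (\<lambda>x. f x + g x) (k x) = \<Theta> f (k x) + \<Theta> g (k x)"
      using F.real_cond_exp_add[OF quotient_integrable[OF f] quotient_integrable[OF g]] AE_m_space
      by eventually_elim (simp add: \<Theta>_comp add_divide_distrib)
  qed measurable
  show "AE y in \<rho>. \<Theta> (\<lambda>x. c * f x) y = c * \<Theta> f y" if f: "f \<in> pfuns M p" for c f
  proof (subst AE_\<rho>_iff)
    show "AE x in m. \<Theta> (\<lambda>x. c * f x) (k x) = c * \<Theta> f (k x)"
      using F.real_cond_exp_cmult[OF quotient_integrable[OF f], of c] AE_m_space
      by eventually_elim (simp add: \<Theta>_comp)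
  qed measurable
  show "AE y in \<rho>. 0 \<le> \<Theta> f y" if f: "f \<in> pfuns M p" and pos: "AE x in M. 0 \<le> f x" for f
  proof (subst AE_\<rho>_iff)
    have "AE x in m. 0 \<le> f x / w x"
      unfolding AE_m_iff using pos by eventually_elim simp
    then have "AE x in m. 0 \<le> real_cond_exp m F (\<lambda>x. f x / w x) x"
      using quotient_integrable[OF f] by (intro F.real_cond_exp_pos) auto
    with AE_m_space show "AE x in m. 0 \<le> \<Theta> f (k x)"
      by eventually_elim (simp add: \<Theta>_comp)
  qed measurable
qed (auto simp: p_pos pmass_\<Theta>)

lemma \<Theta>_\<Psi>:
  assumes h: "h \<in> pfuns \<rho> p"
  shows "AE y in \<rho>. \<Theta> (\<Psi> h) y = h y"
proof -
  have [measurable]: "h \<in> borel_measurable borel" by (rule pfuns_\<rho>_borel[OF h])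
  have "pmass m p (\<lambda>x. h (k x)) < \<infinity>" using h by (simp add: pfuns_iff pmass_\<rho>)
  then have "(\<lambda>x. h (k x)) \<in> pfuns m p" by (auto simp: pfuns_iff)
  then have int: "integrable m (\<lambda>x. h (k x))" using p_gt_1 by (intro m.pfuns_integrable) auto
  have "AE x in m. real_cond_exp m F (\<lambda>x. \<Psi> h x / w x) x = real_cond_exp m F (\<lambda>x. h (k x)) x"
  proof (rule F.real_cond_exp_cong)
    show "AE x in m. \<Psi> h x / w x = h (k x)" unfolding AE_m_iff by (intro AE_I2) (simp add: \<Psi>_def)
  qed (auto simp: \<Psi>_def)
  moreover have "AE x in m. real_cond_exp m F (\<lambda>x. h (k x)) x = h (k x)"
    by (rule F.real_cond_exp_F_meas[OF int]) measurable
  ultimately have "AE x in m. \<Theta> (\<Psi> h) (k x) = h (k x)"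
    using AE_m_space by eventually_elim (simp add: \<Theta>_comp)
  then show ?thesis by (subst AE_\<rho>_iff) auto
qed

lemma cut_\<Psi>: "x \<in> space M \<Longrightarrow> cut {x \<in> space M. 0 < w x} (\<Psi> h) x = \<Psi> h x"
  using w_nonneg[of x] by (auto simp: cut_def \<Psi>_def)

end

section \<open>Disjoint copies of a distribution on the line\<close>

text \<open>
  A piece of \<open>\<rho>\<close> is given by a density and not just by a set, because its mass has to be rescaled, and
  in the atomic case by a different factor at each point.
\<close>

definition disjoint_copies :: "real measure \<Rightarrow> (nat \<Rightarrow> real \<Rightarrow> real) \<Rightarrow> (nat \<Rightarrow> real \<Rightarrow> real) \<Rightarrow> bool" where
  "disjoint_copies \<rho> a \<kappa> \<longleftrightarrow>
     (\<forall>n. a n \<in> borel_measurable borel \<and> \<kappa> n \<in> borel_measurable borel \<and> (\<forall>y. 0 \<le> a n y) \<and>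
       distr (density \<rho> (\<lambda>y. ennreal (a n y))) borel (\<kappa> n) = \<rho>) \<and>
     (\<forall>n m y. n \<noteq> m \<longrightarrow> a n y = 0 \<or> a m y = 0)"

lemma borel_of_countable: "countable (A :: real set) \<Longrightarrow> A \<in> sets borel"
  by (rule sets.countable) auto

lemma distr_density_eqI:
  fixes \<rho> :: "real measure"
  assumes [measurable_cong]: "sets \<rho> = sets borel"
    and [measurable]: "a \<in> borel_measurable borel" "\<kappa> \<in> borel_measurable borel"
    and eq: "\<And>B. B \<in> sets borel \<Longrightarrow> (\<integral>\<^sup>+y. ennreal (a y) * indicator B (\<kappa> y) \<partial>\<rho>) = emeasure \<rho> B"
  shows "distr (density \<rho> (\<lambda>y. ennreal (a y))) borel \<kappa> = \<rho>"
proof (rule measure_eqI)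
  fix B assume "B \<in> sets (distr (density \<rho> (\<lambda>y. ennreal (a y))) borel \<kappa>)"
  then have [measurable]: "B \<in> sets borel" by simp
  have "emeasure (distr (density \<rho> (\<lambda>y. ennreal (a y))) borel \<kappa>) B
      = (\<integral>\<^sup>+y. indicator B y \<partial>distr (density \<rho> (\<lambda>y. ennreal (a y))) borel \<kappa>)" by simp
  also have "\<dots> = (\<integral>\<^sup>+y. ennreal (a y) * indicator B (\<kappa> y) \<partial>\<rho>)"
    by (subst nn_integral_distr, measurable, subst nn_integral_density) auto
  also have "\<dots> = emeasure \<rho> B" by (rule eq) measurable
  finally show "emeasure (distr (density \<rho> (\<lambda>y. ennreal (a y))) borel \<kappa>) B = emeasure \<rho> B" .
qed (simp add: assms)

text \<open>
  The equivalence is the Galois connection between the distribution function and its generalized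
  inverse \<open>q\<close>; the integral formula says that \<open>q\<close> transports the uniform distribution to \<open>\<rho>\<close>.
\<close>

lemma quantile_function:
  assumes "real_distribution \<rho>"
  shows "\<exists>q\<in>borel_measurable borel. (\<forall>s x. 0 < s \<and> s < 1 \<longrightarrow> (s \<le> cdf \<rho> x \<longleftrightarrow> q s \<le> x)) \<and>
    (\<forall>f::real \<Rightarrow> ennreal. f \<in> borel_measurable borel \<longrightarrow>
      (\<integral>\<^sup>+y. f y \<partial>\<rho>) = (\<integral>\<^sup>+s. f (q s) * indicator {0<..<1} s \<partial>lborel))"
proof -
  interpret cdf_distribution \<rho> unfolding cdf_distribution_def by fact
  define q where "q s = (if s \<in> {0<..<1} then I s else 0)" for s
  have "q \<in> borel_measurable borel"
    using measurable_CI measurable_restrict_space_iff[of "{0<..<1}" borel 0 borel I]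
    unfolding q_def by simp
  moreover have "s \<le> cdf \<rho> x \<longleftrightarrow> q s \<le> x" if "0 < s" "s < 1" for s x
  proof -
    have "q s = I s" using that by (simp add: q_def)
    then show ?thesis using pseudoinverse[OF that, of x] by metis
  qed
  moreover have "(\<integral>\<^sup>+y. f y \<partial>\<rho>) = (\<integral>\<^sup>+s. f (q s) * indicator {0<..<1} s \<partial>lborel)"
    if [measurable]: "f \<in> borel_measurable borel" for f :: "real \<Rightarrow> ennreal"
  proof -
    have I: "I \<in> borel_measurable (restrict_space lborel {0<..<1})"
      using measurable_CI measurable_cong_sets[OF sets_restrict_space_cong[OF sets_lborel] refl] by blast
    have "(\<integral>\<^sup>+y. f y \<partial>\<rho>) = (\<integral>\<^sup>+y. f y \<partial>distr (restrict_space lborel {0<..<1::real}) borel I)"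
      by (simp only: distr_I_eq_M)
    also have "\<dots> = (\<integral>\<^sup>+s. f (I s) \<partial>restrict_space lborel {0<..<1::real})"
      by (rule nn_integral_distr[OF I]) simp
    also have "\<dots> = (\<integral>\<^sup>+s. f (I s) * indicator {0<..<1} s \<partial>lborel)"
      by (rule nn_integral_restrict_space) simp
    also have "\<dots> = (\<integral>\<^sup>+s. f (q s) * indicator {0<..<1} s \<partial>lborel)"
      by (intro nn_integral_cong) (simp add: q_def indicator_def)
    finally show ?thesis .
  qed
  ultimately show ?thesis by blast
qed

text \<open>
  Without atoms the distribution function is continuous, hence a left inverse of the quantile
  function, and it therefore transports \<open>\<rho>\<close> back to the uniform distribution.
\<close>

lemma nn_integral_cdf_atomless:
  fixes f :: "real \<Rightarrow> ennreal"
  assumes \<rho>: "real_distribution \<rho>" and atomless: "\<And>x. measure \<rho> {x} = 0"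
    and f [measurable]: "f \<in> borel_measurable borel"
  shows "(\<integral>\<^sup>+y. f (cdf \<rho> y) \<partial>\<rho>) = (\<integral>\<^sup>+s. f s * indicator {0<..<1} s \<partial>lborel)"
proof -
  interpret cdf_distribution \<rho> unfolding cdf_distribution_def by fact
  obtain q where q: "q \<in> borel_measurable borel"
      "\<forall>s x. 0 < s \<and> s < 1 \<longrightarrow> (s \<le> cdf \<rho> x \<longleftrightarrow> q s \<le> x)"
      "\<forall>f::real \<Rightarrow> ennreal. f \<in> borel_measurable borel \<longrightarrow>
        (\<integral>\<^sup>+y. f y \<partial>\<rho>) = (\<integral>\<^sup>+s. f (q s) * indicator {0<..<1} s \<partial>lborel)"
    using quantile_function[OF \<rho>] by blast
  have inverse: "cdf \<rho> (q s) = s" if s: "0 < s" "s < 1" for s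
  proof (rule antisym)
    show "s \<le> cdf \<rho> (q s)" using q(2) s by simp
    show "cdf \<rho> (q s) \<le> s"
    proof (rule ccontr)
      assume "\<not> cdf \<rho> (q s) \<le> s"
      moreover have "isCont (cdf \<rho>) (q s)"
        using finite_borel_measure.isCont_cdf[OF finite_borel_measure_M] atomless by simp
      then have "(cdf \<rho> \<longlongrightarrow> cdf \<rho> (q s)) (at_left (q s))"
        by (simp add: isCont_def filterlim_at_split)
      ultimately have "\<forall>\<^sub>F x in at_left (q s). s < cdf \<rho> x" by (intro order_tendstoD(1)) auto
      moreover have "\<forall>\<^sub>F x in at_left (q s). x < q s" by (simp add: eventually_at_filter)
      ultimately have "\<forall>\<^sub>F x in at_left (q s). False"
        by eventually_elim (use q(2) s in \<open>meson less_le_not_le less_imp_le\<close>)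
      then show False by simp
    qed
  qed
  have "(\<integral>\<^sup>+y. f (cdf \<rho> y) \<partial>\<rho>) = (\<integral>\<^sup>+s. f (cdf \<rho> (q s)) * indicator {0<..<1} s \<partial>lborel)"
    by (rule q(3)[rule_format]) measurable
  also have "\<dots> = (\<integral>\<^sup>+s. f s * indicator {0<..<1} s \<partial>lborel)"
    by (intro nn_integral_cong) (auto simp: inverse indicator_def)
  finally show ?thesis .
qed

text \<open>
  The normalized diffuse part \<open>\<nu>\<close> of \<open>\<rho>\<close> becomes uniform under its distribution function. The
  \<open>n\<close>-th piece is the part over the dyadic interval from \<open>2\<^bsup>-n-1\<^esup>\<close> to \<open>2\<^bsup>-n\<^esup>\<close>; it is stretched to the
  unit interval and then mapped to \<open>\<rho>\<close> by the quantile function.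
\<close>

lemma disjoint_copies_diffuse:
  assumes \<rho>: "real_distribution \<rho>" and diffuse: "0 < measure \<rho> {y. measure \<rho> {y} = 0}"
  shows "\<exists>a \<kappa>. disjoint_copies \<rho> a \<kappa>"
proof -
  interpret real_distribution \<rho> by fact
  define N where "N = {y. measure \<rho> {y} = 0}"
  have "countable {y. measure \<rho> {y} > 0}"
    by (rule finite_borel_measure.countable_atoms[OF finite_borel_measure_M])
  then have "{y. measure \<rho> {y} > 0} \<in> sets borel" by (rule borel_of_countable)
  moreover have "N = UNIV - {y. measure \<rho> {y} > 0}" by (auto simp: N_def less_le)
  ultimately have N [measurable]: "N \<in> sets borel" by auto
  define r where "r = measure \<rho> N"
  have r: "r > 0" using diffuse by (simp add: r_def N_def)
  define \<nu> where "\<nu> = density \<rho> (\<lambda>y. ennreal (indicator N y / r))"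
  have [measurable_cong]: "sets \<nu> = sets borel" by (simp add: \<nu>_def)
  have emeasure_\<nu>: "emeasure \<nu> X = ennreal (1 / r) * emeasure \<rho> (N \<inter> X)" if [measurable]: "X \<in> sets borel" for X
  proof -
    have "emeasure \<nu> X = (\<integral>\<^sup>+y. ennreal (1 / r) * indicator (N \<inter> X) y \<partial>\<rho>)"
      unfolding \<nu>_def by (subst emeasure_density) (auto intro!: nn_integral_cong simp: indicator_def)
    also have "\<dots> = ennreal (1 / r) * emeasure \<rho> (N \<inter> X)" by (simp add: nn_integral_cmult)
    finally show ?thesis .
  qed
  have "prob_space \<nu>"
  proof
    have "emeasure \<nu> UNIV = ennreal (1 / r) * ennreal r"
      by (subst emeasure_\<nu>) (auto simp: r_def emeasure_eq_measure)
    then show "emeasure \<nu> (space \<nu>) = 1"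
      using r by (simp add: \<nu>_def flip: ennreal_mult)
  qed
  then have \<nu>: "real_distribution \<nu>" by (simp add: real_distribution_def real_distribution_axioms_def \<open>sets \<nu> = sets borel\<close>)
  have atomless: "measure \<nu> {x} = 0" for x
  proof (cases "x \<in> N")
    case True
    then have "emeasure \<rho> (N \<inter> {x}) = 0" by (simp add: N_def emeasure_eq_measure)
    then show ?thesis by (simp add: measure_def emeasure_\<nu>)
  qed (simp add: measure_def emeasure_\<nu>)
  have cdf_meas [measurable]: "cdf \<nu> \<in> borel_measurable borel"
    by (intro cdf_distribution.measurable_C) (simp add: cdf_distribution_def \<nu>)
  obtain q :: "real \<Rightarrow> real" where q [measurable]: "q \<in> borel_measurable borel"
      and q_int: "\<forall>f::real \<Rightarrow> ennreal. f \<in> borel_measurable borel \<longrightarrow>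
        (\<integral>\<^sup>+y. f y \<partial>\<rho>) = (\<integral>\<^sup>+s. f (q s) * indicator {0<..<1} s \<partial>lborel)"
    using quantile_function[OF \<rho>] by blast
  define A where "A n = {(1/2) ^ Suc n<..<(1/2::real) ^ n}" for n :: nat
  define a where "a n y = 2 ^ Suc n * (indicator N y / r) * indicator (A n) (cdf \<nu> y)" for n y
  define \<kappa> where "\<kappa> n y = q (2 ^ Suc n * cdf \<nu> y - 1)" for n :: nat and y
  have [measurable]: "a n \<in> borel_measurable borel" "\<kappa> n \<in> borel_measurable borel" for n
    unfolding a_def \<kappa>_def A_def by measurable
  have "distr (density \<rho> (\<lambda>y. ennreal (a n y))) borel (\<kappa> n) = \<rho>" for n
  proof (rule distr_density_eqI)
    fix B :: "real set" assume B [measurable]: "B \<in> sets borel"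
    define f where "f s = ennreal (2 ^ Suc n) * indicator (A n) s * indicator B (q (2 ^ Suc n * s - 1))" for s
    have [measurable]: "f \<in> borel_measurable borel" unfolding f_def A_def by measurable
    have "(\<integral>\<^sup>+y. ennreal (a n y) * indicator B (\<kappa> n y) \<partial>\<rho>)
        = (\<integral>\<^sup>+y. ennreal (indicator N y / r) * f (cdf \<nu> y) \<partial>\<rho>)"
      using r by (intro nn_integral_cong) (auto simp: a_def \<kappa>_def f_def indicator_def mult.commute simp flip: ennreal_mult)
    also have "\<dots> = (\<integral>\<^sup>+y. f (cdf \<nu> y) \<partial>\<nu>)"
      unfolding \<nu>_def[symmetric] by (subst (2) \<nu>_def) (subst nn_integral_density, auto)
    also have "\<dots> = (\<integral>\<^sup>+s. f s * indicator {0<..<1} s \<partial>lborel)"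
      by (rule nn_integral_cdf_atomless[OF \<nu> atomless]) measurable
    also have "\<dots> = ennreal \<bar>(1/2) ^ Suc n\<bar> * (\<integral>\<^sup>+t. f ((1/2) ^ Suc n + (1/2) ^ Suc n * t) *
        indicator {0<..<1} ((1/2) ^ Suc n + (1/2) ^ Suc n * t) \<partial>lborel)"
      by (rule nn_integral_real_affine) auto
    also have "\<dots> = (\<integral>\<^sup>+t. ennreal ((1/2) ^ Suc n) * (f ((1/2) ^ Suc n + (1/2) ^ Suc n * t) *
        indicator {0<..<1} ((1/2) ^ Suc n + (1/2) ^ Suc n * t)) \<partial>lborel)"
      by (subst nn_integral_cmult) auto
    also have "\<dots> = (\<integral>\<^sup>+t. indicator B (q t) * indicator {0<..<1} t \<partial>lborel)"
    proof (intro nn_integral_cong)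
      fix t :: real
      \<comment> \<open>after the substitution \<open>s = h + h t\<close>, the dyadic interval \<open>A n\<close> has become the unit interval\<close>
      define h where "h = (1/2::real) ^ Suc n"
      have h: "h > 0" "h \<le> 1/2" "2 ^ Suc n * h = 1" "(1/2) ^ n = 2 * h"
        by (auto simp: h_def power_le_one power_one_over)
      have 1: "h + h * t \<in> A n \<longleftrightarrow> t \<in> {0<..<1}"
        using h(1) unfolding A_def h(4) h_def[symmetric] by (auto simp: zero_less_mult_iff)
      have 2: "h + h * t \<in> {0<..<1}" if "t \<in> {0<..<1}"
      proof -
        have "0 < h * t" "h * t < h" using that h(1) by auto
        then show ?thesis using h(1,2) unfolding greaterThanLessThan_iff by linarith
      qed
      have 3: "2 ^ Suc n * (h + h * t) - 1 = t"
      proof -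
        have "2 ^ Suc n * (h + h * t) = (2 ^ Suc n * h) * (1 + t)" by (simp only: distrib_left mult.assoc mult_1_right)
        then show ?thesis by (simp only: h(3) mult_1 add_diff_cancel_left')
      qed
      have 4: "ennreal h * ennreal (2 ^ Suc n) = 1"
      proof -
        have "ennreal h * ennreal (2 ^ Suc n) = ennreal (2 ^ Suc n * h)"
          using h(1) by (subst ennreal_mult) (auto simp: mult.commute)
        then show ?thesis unfolding h(3) by simp
      qed
      show "ennreal ((1/2) ^ Suc n) * (f ((1/2) ^ Suc n + (1/2) ^ Suc n * t) *
          indicator {0<..<1} ((1/2) ^ Suc n + (1/2) ^ Suc n * t)) = indicator B (q t) * indicator {0<..<1} t"
      proof (cases "t \<in> {0<..<1}")
        case True
        have "ennreal h * (f (h + h * t) * indicator {0<..<1} (h + h * t))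
            = (ennreal h * ennreal (2 ^ Suc n)) * indicator B (q t)"
          unfolding f_def 3 using True 1 2[OF True] by (simp only: indicator_simps mult_1_right mult_1 ac_simps)
        then show ?thesis using True by (simp only: h_def[symmetric] 4) simp
      next
        case False
        then have "f (h + h * t) = 0" using 1 by (simp add: f_def)
        then show ?thesis using False by (simp only: h_def[symmetric]) simp
      qed
    qed
    also have "\<dots> = (\<integral>\<^sup>+y. indicator B y \<partial>\<rho>)" by (rule q_int[rule_format, symmetric]) measurable
    also have "\<dots> = emeasure \<rho> B" by simp
    finally show "(\<integral>\<^sup>+y. ennreal (a n y) * indicator B (\<kappa> n y) \<partial>\<rho>) = emeasure \<rho> B" .
  qed (auto simp: events_eq_borel)
  moreover have "a n y = 0 \<or> a m y = 0" if "n \<noteq> m" for n m y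
  proof -
    have lt: "A i \<inter> A j = {}" if "i < j" for i j
    proof -
      have "(1/2::real) ^ j \<le> (1/2) ^ Suc i" using that by (intro power_decreasing) auto
      then show ?thesis unfolding A_def by (auto simp del: power_Suc)
    qed
    have "A n \<inter> A m = {}" using lt[of n m] lt[of m n] \<open>n \<noteq> m\<close> by (cases "n < m") auto
    then show ?thesis by (auto simp: a_def indicator_def)
  qed
  ultimately have "disjoint_copies \<rho> a \<kappa>"
    using r unfolding disjoint_copies_def by (auto simp: a_def)
  then show ?thesis by blast
qed

text \<open>
  Number the atoms by pairs of natural numbers. The \<open>n\<close>-th piece consists of the atoms with first index
  \<open>n\<close>, and \<open>\<kappa> n\<close> sends the atom with index \<open>(n, j)\<close> to the \<open>j\<close>-th atom; the densities correct the masses.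
\<close>

lemma disjoint_copies_atomic:
  assumes \<rho>: "real_distribution \<rho>" and atomic: "measure \<rho> {y. measure \<rho> {y} = 0} = 0"
    and inf: "infinite {y. 0 < measure \<rho> {y}}"
  shows "\<exists>a \<kappa>. disjoint_copies \<rho> a \<kappa>"
proof -
  interpret real_distribution \<rho> by fact
  define A where "A = {y. 0 < measure \<rho> {y}}"
  have A: "countable A" unfolding A_def
    by (rule finite_borel_measure.countable_atoms[OF finite_borel_measure_M])
  then have A_sets [measurable]: "A \<in> sets borel" by (rule borel_of_countable)
  have infA: "infinite A" using inf by (simp add: A_def)
  define e where "e = from_nat_into A"
  define i where "i = to_nat_on A"
  have e: "e n \<in> A" and ie: "i (e n) = n" for n
    using A infA from_nat_into[of A n] by (auto simp: e_def i_def to_nat_on_from_nat_into_infinite)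
  have ei: "e (i y) = y" if "y \<in> A" for y
    using A that by (simp add: e_def i_def)
  have "{y. measure \<rho> {y} = 0} = UNIV - A" by (auto simp: A_def less_le)
  then have "emeasure \<rho> (UNIV - A) = 0" using atomic by (simp add: emeasure_eq_measure)
  then have AE_A: "AE y in \<rho>. y \<in> A" by (intro AE_I[of _ _ "UNIV - A"]) auto
  have nn_int: "(\<integral>\<^sup>+y. f y \<partial>\<rho>) = (\<Sum>n. f (e n) * emeasure \<rho> {e n})"
    if [measurable]: "f \<in> borel_measurable borel" for f :: "real \<Rightarrow> ennreal"
  proof -
    have "(\<integral>\<^sup>+y. f y \<partial>\<rho>) = (\<integral>\<^sup>+y. (\<Sum>n. f (e n) * indicator {e n} y) \<partial>\<rho>)"
    proof (rule nn_integral_cong_AE)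
      show "AE y in \<rho>. f y = (\<Sum>n. f (e n) * indicator {e n} y)"
        using AE_A
      proof eventually_elim
        case (elim y)
        have "(\<Sum>n. f (e n) * indicator {e n} y) = (\<Sum>n\<in>{i y}. f (e n) * indicator {e n} y)"
          by (rule suminf_finite) (use ie in \<open>auto simp: indicator_def\<close>)
        then show ?case using ei[OF elim] by simp
      qed
    qed
    also have "\<dots> = (\<Sum>n. \<integral>\<^sup>+y. f (e n) * indicator {e n} y \<partial>\<rho>)" by (rule nn_integral_suminf) measurable
    also have "\<dots> = (\<Sum>n. f (e n) * emeasure \<rho> {e n})" by (simp add: nn_integral_cmult)
    finally show ?thesis .
  qed
  define \<kappa> where "\<kappa> n y = (if y \<in> A then e (snd (prod_decode (i y))) else 0)" for n :: nat and y
  define a where "a n y = (if y \<in> A \<and> fst (prod_decode (i y)) = n then measure \<rho> {\<kappa> n y} / measure \<rho> {y} else 0)" for n y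
  have meas: "f \<in> borel_measurable borel" if "\<And>y. y \<notin> A \<Longrightarrow> f y = 0" for f :: "real \<Rightarrow> real"
    by (rule measurable_discrete_difference[of "\<lambda>_. 0" borel borel A]) (use that A in auto)
  have [measurable]: "a n \<in> borel_measurable borel" "\<kappa> n \<in> borel_measurable borel" for n
    by (rule meas; simp add: a_def \<kappa>_def)+
  have "distr (density \<rho> (\<lambda>y. ennreal (a n y))) borel (\<kappa> n) = \<rho>" for n
  proof (rule distr_density_eqI)
    fix B :: "real set" assume B [measurable]: "B \<in> sets borel"
    define f where "f = (\<lambda>(m, j). if m = n then indicator B (e j) * emeasure \<rho> {e j} else 0)"
    have "(\<integral>\<^sup>+y. ennreal (a n y) * indicator B (\<kappa> n y) \<partial>\<rho>)
        = (\<Sum>k. ennreal (a n (e k)) * indicator B (\<kappa> n (e k)) * emeasure \<rho> {e k})"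
      by (rule nn_int) measurable
    also have "\<dots> = (\<Sum>k. f (prod_decode k))"
    proof (rule suminf_cong)
      fix k
      have "0 < measure \<rho> {e k}" using e[of k] by (simp add: A_def)
      then show "ennreal (a n (e k)) * indicator B (\<kappa> n (e k)) * emeasure \<rho> {e k} = f (prod_decode k)"
        using e[of k]
        by (auto simp: f_def a_def \<kappa>_def ie emeasure_eq_measure indicator_def split: prod.splits simp flip: ennreal_mult)
    qed
    also have "\<dots> = (\<Sum>m. \<Sum>j. f (m, j))" by (rule suminf_ennreal_2dimen) simp
    also have "\<dots> = (\<Sum>m\<in>{n}. \<Sum>j. f (m, j))" by (rule suminf_finite) (auto simp: f_def)
    also have "\<dots> = (\<Sum>j. indicator B (e j) * emeasure \<rho> {e j})" by (simp add: f_def)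
    also have "\<dots> = (\<integral>\<^sup>+y. indicator B y \<partial>\<rho>)" by (rule nn_int[symmetric]) measurable
    also have "\<dots> = emeasure \<rho> B" by simp
    finally show "(\<integral>\<^sup>+y. ennreal (a n y) * indicator B (\<kappa> n y) \<partial>\<rho>) = emeasure \<rho> B" .
  qed (auto simp: events_eq_borel)
  then have "disjoint_copies \<rho> a \<kappa>"
    unfolding disjoint_copies_def by (auto simp: a_def)
  then show ?thesis by blast
qed

theorem disjoint_copies_exist:
  assumes \<rho>: "real_distribution \<rho>" and inf: "\<And>A. finite A \<Longrightarrow> \<not> (AE y in \<rho>. y \<in> A)"
  shows "\<exists>a \<kappa>. disjoint_copies \<rho> a \<kappa>"
proof (cases "measure \<rho> {y. measure \<rho> {y} = 0} = 0")
  case True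
  interpret real_distribution \<rho> by fact
  define A where "A = {y. 0 < measure \<rho> {y}}"
  have "countable A" unfolding A_def
    by (rule finite_borel_measure.countable_atoms[OF finite_borel_measure_M])
  then have A_sets [measurable]: "A \<in> sets borel" by (rule borel_of_countable)
  have "{y. measure \<rho> {y} = 0} = UNIV - A" by (auto simp: A_def less_le)
  then have "emeasure \<rho> (UNIV - A) = 0" using True by (simp add: emeasure_eq_measure)
  then have "AE y in \<rho>. y \<in> A" by (intro AE_I[of _ _ "UNIV - A"]) auto
  then have "infinite A" using inf by blast
  then show ?thesis using disjoint_copies_atomic[OF \<rho> True] by (simp add: A_def)
next
  case False
  then show ?thesis using disjoint_copies_diffuse[OF \<rho>] by (simp add: less_le)
qed

section \<open>Coding a separable space of functions on the line\<close>

text \<open>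
  A sequence of bits becomes a real number with digits \<open>0\<close> and \<open>1\<close> in base four. The tail after any
  digit is then less than one unit, so that digit is the parity of an integer part.
\<close>

definition base4 :: "(nat \<Rightarrow> bool) \<Rightarrow> real" where
  "base4 b = (\<Sum>i. of_bool (b i) * (1/4) ^ Suc i)"

lemma base4_summable: "summable (\<lambda>i. of_bool (b i) * (1/4::real) ^ Suc i)"
  by (rule summable_comparison_test'[of "\<lambda>i. (1/4::real) ^ Suc i" 0])
     (auto simp: summable_Suc_iff summable_mult intro!: summable_geometric summable_mult)

lemma base4_bounds: "0 \<le> base4 b" "base4 b < 1"
proof -
  show "0 \<le> base4 b" unfolding base4_def by (intro suminf_nonneg base4_summable) auto
  have geo: "(\<lambda>i. (1/4::real) * (1/4) ^ i) sums (1/4 * (1 / (1 - 1/4)))"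
    by (intro sums_mult geometric_sums) auto
  have "base4 b \<le> (\<Sum>i. (1/4::real) * (1/4) ^ i)"
    unfolding base4_def by (intro suminf_le base4_summable sums_summable[OF geo]) auto
  also have "\<dots> = 1/3" using sums_unique[OF geo] by simp
  finally show "base4 b < 1" by simp
qed

lemma base4_shift: "4 * base4 b = of_bool (b 0) + base4 (\<lambda>i. b (Suc i))"
proof -
  have "base4 b = (\<Sum>i. of_bool (b (Suc i)) * (1/4) ^ Suc (Suc i)) + of_bool (b 0) * (1/4) ^ Suc 0"
    using suminf_split_head[OF base4_summable[of b]] unfolding base4_def by simp
  also have "(\<Sum>i. of_bool (b (Suc i)) * (1/4) ^ Suc (Suc i)) = (\<Sum>i. 1/4 * (of_bool (b (Suc i)) * (1/4::real) ^ Suc i))"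
    by (intro suminf_cong) simp
  also have "\<dots> = 1/4 * base4 (\<lambda>i. b (Suc i))"
    unfolding base4_def by (intro suminf_mult base4_summable)
  finally show ?thesis by simp
qed

lemma base4_digit: "odd \<lfloor>4 ^ Suc n * base4 b\<rfloor> \<longleftrightarrow> b n"
proof -
  have "\<exists>K::int. 4 ^ n * base4 b = of_int K + base4 (\<lambda>i. b (i + n))" for n
  proof (induction n)
    case 0
    then show ?case by (intro exI[of _ 0]) simp
  next
    case (Suc n)
    then obtain K :: int where "4 ^ n * base4 b = of_int K + base4 (\<lambda>i. b (i + n))" by blast
    then have "4 ^ Suc n * base4 b = of_int (4 * K) + 4 * base4 (\<lambda>i. b (i + n))" by simp
    also have "\<dots> = of_int (4 * K + of_bool (b n)) + base4 (\<lambda>i. b (i + Suc n))"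
      by (subst base4_shift) simp
    finally show ?case by blast
  qed
  then obtain K :: int where "4 ^ n * base4 b = of_int K + base4 (\<lambda>i. b (i + n))" by blast
  then have "4 ^ Suc n * base4 b = of_int (4 * K) + 4 * base4 (\<lambda>i. b (i + n))" by simp
  also have "\<dots> = of_int (4 * K + of_bool (b n)) + base4 (\<lambda>i. b (i + Suc n))"
    by (subst base4_shift) simp
  finally have "\<lfloor>4 ^ Suc n * base4 b\<rfloor> = 4 * K + of_bool (b n)"
    using base4_bounds[of "\<lambda>i. b (i + Suc n)"] by (intro floor_unique) auto
  then show ?thesis by simp
qed

text \<open>
  The bits of \<open>g\<close> record, for all \<open>n\<close> and all rational \<open>q\<close>, whether \<open>e n\<close> exceeds \<open>q\<close>.
\<close>

lemma countably_generated_by_real_function: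
  fixes e :: "nat \<Rightarrow> 'a \<Rightarrow> real"
  assumes [measurable]: "\<And>n. e n \<in> borel_measurable M"
  shows "\<exists>g::'a \<Rightarrow> real. g \<in> borel_measurable M \<and> (\<forall>n. e n \<in> borel_measurable (vimage_algebra (space M) g borel))"
proof -
  define q where "q m = real_of_rat (from_nat m)" for m
  define b where "b x i = (case prod_decode i of (n, m) \<Rightarrow> q m < e n x)" for x i
  define g where "g x = base4 (b x)" for x
  have "Measurable.pred M (\<lambda>x. b x i)" for i
    unfolding b_def by (cases "prod_decode i") simp
  then have "(\<lambda>x. of_bool (b x i) :: real) \<in> borel_measurable M" for i
    unfolding of_bool_def by measurable
  then have [measurable]: "g \<in> borel_measurable M"
    unfolding g_def base4_def
    by (intro borel_measurable_suminf borel_measurable_times borel_measurable_const)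
  let ?F = "vimage_algebra (space M) g borel"
  have [measurable]: "g \<in> borel_measurable ?F" by (rule measurable_vimage_algebra1) simp
  have level: "{x \<in> space ?F. q m < e n x} \<in> sets ?F" for n m
  proof -
    have "q m < e n x \<longleftrightarrow> odd \<lfloor>4 ^ Suc (prod_encode (n, m)) * g x\<rfloor>" for x
      unfolding g_def base4_digit by (simp add: b_def)
    then have "{x \<in> space ?F. q m < e n x} = {x \<in> space ?F. odd \<lfloor>4 ^ Suc (prod_encode (n, m)) * g x\<rfloor>}"
      by simp
    also have "\<dots> \<in> sets ?F" by measurable
    finally show ?thesis .
  qed
  have "e n \<in> borel_measurable ?F" for n
    unfolding borel_measurable_iff_greater
  proof
    fix a
    have "{x \<in> space ?F. a < e n x} = (\<Union>m\<in>{m. a < q m}. {x \<in> space ?F. q m < e n x})"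
    proof safe
      fix x assume "x \<in> space ?F" "a < e n x"
      then obtain r where r: "a < real_of_rat r" "real_of_rat r < e n x" using of_rat_dense by blast
      then show "x \<in> (\<Union>m\<in>{m. a < q m}. {x \<in> space ?F. q m < e n x})"
        using \<open>x \<in> space ?F\<close> by (intro UN_I[of "to_nat r"]) (auto simp: q_def)
    qed auto
    also have "\<dots> \<in> sets ?F" using level by (intro sets.countable_UN'') auto
    finally show "{x \<in> space ?F. a < e n x} \<in> sets ?F" .
  qed
  then show ?thesis using \<open>g \<in> borel_measurable M\<close> by blast
qed

text \<open>
  The sum over \<open>j\<close> of the functions \<open>\<bar>f - d j\<bar>\<^sup>p\<close> has a finite integral, so it is finite almost
  everywhere and its terms tend to zero there.
\<close>

lemma pmass_fast_convergence_AE: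
  fixes f :: "'a \<Rightarrow> real" and d :: "nat \<Rightarrow> 'a \<Rightarrow> real"
  assumes p: "0 < p" and [measurable]: "f \<in> borel_measurable M" "\<And>n. d n \<in> borel_measurable M"
    and fast: "\<And>j. pmass M p (\<lambda>x. f x - d j x) < ennreal ((1/2) ^ j)"
  shows "AE x in M. (\<lambda>j. d j x) \<longlonglongrightarrow> f x"
proof -
  have "(\<integral>\<^sup>+x. (\<Sum>j. ennreal (\<bar>f x - d j x\<bar> powr p)) \<partial>M) = (\<Sum>j. pmass M p (\<lambda>x. f x - d j x))"
    unfolding pmass_def by (rule nn_integral_suminf) measurable
  also have "\<dots> \<le> (\<Sum>j. ennreal ((1/2) ^ j))"
    by (intro suminf_le less_imp_le[OF fast]) auto
  also have "\<dots> < \<infinity>" by (simp add: suminf_half_powers)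
  finally have "(\<integral>\<^sup>+x. (\<Sum>j. ennreal (\<bar>f x - d j x\<bar> powr p)) \<partial>M) \<noteq> \<infinity>" by simp
  then have "AE x in M. (\<Sum>j. ennreal (\<bar>f x - d j x\<bar> powr p)) \<noteq> \<infinity>"
    by (intro nn_integral_PInf_AE) measurable
  then show ?thesis
  proof eventually_elim
    case (elim x)
    then have "summable (\<lambda>j. \<bar>f x - d j x\<bar> powr p)" by (intro summable_suminf_not_top) auto
    then have "(\<lambda>j. \<bar>f x - d j x\<bar> powr p) \<longlonglongrightarrow> 0" by (rule summable_LIMSEQ_zero)
    then have "(\<lambda>j. (\<bar>f x - d j x\<bar> powr p) powr (1 / p)) \<longlonglongrightarrow> 0 powr (1 / p)"
      using p by (intro tendsto_powr') auto
    then have "(\<lambda>j. \<bar>f x - d j x\<bar>) \<longlonglongrightarrow> 0" using p by (simp add: powr_powr)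
    then have "(\<lambda>j. f x - d j x) \<longlonglongrightarrow> 0" by (rule tendsto_rabs_zero_cancel)
    then have "(\<lambda>j. f x - (f x - d j x)) \<longlonglongrightarrow> f x - 0" by (intro tendsto_diff tendsto_const)
    then show ?case by simp
  qed
qed

text \<open>
  The density \<open>w\<^sup>p\<close> is a normalized sum of truncations of the \<open>\<bar>d n\<bar>\<^sup>p\<close> with small coefficients; it
  vanishes only where all \<open>d n\<close> do, which makes up for a measure that need not be sigma-finite. The
  function \<open>g\<close> generates a sigma-algebra for which \<open>w\<close> and all \<open>d n\<close> are measurable. Every \<open>f\<close> is almost
  everywhere a limit of some of the \<open>d n\<close>, so \<open>f / w\<close> has a version that is a function of \<open>g\<close>.
\<close>

theorem separable_coding:
  fixes M :: "'a measure" and d :: "nat \<Rightarrow> 'a \<Rightarrow> real"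
  assumes p: "1 < p" and d: "\<And>n. d n \<in> pfuns M p"
    and dense: "\<And>f e. f \<in> pfuns M p \<Longrightarrow> 0 < e \<Longrightarrow> \<exists>n. pmass M p (\<lambda>x. f x - d n x) < ennreal e"
    and nontrivial: "\<exists>n. \<not> (AE x in M. d n x = 0)"
  shows "\<exists>w g \<rho>. weighted_composition M w g \<rho> p \<and>
    (\<forall>f\<in>pfuns M p. \<exists>h\<in>borel_measurable borel. AE x in M. f x = w x * h (g x))"
proof -
  have [measurable]: "d n \<in> borel_measurable M" for n by (rule pfuns_measurable[OF d])
  define c where "c n = (1/2) ^ n / (1 + enn2real (pmass M p (d n)))" for n
  have c: "0 < c n" "c n \<le> (1/2) ^ n" for n
  proof -
    have 1: "1 \<le> 1 + enn2real (pmass M p (d n))" by simp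
    then show "0 < c n" unfolding c_def by (intro divide_pos_pos) (auto intro: less_le_trans[OF zero_less_one])
    show "c n \<le> (1/2) ^ n" unfolding c_def
      using divide_left_mono[OF 1, of "(1/2) ^ n"] 1 by simp
  qed
  define t where "t n x = c n * min 1 (\<bar>d n x\<bar> powr p)" for n x
  have t: "0 \<le> t n x" "t n x \<le> (1/2) ^ n" for n x
  proof -
    show "0 \<le> t n x" using c(1)[of n] by (simp add: t_def)
    have "t n x \<le> c n * 1" unfolding t_def using c(1)[of n] by (intro mult_left_mono) auto
    then show "t n x \<le> (1/2) ^ n" using c(2)[of n] by simp
  qed
  have [measurable]: "t n \<in> borel_measurable M" for n unfolding t_def by measurable
  have summ: "summable (\<lambda>n. t n x)" for x
    by (rule summable_comparison_test'[of "\<lambda>n. (1/2::real) ^ n" 0]) (use t in auto)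
  define u where "u x = (\<Sum>n. t n x)" for x
  have u_nonneg: "0 \<le> u x" for x unfolding u_def using t summ by (intro suminf_nonneg) auto
  have t_le_u: "t n x \<le> u x" for n x
    using sum_le_suminf[OF summ, of "{n}" x] t by (auto simp: u_def)
  have [measurable]: "u \<in> borel_measurable M" unfolding u_def by (intro borel_measurable_suminf) measurable
  have "(\<integral>\<^sup>+x. ennreal (u x) \<partial>M) = (\<integral>\<^sup>+x. (\<Sum>n. ennreal (t n x)) \<partial>M)"
    unfolding u_def using t summ by (intro nn_integral_cong suminf_ennreal2[symmetric]) auto
  also have "\<dots> = (\<Sum>n. \<integral>\<^sup>+x. ennreal (t n x) \<partial>M)" by (rule nn_integral_suminf) measurable
  also have "\<dots> \<le> (\<Sum>n. ennreal ((1/2) ^ n))"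
  proof (intro suminf_le)
    fix n
    have "(\<integral>\<^sup>+x. ennreal (t n x) \<partial>M) \<le> (\<integral>\<^sup>+x. ennreal (c n) * ennreal (\<bar>d n x\<bar> powr p) \<partial>M)"
      using c(1)[of n] by (intro nn_integral_mono) (auto simp: t_def simp flip: ennreal_mult intro!: ennreal_leI)
    also have "\<dots> = ennreal (c n) * pmass M p (d n)" by (simp add: nn_integral_cmult pmass_def)
    also have "\<dots> = ennreal (c n) * ennreal (enn2real (pmass M p (d n)))"
      using d[of n] by (simp add: pfuns_iff)
    also have "\<dots> = ennreal (c n * enn2real (pmass M p (d n)))" using c(1)[of n] by (simp flip: ennreal_mult)
    also have "\<dots> \<le> ennreal ((1/2) ^ n)"
    proof (rule ennreal_leI)
      have frac: "r / (1 + r) \<le> 1" if "0 \<le> r" for r :: real using that by (simp add: field_simps)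
      have "enn2real (pmass M p (d n)) / (1 + enn2real (pmass M p (d n))) \<le> 1"
        by (rule frac) simp
      then show "c n * enn2real (pmass M p (d n)) \<le> (1/2) ^ n"
        unfolding c_def using mult_left_le[of "enn2real (pmass M p (d n)) / (1 + enn2real (pmass M p (d n)))" "(1/2) ^ n"]
        by simp
    qed
    finally show "(\<integral>\<^sup>+x. ennreal (t n x) \<partial>M) \<le> ennreal ((1/2) ^ n)" .
  qed auto
  also have "\<dots> < \<infinity>" by (simp add: suminf_half_powers)
  finally obtain Z where Z: "(\<integral>\<^sup>+x. ennreal (u x) \<partial>M) = ennreal Z" "0 \<le> Z"
    by (cases "\<integral>\<^sup>+x. ennreal (u x) \<partial>M") auto
  have d_zero: "d n x = 0" if "u x = 0" for n x
  proof -
    have "t n x = 0" using t_le_u[of n x] t(1)[of n x] that by simp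
    then show ?thesis using c(1)[of n] by (auto simp: t_def min_def split: if_splits)
  qed
  have "Z \<noteq> 0"
  proof
    assume "Z = 0"
    then have "AE x in M. u x = 0"
      using Z(1) nn_integral_0_iff_AE[of "\<lambda>x. ennreal (u x)" M] u_nonneg
      by (auto simp: ennreal_eq_0_iff elim!: eventually_mono intro: antisym)
    then have "AE x in M. d n x = 0" for n by eventually_elim (rule d_zero)
    then show False using nontrivial by blast
  qed
  with Z have Zpos: "0 < Z" by simp
  \<comment> \<open>the density itself has to be measurable with respect to \<open>g\<close> as well\<close>
  define e where "e n = (case n of 0 \<Rightarrow> u | Suc n \<Rightarrow> d n)" for n
  have "e n \<in> borel_measurable M" for n unfolding e_def by (cases n) auto
  then obtain g :: "'a \<Rightarrow> real" where g [measurable]: "g \<in> borel_measurable M"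
    and eF: "\<And>n. e n \<in> borel_measurable (vimage_algebra (space M) g borel)"
    using countably_generated_by_real_function[of e M] by blast
  let ?F = "vimage_algebra (space M) g borel"
  have [measurable]: "u \<in> borel_measurable ?F" "d n \<in> borel_measurable ?F" for n
    using eF[of 0] eF[of "Suc n"] by (simp_all add: e_def)
  define w where "w x = (u x / Z) powr (1 / p)" for x
  have w_powr: "w x powr p = u x / Z" for x
    using p Zpos u_nonneg[of x] by (simp add: w_def powr_powr)
  define \<rho> where "\<rho> = distr (density M (\<lambda>x. ennreal (w x powr p))) borel g"
  have "weighted_composition M w g \<rho> p"
  proof (rule weighted_composition.intro)
    show "w \<in> borel_measurable M" unfolding w_def by measurable
    have "prob_space (density M (\<lambda>x. ennreal (w x powr p)))"
    proof
      have "emeasure (density M (\<lambda>x. ennreal (w x powr p))) (space M) = (\<integral>\<^sup>+x. ennreal (1 / Z) * ennreal (u x) \<partial>M)"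
        unfolding w_powr using Zpos u_nonneg
        by (subst emeasure_density) (auto intro!: nn_integral_cong simp flip: ennreal_mult)
      also have "\<dots> = ennreal (1 / Z) * ennreal Z" by (simp add: nn_integral_cmult Z)
      also have "\<dots> = 1" using Zpos by (simp flip: ennreal_mult)
      finally show "emeasure (density M (\<lambda>x. ennreal (w x powr p)))
          (space (density M (\<lambda>x. ennreal (w x powr p)))) = 1" by simp
    qed
    then show "prob_space \<rho>" unfolding \<rho>_def by (rule prob_space.prob_space_distr) simp
    show "1 < p" by (rule p)
    show "0 \<le> w x" for x by (simp add: w_def)
    show "distr (density M (\<lambda>x. ennreal (w x powr p))) borel g = \<rho>" by (simp add: \<rho>_def)
  qed (rule g)
  moreover have "\<exists>h\<in>borel_measurable borel. AE x in M. f x = w x * h (g x)" if f: "f \<in> pfuns M p" for f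
  proof -
    have [measurable]: "f \<in> borel_measurable M" by (rule pfuns_measurable[OF f])
    have "\<exists>n. pmass M p (\<lambda>x. f x - d n x) < ennreal ((1/2) ^ j)" for j :: nat
      by (rule dense[OF f]) simp
    then obtain n where n: "\<And>j. pmass M p (\<lambda>x. f x - d (n j) x) < ennreal ((1/2) ^ j)" by metis
    have lim: "AE x in M. (\<lambda>j. d (n j) x) \<longlonglongrightarrow> f x"
      by (rule pmass_fast_convergence_AE[OF _ _ _ n]) (use p in auto)
    define \<phi> where "\<phi> x = lim (\<lambda>j. d (n j) x) / w x" for x
    have "\<phi> \<in> borel_measurable ?F" unfolding \<phi>_def w_def by measurable
    then have "\<exists>h\<in>borel_measurable borel. \<forall>x\<in>space M. \<phi> x = h (g x)"
      by (intro vimage_algebra_factor) simp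
    then obtain h where h: "h \<in> borel_measurable borel" "\<And>x. x \<in> space M \<Longrightarrow> \<phi> x = h (g x)"
      by blast
    have "AE x in M. f x = w x * h (g x)"
      using lim AE_space
    proof eventually_elim
      case (elim x)
      have "f x = w x * \<phi> x"
      proof (cases "u x = 0")
        case True
        then have "(\<lambda>j. d (n j) x) = (\<lambda>j. 0)" by (simp add: d_zero)
        with elim(1) have "f x = 0" by (metis LIMSEQ_unique tendsto_const)
        then show ?thesis using True by (simp add: w_def)
      next
        case False
        then have "w x \<noteq> 0" using Zpos by (simp add: w_def)
        then show ?thesis using limI[OF elim(1)] by (simp add: \<phi>_def)
      qed
      then show ?case using h(2) elim(2) by simp
    qed
    with h(1) show ?thesis by blast
  qed
  ultimately show ?thesis by blast
qed

section \<open>Commutators of positive maps on functions\<close>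

text \<open>
  Transports compose: a piece of \<open>\<rho>\<close> that \<open>\<kappa>\<close> transports to \<open>\<rho>\<close> pulls back along \<open>k\<close>.
\<close>

lemma (in weighted_composition) weighted_composition_copy:
  assumes [measurable]: "a \<in> borel_measurable borel" "\<kappa> \<in> borel_measurable borel"
    and a: "\<And>y. 0 \<le> a y" and copy: "distr (density \<rho> (\<lambda>y. ennreal (a y))) borel \<kappa> = \<rho>"
  shows "weighted_composition M (\<lambda>x. w x * a (k x) powr (1 / p)) (\<lambda>x. \<kappa> (k x)) \<rho> p"
proof (rule weighted_composition.intro)
  have "distr (density M (\<lambda>x. ennreal ((w x * a (k x) powr (1 / p)) powr p))) borel (\<lambda>x. \<kappa> (k x))
      = distr (density \<rho> (\<lambda>y. ennreal (a y))) borel \<kappa>" (is "?L = ?R")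
  proof (rule measure_eqI)
    fix B assume "B \<in> sets ?L"
    then have [measurable]: "B \<in> sets borel" by simp
    have "emeasure ?L B = (\<integral>\<^sup>+y. indicator B y \<partial>?L)" by simp
    also have "\<dots> = (\<integral>\<^sup>+x. ennreal (w x powr p) * (ennreal (a (k x)) * indicator B (\<kappa> (k x))) \<partial>M)"
      using w_nonneg a p_pos
      by (subst nn_integral_distr, measurable, subst nn_integral_density)
         (auto intro!: nn_integral_cong simp: powr_mult powr_powr ennreal_mult mult.assoc)
    also have "\<dots> = (\<integral>\<^sup>+x. ennreal (a (k x)) * indicator B (\<kappa> (k x)) \<partial>m)"
      unfolding m_def by (subst nn_integral_density) auto
    also have "\<dots> = (\<integral>\<^sup>+y. ennreal (a y) * indicator B (\<kappa> y) \<partial>\<rho>)"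
      unfolding \<rho>_distr by (subst nn_integral_distr) auto
    also have "\<dots> = (\<integral>\<^sup>+y. indicator B y \<partial>?R)"
      by (subst nn_integral_distr, measurable, subst nn_integral_density) auto
    also have "\<dots> = emeasure ?R B" by simp
    finally show "emeasure ?L B = emeasure ?R B" .
  qed simp
  then show "distr (density M (\<lambda>x. ennreal ((w x * a (k x) powr (1 / p)) powr p))) borel (\<lambda>x. \<kappa> (k x)) = \<rho>"
    using copy by simp
  show "0 \<le> w x * a (k x) powr (1 / p)" for x using w_nonneg[of x] by simp
  show "1 < p" by (rule p_gt_1)
  show "(\<lambda>x. w x * a (k x) powr (1 / p)) \<in> borel_measurable M" by measurable
  show "(\<lambda>x. \<kappa> (k x)) \<in> borel_measurable M" by measurable
  show "prob_space \<rho>" by (rule prob_\<rho>)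
qed

text \<open>
  The index set consists of real numbers because it will be a set of atoms of a measure on the line;
  an indexed family need not be injective.
\<close>

definition pfuns_infinite_dimensional :: "'a measure \<Rightarrow> real \<Rightarrow> bool" where
  "pfuns_infinite_dimensional M p \<longleftrightarrow>
     \<not> (\<exists>I (b :: real \<Rightarrow> 'a \<Rightarrow> real). finite I \<and> (\<forall>i\<in>I. b i \<in> pfuns M p) \<and>
       (\<forall>f\<in>pfuns M p. \<exists>c. AE x in M. f x = (\<Sum>i\<in>I. c i * b i x)))"

text \<open>
  The sets where the weights \<open>v n\<close> are positive are disjoint and each carries a copy of the whole space.
  A subsequence of them on which \<open>c\<close> decays fast enough, preceded by the complement of their union, is the
  partition for the shift.
\<close>

lemma positive_commutator_functions:
  fixes M :: "'a measure" and d :: "nat \<Rightarrow> 'a \<Rightarrow> real"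
  assumes p: "1 < p" and d: "\<And>n. d n \<in> pfuns M p"
    and dense: "\<And>f e. f \<in> pfuns M p \<Longrightarrow> 0 < e \<Longrightarrow> \<exists>n. pmass M p (\<lambda>x. f x - d n x) < ennreal e"
    and infdim: "pfuns_infinite_dimensional M p"
    and c: "semicompact_pos_map M p K c"
  shows "\<exists>A B KA KB. pos_map M M p KA A \<and> pos_map M M p KB B \<and>
    (\<forall>f\<in>pfuns M p. AE x in M. A (B f) x - B (A f) x = c f x)"
proof -
  have nontrivial: "\<exists>n. \<not> (AE x in M. d n x = 0)"
  proof (rule ccontr)
    assume "\<not> ?thesis"
    then have zero: "AE x in M. d n x = 0" for n by blast
    have "AE x in M. f x = 0" if f: "f \<in> pfuns M p" for f
    proof -
      have small: "pmass M p f \<le> 0 + ennreal e" if e: "0 < e" for e :: real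
      proof -
        obtain n where n: "pmass M p (\<lambda>x. f x - d n x) < ennreal e" using dense[OF f e] by blast
        have "pmass M p f = pmass M p (\<lambda>x. f x - d n x)"
          using zero[of n] by (intro pmass_cong_AE) (auto elim: eventually_mono)
        with n show ?thesis by simp
      qed
      have "pmass M p f \<le> 0" by (rule ennreal_le_epsilon) (rule small)
      then show ?thesis using pmass_eq_0_iff[OF pfuns_measurable[OF f]] by simp
    qed
    then show False using infdim unfolding pfuns_infinite_dimensional_def
      by (auto dest!: spec[of _ "{} :: real set"])
  qed
  obtain w g \<rho> where wc: "weighted_composition M w g \<rho> p"
    and onto: "\<And>f. f \<in> pfuns M p \<Longrightarrow> \<exists>h\<in>borel_measurable borel. AE x in M. f x = w x * h (g x)"
    using separable_coding[OF p d dense nontrivial] by blast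
  interpret U: weighted_composition M w g \<rho> p by fact
  have U_left_inverse: "AE x in M. U.\<Psi> (U.\<Theta> f) x = f x" if f: "f \<in> pfuns M p" for f
  proof -
    obtain h where h: "h \<in> borel_measurable borel" "AE x in M. f x = U.\<Psi> h x"
      using onto[OF f] by (auto simp: U.\<Psi>_def)
    have [measurable]: "U.\<Psi> h \<in> borel_measurable M"
      using h(1) unfolding U.\<Psi>_def by measurable
    have "U.\<Psi> h \<in> pfuns M p"
      by (rule pfuns_cong_AE[OF f]) (use h(2) in \<open>auto elim: eventually_mono\<close>)
    then have h': "h \<in> pfuns \<rho> p" using h(1) by (simp add: U.\<Psi>_pfuns_iff)
    interpret T: pos_map M \<rho> p 1 U.\<Theta> by (rule U.pos_map_\<Theta>)
    interpret P: pos_map \<rho> M p 1 U.\<Psi> by (rule U.pos_map_\<Psi>)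
    have "AE y in \<rho>. U.\<Theta> f y = U.\<Theta> (U.\<Psi> h) y" by (rule T.cong[OF f \<open>U.\<Psi> h \<in> pfuns M p\<close> h(2)])
    with U.\<Theta>_\<Psi>[OF h'] have "AE y in \<rho>. U.\<Theta> f y = h y" by eventually_elim simp
    then have "AE x in M. U.\<Psi> (U.\<Theta> f) x = U.\<Psi> h x" by (rule P.cong[OF T.maps[OF f] h'])
    with h(2) show ?thesis by eventually_elim simp
  qed
  have dist: "real_distribution \<rho>"
    using U.prob_\<rho> U.sets_\<rho> by (simp add: real_distribution_def real_distribution_axioms_def)
  have inf: "\<not> (AE y in \<rho>. y \<in> A)" if A: "finite A" for A
  proof
    assume "AE y in \<rho>. y \<in> A"
    moreover have "A \<in> sets borel" using A by (intro borel_of_countable countable_finite)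
    ultimately have "AE x in M. 0 < w x \<longrightarrow> g x \<in> A"
      by (subst (asm) U.AE_\<rho>_iff) (auto simp: U.AE_m_iff)
    then have "AE x in M. U.\<Psi> h x = (\<Sum>y\<in>A. h y * U.\<Psi> (indicator {y}) x)" for h
    proof eventually_elim
      case (elim x)
      have "(\<Sum>y\<in>A. h y * U.\<Psi> (indicator {y}) x) = w x * (\<Sum>y\<in>A. h y * indicator {y} (g x))"
        by (simp add: U.\<Psi>_def sum_distrib_left mult.left_commute)
      also have "(\<Sum>y\<in>A. h y * indicator {y} (g x)) = (if g x \<in> A then h (g x) else 0)"
        using A by (simp add: indicator_def sum.delta)
      finally show ?case using elim U.w_nonneg[of x] by (auto simp: U.\<Psi>_def less_le)
    qed
    then have span: "\<exists>h. AE x in M. f x = (\<Sum>y\<in>A. h y * U.\<Psi> (indicator {y}) x)" if f: "f \<in> pfuns M p" for f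
    proof -
      obtain h where "AE x in M. f x = U.\<Psi> h x" using onto[OF f] by (auto simp: U.\<Psi>_def)
      with \<open>AE x in M. U.\<Psi> h x = (\<Sum>y\<in>A. h y * U.\<Psi> (indicator {y}) x)\<close>
      have "AE x in M. f x = (\<Sum>y\<in>A. h y * U.\<Psi> (indicator {y}) x)" by eventually_elim simp
      then show ?thesis by blast
    qed
    have mem: "U.\<Psi> (indicator {y}) \<in> pfuns M p" for y
    proof -
      interpret R: prob_space \<rho> by (rule U.prob_\<rho>)
      have [measurable]: "indicator {y} \<in> borel_measurable borel" by simp
      have "pmass \<rho> p (indicator {y}) \<le> (\<integral>\<^sup>+x. 1 \<partial>\<rho>)"
        unfolding pmass_def by (intro nn_integral_mono) (auto simp: indicator_def)
      also have "\<dots> < \<infinity>" by (simp add: R.emeasure_space_1)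
      finally have "(indicator {y} :: real \<Rightarrow> real) \<in> pfuns \<rho> p"
        by (simp add: pfuns_iff measurable_cong_sets[OF U.sets_\<rho> refl])
      then show ?thesis by (simp add: U.\<Psi>_pfuns_iff)
    qed
    have "\<exists>I (b :: real \<Rightarrow> 'a \<Rightarrow> real). finite I \<and> (\<forall>i\<in>I. b i \<in> pfuns M p) \<and>
        (\<forall>f\<in>pfuns M p. \<exists>c. AE x in M. f x = (\<Sum>i\<in>I. c i * b i x))"
      by (rule exI[of _ A], rule exI[of _ "\<lambda>y. U.\<Psi> (indicator {y})"])
         (intro conjI ballI A mem span)
    then show False using infdim unfolding pfuns_infinite_dimensional_def by (rule notE[rotated])
  qed
  obtain a \<kappa> where "disjoint_copies \<rho> a \<kappa>" using disjoint_copies_exist[OF dist inf] by blast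
  then have [measurable]: "a n \<in> borel_measurable borel" "\<kappa> n \<in> borel_measurable borel"
    and a: "0 \<le> a n y" and copy: "distr (density \<rho> (\<lambda>y. ennreal (a n y))) borel (\<kappa> n) = \<rho>"
    and disj: "n \<noteq> m \<Longrightarrow> a n y = 0 \<or> a m y = 0" for n m y
    unfolding disjoint_copies_def by auto
  define v where "v n x = w x * a n (g x) powr (1 / p)" for n x
  define l where "l n x = \<kappa> n (g x)" for n x
  have "weighted_composition M (v n) (l n) \<rho> p" for n
    unfolding v_def l_def by (rule U.weighted_composition_copy) (auto simp: a copy)
  then interpret V: weighted_composition M "v n" "l n" \<rho> p for n .
  define G where "G n = {x \<in> space M. 0 < v n x}" for n
  have G_sets [measurable]: "G n \<in> sets M" for n unfolding G_def by measurable
  have G_disj: "disjoint_family G"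
    unfolding disjoint_family_on_def
  proof (intro ballI impI)
    fix n m :: nat assume "n \<noteq> m"
    have "a n (g x) \<noteq> 0 \<and> a m (g x) \<noteq> 0" if "x \<in> G n" "x \<in> G m" for x
      using that by (auto simp: G_def v_def)
    then show "G n \<inter> G m = {}" using disj[OF \<open>n \<noteq> m\<close>] by blast
  qed
  interpret c: semicompact_pos_map M p K c by fact
  have "\<exists>n>r. (\<forall>f\<in>pfuns M p. pmass M p (cut (G n) (c f)) \<le> ennreal (4 powr (- (p + 1) * real i)) * pmass M p f) \<and>
      (\<forall>f\<in>pfuns M p. pmass M p (c (cut (G n) f)) \<le> ennreal (4 powr (- (p + 1) * real i)) * pmass M p f)"
    (is "\<exists>n>r. ?small i n") for r i :: nat
  proof -
    have "\<forall>\<^sub>F n in sequentially. r < n \<and> ?small i n"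
      by (intro eventually_conj eventually_gt_at_top c.eventually_small_range c.eventually_small_source)
         (use G_disj in auto)
    then show ?thesis using eventually_happens' sequentially_bot by blast
  qed
  then have "\<exists>r. \<forall>i. ?small (Suc i) (r i) \<and> r i < r (Suc i)"
    by (intro dependent_nat_choice) blast+
  then obtain r where r: "\<And>i. ?small (Suc i) (r i)" "\<And>i. r i < r (Suc i)" by blast
  have "strict_mono r" using r(2) by (simp add: strict_mono_Suc_iff)
  then have "inj r" by (rule strict_mono_imp_inj_on)
  define E where "E i = (case i of 0 \<Rightarrow> space M - (\<Union>j. G (r j)) | Suc j \<Rightarrow> G (r j))" for i
  interpret E: countable_partition M E
  proof
    show "E i \<in> sets M" for i unfolding E_def by (cases i) auto
    show "E i \<inter> E j = {}" if "i \<noteq> j" for i j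
      using that G_disj \<open>inj r\<close>
      by (cases i; cases j) (auto simp: E_def disjoint_family_on_def inj_eq)
    show "space M \<subseteq> (\<Union>i. E i)"
    proof
      fix x assume x: "x \<in> space M"
      show "x \<in> (\<Union>i. E i)"
      proof (cases "x \<in> (\<Union>j. G (r j))")
        case True
        then obtain j where "x \<in> E (Suc j)" by (auto simp: E_def)
        then show ?thesis by blast
      next
        case False
        then have "x \<in> E 0" using x by (simp add: E_def)
        then show ?thesis by blast
      qed
    qed
  qed
  define J where "J i f = V.\<Psi> (r i) (U.\<Theta> f)" for i f
  define Q where "Q i f = U.\<Psi> (V.\<Theta> (r i) f)" for i f
  interpret UT: pos_map M \<rho> p 1 U.\<Theta> by (rule U.pos_map_\<Theta>)
  interpret UP: pos_map \<rho> M p 1 U.\<Psi> by (rule U.pos_map_\<Psi>)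
  interpret VT: pos_map M \<rho> p 1 "V.\<Theta> n" for n by (rule V.pos_map_\<Theta>)
  interpret VP: pos_map \<rho> M p 1 "V.\<Psi> n" for n by (rule V.pos_map_\<Psi>)
  interpret shift_commutator M E p J Q K c "K + 1"
  proof (intro shift_commutator.intro shift_system.intro shift_system_axioms.intro
      shift_commutator_axioms.intro)
    show "countable_partition M E" by (rule E.countable_partition_axioms)
    show "pos_map M M p K c" by (rule c.pos_map_axioms)
    show "pos_map M M p 1 (J i)" for i
      using pos_map_compose[OF U.pos_map_\<Theta> V.pos_map_\<Psi>[of "r i"]] by (simp add: J_def[abs_def])
    show "pos_map M M p 1 (Q i)" for i
      using pos_map_compose[OF V.pos_map_\<Theta>[of "r i"] U.pos_map_\<Psi>] by (simp add: Q_def[abs_def])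
    show "AE x in M. Q i (cut (E (Suc i)) (J i f)) x = f x" if f: "f \<in> pfuns M p" for f i
    proof -
      have h: "U.\<Theta> f \<in> pfuns \<rho> p" by (rule UT.maps[OF f])
      have Jf: "J i f \<in> pfuns M p" unfolding J_def by (rule VP.maps[OF h])
      have cutJ: "cut (E (Suc i)) (J i f) \<in> pfuns M p" by (intro cut_pfuns c.p_pos E.E_sets Jf)
      have "AE x in M. cut (E (Suc i)) (J i f) x = J i f x"
        by (intro AE_I2) (simp add: E_def G_def J_def V.cut_\<Psi>)
      then have "AE y in \<rho>. V.\<Theta> (r i) (cut (E (Suc i)) (J i f)) y = V.\<Theta> (r i) (J i f) y"
        by (rule VT.cong[OF cutJ Jf])
      moreover have "AE y in \<rho>. V.\<Theta> (r i) (J i f) y = U.\<Theta> f y"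
        unfolding J_def by (rule V.\<Theta>_\<Psi>[OF h])
      ultimately have "AE y in \<rho>. V.\<Theta> (r i) (cut (E (Suc i)) (J i f)) y = U.\<Theta> f y"
        by eventually_elim simp
      then have "AE x in M. Q i (cut (E (Suc i)) (J i f)) x = U.\<Psi> (U.\<Theta> f) x"
        unfolding Q_def by (rule UP.cong[OF VT.maps[OF cutJ] h])
      with U_left_inverse[OF f] show ?thesis by eventually_elim simp
    qed
    show "K + 1 < \<infinity>" using c.K_finite by simp
    \<comment> \<open>\<open>K + 1\<close> is at least \<open>1\<close>, which serves the chosen sets, and at least \<open>K\<close>, which serves the rest \<open>E 0\<close>\<close>
    have le1: "e * t \<le> (K + 1) * e * t" for e t :: ennreal
      using mult_right_mono[of 1 "K + 1" "e * t"] by (simp add: mult.assoc)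
    have le0: "K * t \<le> (K + 1) * ennreal (4 powr (- (p + 1) * real 0)) * t" for t :: ennreal
      by (simp add: mult_right_mono)
    show "pmass M p (cut (E i) (c f)) \<le> (K + 1) * ennreal (4 powr (- (p + 1) * real i)) * pmass M p f"
      if f: "f \<in> pfuns M p" for i f
    proof (cases i)
      case 0
      show ?thesis unfolding 0
        by (rule order_trans[OF order_trans[OF pmass_cut_le[OF c.p_pos] c.mass[OF f]] le0])
    next
      case (Suc j)
      then show ?thesis using order_trans[OF _ le1] r(1)[of j] f by (simp add: E_def)
    qed
    show "pmass M p (c (cut (E i) f)) \<le> (K + 1) * ennreal (4 powr (- (p + 1) * real i)) * pmass M p f"
      if f: "f \<in> pfuns M p" for i f
    proof (cases i)
      case 0
      have "pmass M p (c (cut (E 0) f)) \<le> K * pmass M p (cut (E 0) f)"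
        by (intro c.mass cut_pfuns c.p_pos E.E_sets f)
      also have "\<dots> \<le> K * pmass M p f" by (intro mult_left_mono pmass_cut_le c.p_pos) simp
      finally show ?thesis unfolding 0 using le0 order_trans by blast
    next
      case (Suc j)
      then show ?thesis using order_trans[OF _ le1] r(1)[of j] f by (simp add: E_def)
    qed
  qed
  show ?thesis using pos_map_L pos_map_B commutator by blast
qed

section \<open>From functions to classes\<close>

lemma Lp_norm_pmass:
  assumes "f \<in> pfuns M p"
  shows "Lp_norm M p (Lp_class M p f) = enn2real (pmass M p f) powr (1 / p)"
  using assms by (simp add: Lp_norm_class pmass_eq_integral)

lemma Lp_norm_le_iff:
  assumes p: "0 < p" and f: "f \<in> pfuns M p" and r: "0 \<le> r"
  shows "Lp_norm M p (Lp_class M p f) \<le> r \<longleftrightarrow> pmass M p f \<le> ennreal (r powr p)"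
proof -
  define m where "m = (\<integral>x. \<bar>f x\<bar> powr p \<partial>M)"
  have m: "pmass M p f = ennreal m" "0 \<le> m" unfolding m_def by (auto intro: pmass_eq_integral f)
  have "m powr (1 / p) \<le> r \<longleftrightarrow> m \<le> r powr p"
  proof
    assume "m powr (1 / p) \<le> r"
    then have "(m powr (1 / p)) powr p \<le> r powr p" using p by (intro powr_mono2) auto
    then show "m \<le> r powr p" using m p by (simp add: powr_powr)
  next
    assume "m \<le> r powr p"
    then have "m powr (1 / p) \<le> (r powr p) powr (1 / p)" using m p by (intro powr_mono2) auto
    then show "m powr (1 / p) \<le> r" using r p by (simp add: powr_powr)
  qed
  then show ?thesis using m by (simp add: Lp_norm_pmass[OF f])
qed

lemma Lp_diff_class:
  assumes "0 < p" "f \<in> pfuns M p" "g \<in> pfuns M p"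
  shows "Lp_diff M p (Lp_class M p f) (Lp_class M p g) = Lp_class M p (\<lambda>x. f x - g x)"
  using assms by (simp add: Lp_diff_def Lp_scale_class Lp_add_class pfuns_scale[of g M p "-1", simplified])

lemma Lp_positive_operator_imp_pos_map:
  assumes p: "0 < p" and C: "Lp_positive_operator M p C"
  shows "\<exists>K c. pos_map M M p K c \<and> (\<forall>f\<in>pfuns M p. C (Lp_class M p f) = Lp_class M p (c f))"
proof -
  define c where "c f = (SOME h. h \<in> pfuns M p \<and> C (Lp_class M p f) = Lp_class M p h)" for f
  have op: "Lp_operator M p C" using C by (simp add: Lp_positive_operator_def)
  have "c f \<in> pfuns M p \<and> C (Lp_class M p f) = Lp_class M p (c f)" if f: "f \<in> pfuns M p" for f
  proof -
    have "C (Lp_class M p f) \<in> Lp M p"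
      using op Lp_class_in_Lp[OF f] by (simp add: Lp_operator_def)
    then have "\<exists>h. h \<in> pfuns M p \<and> C (Lp_class M p f) = Lp_class M p h" by (auto elim: Lp_cases)
    from someI_ex[OF this] show ?thesis unfolding c_def .
  qed
  then have c: "c f \<in> pfuns M p" and C_c: "C (Lp_class M p f) = Lp_class M p (c f)"
    if "f \<in> pfuns M p" for f using that by auto
  obtain k where k: "\<And>F. F \<in> Lp M p \<Longrightarrow> Lp_norm M p (C F) \<le> k * Lp_norm M p F"
    using op unfolding Lp_operator_def by blast
  \<comment> \<open>a negative \<open>k\<close> is possible when the space is trivial\<close>
  define k' where "k' = max k 0"
  have "pos_map M M p (ennreal (k' powr p)) c"
  proof
    show "AE x in M. c (\<lambda>x. f x + g x) x = c f x + c g x"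
      if f: "f \<in> pfuns M p" and g: "g \<in> pfuns M p" for f g
    proof -
      have "C (Lp_add M p (Lp_class M p f) (Lp_class M p g))
          = Lp_add M p (C (Lp_class M p f)) (C (Lp_class M p g))"
        using op Lp_class_in_Lp[OF f] Lp_class_in_Lp[OF g] by (simp add: Lp_operator_def)
      then have "Lp_class M p (c (\<lambda>x. f x + g x)) = Lp_class M p (\<lambda>x. c f x + c g x)"
        using p f g by (simp add: Lp_add_class C_c c pfuns_add)
      then show ?thesis using p f g by (subst (asm) Lp_class_eq_iff) (auto intro: c pfuns_add)
    qed
    show "AE x in M. c (\<lambda>x. r * f x) x = r * c f x" if f: "f \<in> pfuns M p" for r f
    proof -
      have "C (Lp_scale M p r (Lp_class M p f)) = Lp_scale M p r (C (Lp_class M p f))"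
        using op Lp_class_in_Lp[OF f] by (simp add: Lp_operator_def)
      then have "Lp_class M p (c (\<lambda>x. r * f x)) = Lp_class M p (\<lambda>x. r * c f x)"
        using f by (simp add: Lp_scale_class C_c c pfuns_scale)
      then show ?thesis using f by (subst (asm) Lp_class_eq_iff) (auto intro: c pfuns_scale)
    qed
    show "AE x in M. 0 \<le> c f x" if f: "f \<in> pfuns M p" and pos: "AE x in M. 0 \<le> f x" for f
    proof -
      have "Lp_le M (Lp_zero M p) (Lp_class M p f)"
        using pos f by (simp add: Lp_zero_def Lp_le_class)
      then have "Lp_le M (Lp_zero M p) (C (Lp_class M p f))"
        using C Lp_class_in_Lp[OF f] by (simp add: Lp_positive_operator_def)
      then show ?thesis using f by (simp add: C_c Lp_zero_def Lp_le_class c)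
    qed
    show "pmass M p (c f) \<le> ennreal (k' powr p) * pmass M p f" if f: "f \<in> pfuns M p" for f
    proof -
      define n where "n = Lp_norm M p (Lp_class M p f)"
      have n: "0 \<le> n" "ennreal (n powr p) = pmass M p f"
        using f p by (auto simp: n_def Lp_norm_pmass powr_powr pfuns_iff)
      have "Lp_norm M p (Lp_class M p (c f)) \<le> k * n"
        using k[OF Lp_class_in_Lp[OF f]] f by (simp add: C_c n_def)
      also have "\<dots> \<le> k' * n" using n by (simp add: k'_def mult_right_mono)
      finally have "pmass M p (c f) \<le> ennreal ((k' * n) powr p)"
        using n by (subst (asm) Lp_norm_le_iff[OF p c[OF f]]) (auto simp: k'_def)
      also have "\<dots> = ennreal (k' powr p) * pmass M p f"
        using n by (simp add: powr_mult ennreal_mult k'_def)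
      finally show ?thesis .
    qed
  qed (use p c in auto)
  with C_c show ?thesis by blast
qed

lemma pos_map_imp_Lp_positive_operator:
  assumes T: "pos_map M M p K T"
  shows "\<exists>A. Lp_positive_operator M p A \<and> (\<forall>f\<in>pfuns M p. A (Lp_class M p f) = Lp_class M p (T f))"
proof -
  interpret T: pos_map M M p K T by fact
  define A where "A F = Lp_class M p (T (SOME f. f \<in> F))" for F
  have A: "A (Lp_class M p f) = Lp_class M p (T f)" if f: "f \<in> pfuns M p" for f
  proof -
    define g where "g = (SOME g. g \<in> Lp_class M p f)"
    have "g \<in> Lp_class M p f" unfolding g_def by (rule someI[of _ f]) (rule Lp_class_self[OF f])
    then have g: "g \<in> pfuns M p" "AE x in M. g x = f x"
      by (auto simp: mem_Lp_class elim: eventually_mono)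
    have "AE x in M. T g x = T f x" by (rule T.cong[OF g(1) f g(2)])
    then show ?thesis unfolding A_def g_def[symmetric]
      by (subst Lp_class_eq_iff[OF T.maps[OF g(1)] T.maps[OF f]])
  qed
  obtain k where k: "K = ennreal k" "0 \<le> k" using T.K_finite by (cases K) auto
  have "Lp_positive_operator M p A"
    unfolding Lp_positive_operator_def Lp_operator_def
  proof (intro conjI ballI allI impI exI)
    show "A F \<in> Lp M p" if "F \<in> Lp M p" for F
      using that by (elim Lp_cases) (simp add: A Lp_class_in_Lp T.maps)
    show "A (Lp_add M p F G) = Lp_add M p (A F) (A G)" if F: "F \<in> Lp M p" and G: "G \<in> Lp M p" for F G
    proof -
      obtain f where "f \<in> pfuns M p" "F = Lp_class M p f" using F by (rule Lp_cases)
      moreover obtain g where "g \<in> pfuns M p" "G = Lp_class M p g" using G by (rule Lp_cases)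
      ultimately have fg: "f \<in> pfuns M p" "F = Lp_class M p f" "g \<in> pfuns M p" "G = Lp_class M p g"
        by simp_all
      have "Lp_class M p (T (\<lambda>x. f x + g x)) = Lp_class M p (\<lambda>x. T f x + T g x)"
        using T.add[OF fg(1,3)] fg by (subst Lp_class_eq_iff) (auto intro!: T.maps pfuns_add T.p_pos)
      then show ?thesis using fg T.p_pos by (simp add: Lp_add_class A pfuns_add T.maps)
    qed
    show "A (Lp_scale M p r F) = Lp_scale M p r (A F)" if F: "F \<in> Lp M p" for r F
    proof -
      obtain f where f: "f \<in> pfuns M p" "F = Lp_class M p f" using F by (rule Lp_cases)
      have "Lp_class M p (T (\<lambda>x. r * f x)) = Lp_class M p (\<lambda>x. r * T f x)"
        using T.scale[OF f(1)] f by (subst Lp_class_eq_iff) (auto intro!: T.maps pfuns_scale)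
      then show ?thesis using f by (simp add: Lp_scale_class A pfuns_scale T.maps)
    qed
    show "Lp_norm M p (A F) \<le> k powr (1 / p) * Lp_norm M p F" if F: "F \<in> Lp M p" for F
    proof -
      obtain f where f: "f \<in> pfuns M p" "F = Lp_class M p f" using F by (rule Lp_cases)
      have "enn2real (pmass M p (T f)) \<le> enn2real (ennreal k * pmass M p f)"
        using T.mass[OF f(1)] f(1) by (intro enn2real_mono) (auto simp: k pfuns_iff ennreal_mult_less_top)
      then have "enn2real (pmass M p (T f)) \<le> k * enn2real (pmass M p f)"
        using k by (simp add: enn2real_mult)
      then have "enn2real (pmass M p (T f)) powr (1 / p) \<le> (k * enn2real (pmass M p f)) powr (1 / p)"
        using T.p_pos by (intro powr_mono2) auto
      then show ?thesis using f k by (simp add: A Lp_norm_pmass T.maps powr_mult)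
    qed
    show "Lp_le M (Lp_zero M p) (A F)" if F: "F \<in> Lp M p" "Lp_le M (Lp_zero M p) F" for F
    proof -
      obtain f where f: "f \<in> pfuns M p" "F = Lp_class M p f" using F(1) by (rule Lp_cases)
      then have "AE x in M. 0 \<le> f x" using F(2) by (simp add: Lp_zero_def Lp_le_class)
      then have "AE x in M. 0 \<le> T f x" by (rule T.pos[OF f(1)])
      then show ?thesis using f by (simp add: A Lp_zero_def Lp_le_class T.maps)
    qed
  qed
  with A show ?thesis by blast
qed

lemma Lp_semicompact_imp_semicompact_pos_map:
  assumes p: "1 < p" and c: "pos_map M M p K c"
    and C_c: "\<And>f. f \<in> pfuns M p \<Longrightarrow> C (Lp_class M p f) = Lp_class M p (c f)"
    and sc: "Lp_semicompact M p C"
  shows "semicompact_pos_map M p K c"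
proof -
  interpret pos_map M M p K c by fact
  have "\<exists>u\<in>pfuns M p. (AE x in M. 0 \<le> u x) \<and> (\<forall>f\<in>pfuns M p. pmass M p f \<le> 1 \<longrightarrow>
      (\<exists>h\<in>pfuns M p. pmass M p h \<le> 1 \<and> (AE x in M. \<bar>c f x\<bar> \<le> u x + e * \<bar>h x\<bar>)))" if e: "0 < e" for e
  proof -
    obtain U where U: "U \<in> Lp M p" "Lp_le M (Lp_zero M p) U"
      and sub: "C ` Lp_unit_ball M p \<subseteq> {Lp_add M p G (Lp_scale M p e H) | G H.
               G \<in> Lp_interval M p (Lp_scale M p (-1) U) U \<and> H \<in> Lp_unit_ball M p}"
      using sc e unfolding Lp_semicompact_def Lp_almost_order_bounded_def by blast
    obtain u where u: "u \<in> pfuns M p" "U = Lp_class M p u" using U(1) by (auto elim!: Lp_cases)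
    have "AE x in M. 0 \<le> u x" using U(2) u by (simp add: Lp_zero_def Lp_le_class)
    moreover have "\<exists>h\<in>pfuns M p. pmass M p h \<le> 1 \<and> (AE x in M. \<bar>c f x\<bar> \<le> u x + e * \<bar>h x\<bar>)"
      if f: "f \<in> pfuns M p" "pmass M p f \<le> 1" for f
    proof -
      have "Lp_class M p f \<in> Lp_unit_ball M p"
        using f Lp_norm_le_iff[OF p_pos f(1), of 1] by (simp add: Lp_unit_ball_def Lp_class_in_Lp)
      then have "C (Lp_class M p f) \<in> C ` Lp_unit_ball M p" by (rule imageI)
      then obtain G H where GH: "C (Lp_class M p f) = Lp_add M p G (Lp_scale M p e H)"
          "G \<in> Lp_interval M p (Lp_scale M p (-1) U) U" "H \<in> Lp_unit_ball M p"
        using sub by blast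
      obtain g where g: "g \<in> pfuns M p" "G = Lp_class M p g"
        using GH(2) by (auto simp: Lp_interval_def elim!: Lp_cases)
      obtain h where h: "h \<in> pfuns M p" "H = Lp_class M p h"
        using GH(3) by (auto simp: Lp_unit_ball_def elim!: Lp_cases)
      have hmass: "pmass M p h \<le> 1"
        using GH(3) h Lp_norm_le_iff[OF p_pos h(1), of 1] by (simp add: Lp_unit_ball_def)
      have mu: "(\<lambda>x. - u x) \<in> pfuns M p" using pfuns_scale[OF u(1), of "-1"] by simp
      have gu: "AE x in M. - u x \<le> g x" "AE x in M. g x \<le> u x"
        using GH(2) u g mu by (simp_all add: Lp_interval_def Lp_scale_class Lp_le_class)
      have "Lp_class M p (c f) = Lp_class M p (\<lambda>x. g x + e * h x)"
        using GH(1) f g h p_pos by (simp add: C_c Lp_scale_class Lp_add_class pfuns_scale)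
      then have "AE x in M. c f x = g x + e * h x"
        using f g h p_pos by (subst (asm) Lp_class_eq_iff) (auto intro!: maps pfuns_add pfuns_scale)
      with gu have "AE x in M. \<bar>c f x\<bar> \<le> u x + e * \<bar>h x\<bar>"
      proof eventually_elim
        case (elim x)
        have "\<bar>c f x\<bar> \<le> \<bar>g x\<bar> + \<bar>e * h x\<bar>" unfolding elim(3) by (rule abs_triangle_ineq)
        also have "\<bar>g x\<bar> \<le> u x" using elim by simp
        finally show ?case using e by (simp add: abs_mult)
      qed
      with h(1) hmass show ?thesis by blast
    qed
    ultimately show ?thesis using u(1) by blast
  qed
  then show ?thesis using c p by (simp add: semicompact_pos_map_def semicompact_pos_map_axioms_def)
qed

lemma Lp_separable_imp_dense_sequence:
  assumes p: "0 < p" and sep: "Lp_separable M p"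
  shows "\<exists>d::nat \<Rightarrow> 'a \<Rightarrow> real. (\<forall>n. d n \<in> pfuns M p) \<and>
    (\<forall>f\<in>pfuns M p. \<forall>e>0. \<exists>n. pmass M p (\<lambda>x. f x - d n x) < ennreal e)"
proof -
  obtain D where D: "D \<subseteq> Lp M p" "countable D"
    and dense: "\<And>F e. F \<in> Lp M p \<Longrightarrow> 0 < e \<Longrightarrow> \<exists>G\<in>D. Lp_norm M p (Lp_diff M p F G) < e"
    using sep unfolding Lp_separable_def by blast
  have "D \<noteq> {}" using dense[OF Lp_zero_in_Lp, of 1] by auto
  define d where "d n = (SOME f. f \<in> pfuns M p \<and> from_nat_into D n = Lp_class M p f)" for n
  have d: "d n \<in> pfuns M p \<and> from_nat_into D n = Lp_class M p (d n)" for n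
  proof -
    have "from_nat_into D n \<in> Lp M p" using from_nat_into[OF \<open>D \<noteq> {}\<close>] D(1) by blast
    then have "\<exists>f. f \<in> pfuns M p \<and> from_nat_into D n = Lp_class M p f" by (auto elim: Lp_cases)
    from someI_ex[OF this] show ?thesis unfolding d_def .
  qed
  have "\<exists>n. pmass M p (\<lambda>x. f x - d n x) < ennreal e" if f: "f \<in> pfuns M p" and e: "0 < e" for f e
  proof -
    have e': "0 < (e / 2) powr (1 / p)" using e by simp
    obtain G where G: "G \<in> D" "Lp_norm M p (Lp_diff M p (Lp_class M p f) G) < (e / 2) powr (1 / p)"
      using dense[OF Lp_class_in_Lp[OF f] e'] by blast
    obtain n where n: "G = from_nat_into D n" using from_nat_into_surj[OF D(2) G(1)] by metis
    have dn: "d n \<in> pfuns M p" "G = Lp_class M p (d n)" using d[of n] n by auto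
    have "Lp_norm M p (Lp_class M p (\<lambda>x. f x - d n x)) \<le> (e / 2) powr (1 / p)"
      using G(2) dn f p by (simp add: Lp_diff_class)
    then have "pmass M p (\<lambda>x. f x - d n x) \<le> ennreal (((e / 2) powr (1 / p)) powr p)"
      using f dn p by (subst (asm) Lp_norm_le_iff) (auto intro: pfuns_diff)
    also have "\<dots> = ennreal (e / 2)" using e p by (simp add: powr_powr)
    also have "\<dots> < ennreal e" using e by (intro ennreal_lessI) auto
    finally show ?thesis by blast
  qed
  with d show ?thesis by blast
qed

lemma Lp_infinite_dimensional_imp_pfuns:
  assumes p: "0 < p" and inf: "Lp_infinite_dimensional M p"
  shows "pfuns_infinite_dimensional M p"
  unfolding pfuns_infinite_dimensional_def
proof
  assume "\<exists>I (b :: real \<Rightarrow> 'a \<Rightarrow> real). finite I \<and> (\<forall>i\<in>I. b i \<in> pfuns M p) \<and>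
       (\<forall>f\<in>pfuns M p. \<exists>c. AE x in M. f x = (\<Sum>i\<in>I. c i * b i x))"
  then obtain I and b :: "real \<Rightarrow> 'a \<Rightarrow> real" where Ib: "finite I \<and> (\<forall>i\<in>I. b i \<in> pfuns M p) \<and>
       (\<forall>f\<in>pfuns M p. \<exists>c. AE x in M. f x = (\<Sum>i\<in>I. c i * b i x))" by (elim exE)
  note I = conjunct1[OF Ib] and b = conjunct1[OF conjunct2[OF Ib]]
    and span = conjunct2[OF conjunct2[OF Ib]]
  let ?S = "(\<lambda>i. Lp_class M p (b i)) ` I"
  have comb: "Lp_class M p (\<lambda>x. \<Sum>i\<in>J. c i * b i x) \<in> Lp_span M p ?S" if "J \<subseteq> I" for c J
    using finite_subset[OF that I] that
  proof (induction J rule: finite_induct)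
    case empty
    show ?case using Lp_span.zero[of M p ?S] by (simp add: Lp_zero_def)
  next
    case (insert j J)
    have bj: "b j \<in> pfuns M p" using insert b by auto
    have sum: "(\<lambda>x. \<Sum>i\<in>J. c i * b i x) \<in> pfuns M p"
      using insert b p by (intro pfuns_sum pfuns_scale) auto
    have "Lp_add M p (Lp_scale M p (c j) (Lp_class M p (b j))) (Lp_class M p (\<lambda>x. \<Sum>i\<in>J. c i * b i x))
        \<in> Lp_span M p ?S"
      using insert by (intro Lp_span.step) auto
    then show ?case using insert bj sum p by (simp add: Lp_scale_class Lp_add_class pfuns_scale)
  qed
  have "Lp M p \<subseteq> Lp_span M p ?S"
  proof
    fix F assume "F \<in> Lp M p"
    then obtain f where f: "f \<in> pfuns M p" "F = Lp_class M p f" by (auto elim: Lp_cases)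
    obtain c where c: "AE x in M. f x = (\<Sum>i\<in>I. c i * b i x)" using bspec[OF span f(1)] by blast
    have "(\<lambda>x. \<Sum>i\<in>I. c i * b i x) \<in> pfuns M p" using b p by (intro pfuns_sum pfuns_scale) auto
    then have "F = Lp_class M p (\<lambda>x. \<Sum>i\<in>I. c i * b i x)"
      using f c by (simp add: Lp_class_eq_iff)
    then show "F \<in> Lp_span M p ?S" using comb[of I c] by simp
  qed
  moreover have "?S \<subseteq> Lp M p" using b by (auto intro: Lp_class_in_Lp)
  moreover have "finite ?S" using I by (rule finite_imageI)
  ultimately have "\<exists>S. finite S \<and> S \<subseteq> Lp M p \<and> Lp M p \<subseteq> Lp_span M p S"
    by (intro exI[of _ ?S] conjI)
  with inf show False unfolding Lp_infinite_dimensional_def by (rule notE)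
qed

theorem corollary5p5:
  fixes M :: "'a measure" and p :: real
    and C :: "('a \<Rightarrow> real) set \<Rightarrow> ('a \<Rightarrow> real) set"
  assumes "1 < p"
    and "Lp_separable M p"
    and "Lp_infinite_dimensional M p"
    and "Lp_positive_operator M p C"
    and "Lp_semicompact M p C"
  shows "\<exists>A B. Lp_positive_operator M p A \<and> Lp_positive_operator M p B \<and>
           (\<forall>F\<in>Lp M p. C F = Lp_diff M p (A (B F)) (B (A F)))"
proof -
  have p: "0 < p" using assms(1) by simp
  obtain K c where c: "pos_map M M p K c" and C_c: "\<And>f. f \<in> pfuns M p \<Longrightarrow> C (Lp_class M p f) = Lp_class M p (c f)"
    using Lp_positive_operator_imp_pos_map[OF p assms(4)] by blast
  obtain d :: "nat \<Rightarrow> 'a \<Rightarrow> real" where d: "\<And>n. d n \<in> pfuns M p"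
      "\<And>f e. f \<in> pfuns M p \<Longrightarrow> 0 < e \<Longrightarrow> \<exists>n. pmass M p (\<lambda>x. f x - d n x) < ennreal e"
    using Lp_separable_imp_dense_sequence[OF p assms(2)] by blast
  obtain a b Ka Kb where a: "pos_map M M p Ka a" and b: "pos_map M M p Kb b"
    and ab: "\<And>f. f \<in> pfuns M p \<Longrightarrow> AE x in M. a (b f) x - b (a f) x = c f x"
    using positive_commutator_functions[OF assms(1) d
        Lp_infinite_dimensional_imp_pfuns[OF p assms(3)]
        Lp_semicompact_imp_semicompact_pos_map[OF assms(1) c C_c assms(5)]] by blast
  interpret c: pos_map M M p K c by fact
  interpret a: pos_map M M p Ka a by fact
  interpret b: pos_map M M p Kb b by fact
  obtain A where A: "Lp_positive_operator M p A" "\<And>f. f \<in> pfuns M p \<Longrightarrow> A (Lp_class M p f) = Lp_class M p (a f)"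
    using pos_map_imp_Lp_positive_operator[OF a] by blast
  obtain B where B: "Lp_positive_operator M p B" "\<And>f. f \<in> pfuns M p \<Longrightarrow> B (Lp_class M p f) = Lp_class M p (b f)"
    using pos_map_imp_Lp_positive_operator[OF b] by blast
  have "C F = Lp_diff M p (A (B F)) (B (A F))" if "F \<in> Lp M p" for F
  proof -
    obtain f where f: "f \<in> pfuns M p" "F = Lp_class M p f" using \<open>F \<in> Lp M p\<close> by (auto elim: Lp_cases)
    have ab': "a (b f) \<in> pfuns M p" "b (a f) \<in> pfuns M p" using f by (auto intro: a.maps b.maps)
    have "Lp_diff M p (A (B F)) (B (A F)) = Lp_class M p (\<lambda>x. a (b f) x - b (a f) x)"
      using f ab' p by (simp add: A B a.maps b.maps Lp_diff_class)
    also have "\<dots> = Lp_class M p (c f)"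
      using ab[OF f(1)] ab' f p by (subst Lp_class_eq_iff) (auto intro: pfuns_diff c.maps)
    finally show ?thesis using f by (simp add: C_c)
  qed
  with A(1) B(1) show ?thesis by blast
qed

end
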